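(* Let $0<r<1$. (1) Let $\phi\in \mathrm{Mult}(\mathscr{H}^2(A_r))\cap\mathrm{Hol}(\mathbb{D})=H^\infty(\mathbb{D})$ (functions on $\mathbb{D}$ being identified with their restrictions to $A_r$). Then $\phi$ is $H^2(\mathbb{D})$-inner if and only if $\phi$ is a subinner multiplier of $\mathscr{H}^2(A_r)$. (2) Analogously, let $\phi\in H^\infty(\mathbb{D}_0)$. Then $\phi$ is $H^2(\mathbb{D}_0)$-inner if and only if $\phi$ is a subinner multiplier of $\mathscr{H}^2(A_r)$.
   Context: $\mathbb{D}$ is the open unit disk, $\mathbb{D}_0=\{|z|>r\}\cup\{\infty\}$, $A_r=\{z\in\mathbb{C}:r<|z|<1\}$; $\mathrm{Hol}$ denotes holomorphic functions and $H^\infty$ bounded holomorphic functions. $H^2(\mathbb{D})$-inner means inner in the classical sense on $\mathbb{D}$. A function $\phi$ is $H^2(\mathbb{D}_0)$-inner if $\phi(z)=g(r/z)$ with $g$ a classical inner function on $\mathbb{D}$. $\mathscr{H}^2(A_r)$ is the reproducing kernel Hilbert space on $A_r$ with kernel $k_r(\lambda,\mu)=\frac{1-r^2}{(1-\lambda\bar\mu)(1-r^2/(\lambda\bar\mu))}$; it consists of the holomorphic functions $f=\sum_{n\in\mathbb{Z}}c_nz^n$ on $A_r$ with $\|f\|^2_{\mathscr{H}^2(A_r)}=\sum_{n<0}r^{2n}|c_n|^2+\sum_{n\ge0}|c_n|^2<\infty$. $\mathrm{Mult}(\mathscr{H}^2(A_r))$ is the algebra of functions $\phi:A_r\to\mathbb{C}$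 with $\phi f\in\mathscr{H}^2(A_r)$ for all $f\in\mathscr{H}^2(A_r)$, normed by the operator norm of $f\mapsto\phi f$; as a set it equals $H^\infty(A_r)$ (known). A multiplier $\phi$ is subinner if its multiplier norm equals $1$ and there is a nonzero $h\in\mathscr{H}^2(A_r)$ with $\|\phi h\|_{\mathscr{H}^2(A_r)}=\|h\|_{\mathscr{H}^2(A_r)}$. *)

theory Defs
  imports "HOL-Complex_Analysis.Complex_Analysis"
begin

text \<open>
  Functions on a domain are total functions \<open>complex \<Rightarrow> complex\<close> of which only the values on
  the domain matter. A function on the disk is thereby identified with its restriction to the
  annulus.
\<close>

definition annulus :: "real \<Rightarrow> complex set" where
  "annulus r = {z. r < cmod z \<and> cmod z < 1}"

definition has_laurent :: "real \<Rightarrow> (complex \<Rightarrow> complex) \<Rightarrow> (int \<Rightarrow> complex) \<Rightarrow> bool" where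
  "has_laurent r f c \<longleftrightarrow> (\<forall>z\<in>annulus r. ((\<lambda>n. c n * z powi n) has_sum f z) UNIV)"

text \<open>For \<open>0 < r < 1\<close> the coefficients are unique whenever they exist.\<close>

definition laurent_coeff :: "real \<Rightarrow> (complex \<Rightarrow> complex) \<Rightarrow> int \<Rightarrow> complex" where
  "laurent_coeff r f = (THE c. has_laurent r f c)"

definition H2A_weight :: "real \<Rightarrow> int \<Rightarrow> real" where
  "H2A_weight r n = (if n < 0 then r powi (2 * n) else 1)"

definition H2A :: "real \<Rightarrow> (complex \<Rightarrow> complex) set" where
  "H2A r = {f. f holomorphic_on annulus r \<and>
     (\<exists>c. has_laurent r f c \<and> (\<lambda>n. H2A_weight r n * (cmod (c n))\<^sup>2) summable_on UNIV)}"

definition H2A_norm :: "real \<Rightarrow> (complex \<Rightarrow> complex) \<Rightarrow> real" where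
  "H2A_norm r f = sqrt (\<Sum>\<^sub>\<infinity>n. H2A_weight r n * (cmod (laurent_coeff r f n))\<^sup>2)"

definition Mult_H2A :: "real \<Rightarrow> (complex \<Rightarrow> complex) set" where
  "Mult_H2A r = {\<phi>. \<forall>f\<in>H2A r. (\<lambda>z. \<phi> z * f z) \<in> H2A r}"

text \<open>
  The operator norm is taken in the extended reals, so that the supremum is meaningful without
  first knowing that multiplication operators are bounded.
\<close>

definition mult_norm :: "real \<Rightarrow> (complex \<Rightarrow> complex) \<Rightarrow> ereal" where
  "mult_norm r \<phi> = (SUP f\<in>{f \<in> H2A r. H2A_norm r f \<le> 1}. ereal (H2A_norm r (\<lambda>z. \<phi> z * f z)))"

definition subinner :: "real \<Rightarrow> (complex \<Rightarrow> complex) \<Rightarrow> bool" where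
  "subinner r \<phi> \<longleftrightarrow> \<phi> \<in> Mult_H2A r \<and> mult_norm r \<phi> = 1 \<and>
     (\<exists>h\<in>H2A r. (\<exists>z\<in>annulus r. h z \<noteq> 0) \<and> H2A_norm r (\<lambda>z. \<phi> z * h z) = H2A_norm r h)"

definition Hol_disk :: "(complex \<Rightarrow> complex) set" where
  "Hol_disk = {\<phi>. \<phi> holomorphic_on ball 0 1}"

definition Hinf_disk :: "(complex \<Rightarrow> complex) set" where
  "Hinf_disk = {\<phi>. \<phi> holomorphic_on ball 0 1 \<and> bounded (\<phi> ` ball 0 1)}"

text \<open>
  Classical inner functions: bounded and holomorphic on the disk, with unimodular radial limits
  at almost every point of the unit circle.
\<close>

definition inner_disk :: "(complex \<Rightarrow> complex) \<Rightarrow> bool" where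
  "inner_disk g \<longleftrightarrow> g \<in> Hinf_disk \<and>
     (AE t in lborel. t \<in> {0..2*pi} \<longrightarrow>
        (\<exists>L. cmod L = 1 \<and> ((\<lambda>\<rho>. g (of_real \<rho> * cis t)) \<longlongrightarrow> L) (at_left 1)))"

text \<open>
  The domain \<open>{z. r < cmod z} \<union> {\<infinity>}\<close>. A function on it is given by its values at the finite
  points; \<open>a\<close> below is its value at \<open>\<infinity>\<close>, and holomorphy at \<open>\<infinity>\<close> is holomorphy at \<open>0\<close> in the
  chart \<open>w = 1/z\<close>. The value at \<open>\<infinity>\<close> is determined by the others.
\<close>

definition Hinf_ext :: "real \<Rightarrow> (complex \<Rightarrow> complex) set" where
  "Hinf_ext r = {\<phi>. \<phi> holomorphic_on {z. r < cmod z} \<and>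
     (\<exists>a. (\<lambda>w. if w = 0 then a else \<phi> (1 / w)) holomorphic_on ball 0 (1 / r)) \<and>
     bounded (\<phi> ` {z. r < cmod z})}"

definition inner_ext :: "real \<Rightarrow> (complex \<Rightarrow> complex) \<Rightarrow> bool" where
  "inner_ext r \<phi> \<longleftrightarrow> (\<exists>g. inner_disk g \<and> (\<forall>z. r < cmod z \<longrightarrow> \<phi> z = g (of_real r / z)))"

end

theory Submission
  imports Defs
begin

text \<open>
  The weight of the space is \<open>1\<close> at indices \<open>n \<ge> 0\<close> and grows as \<open>n\<close> decreases below \<open>0\<close>. Writing it as
  a sum of step functions (\<open>weight_layers\<close>) presents the squared norm of a Laurent series as the
  plain square sum of its coefficients plus a combination, with positive weights, of the square
  sums of its truncations to the indices \<open>\<le> k\<close>, for \<open>k < 0\<close>. Multiplication by a function \<open>\<phi>\<close>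
  that is holomorphic on the disk only moves coefficients upwards, so the truncation of \<open>\<phi> f\<close> at
  \<open>k\<close> is a part of \<open>\<phi>\<close> times the truncation of \<open>f\<close>. If \<open>norm \<phi> \<le> B\<close>, Parseval's identity on
  circles of radius \<open>\<rho> \<rightarrow> 1\<close> bounds each of these square sums by \<open>B\<^sup>2\<close> times the old one, and
  \<open>\<phi>\<close> is a multiplier of norm at most \<open>B\<close> (\<open>mult_H2A_seq\<close>).

  If \<open>\<phi>\<close> is inner, then so are its powers; the means of \<open>(norm (\<phi> ^ n))\<^sup>2\<close> over circles tend to
  \<open>1\<close>, so every power has norm \<open>1\<close>. Evaluation at a point being bounded, this forces
  \<open>norm \<phi> \<le> 1\<close>. Therefore \<open>\<phi>\<close> is a contraction, and it attains its norm at the constant \<open>1\<close>.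

  Conversely let \<open>\<phi>\<close> be a contractive multiplier that preserves the norm of some \<open>h \<noteq> 0\<close>. The
  powers of \<open>\<phi>\<close> show as before that \<open>norm \<phi> \<le> 1\<close>, and then no layer of the norm can lose
  anything: \<open>\<phi>\<close> preserves the square sum of \<open>h\<close> and of all its truncations at \<open>k < 0\<close>, hence the
  square sum of some nonzero series \<open>f\<close> that is one-sided, i.e. has a first or a last nonzero
  coefficient (\<open>mult_isometric_one_sided\<close>). In other words, the mean of
  \<open>(1 - (norm \<phi>)\<^sup>2) * (norm f)\<^sup>2\<close> over the circle of radius \<open>\<rho>\<close> tends to \<open>0\<close>.
  To conclude without boundary values of \<open>f\<close>, note that \<open>v = 1 - (norm \<phi>)\<^sup>2\<close> is, on that circle, the
  real part of a function that is analytic inside and whose value at the centre tends to \<open>1 - A\<close>, where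
  \<open>A\<close> is the square sum of the Taylor coefficients of \<open>\<phi>\<close>. The mean value property of
  \<open>f * exp (N * (v + \<i> * w))\<close>, with \<open>w\<close> a harmonic conjugate of this extension of \<open>v\<close> and with \<open>f\<close>
  divided by a monomial, or reflected in the circle, so that its extreme coefficient \<open>c m\<close>
  becomes the value at the centre, bounds
  \<open>norm (c m) * exp (N * (1 - A))\<close> by the mean of \<open>norm f * exp (N * v)\<close>. Since \<open>v\<close> is small
  in the mean wherever \<open>f\<close> is not, that mean stays bounded independently of \<open>N\<close> as \<open>\<rho> \<rightarrow> 1\<close>. Hence \<open>A = 1\<close>
  (\<open>isometric_imp_unit_norm\<close>). By Fatou's theorem \<open>\<phi>\<close> has radial limits almost everywhere; they have
  modulus at most \<open>1\<close> and mean square \<open>A = 1\<close>, so they are unimodular almost everywhere.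

  Fatou's theorem itself is obtained from the antiderivative of \<open>\<phi>\<close>, which is Lipschitz on the
  closed disk: a Lipschitz function on the circle is differentiable almost everywhere (by Vitali's
  covering theorem), and \<open>\<phi>\<close> has a radial limit at each point of differentiability.

  That a multiplier holomorphic on the disk is bounded there follows by testing it on a
  superposition of normalised Szego kernels at points where it is large. Finally, the
  statement about the exterior domain reduces to the disk, because \<open>f \<mapsto> (\<lambda>z. f (r / z))\<close> is an isometry
  of the space.
\<close>

section \<open>Means over the unit circle\<close>

text \<open>
  Normalised arc length, parametrised by angle over the interval that occurs in the definition of an inner
  function.
\<close>

definition circ :: "real measure" where
  "circ = uniform_measure lborel {0..2*pi}"

lemma space_circ [simp]: "space circ = UNIV"
  and sets_circ [simp, measurable_cong]: "sets circ = sets borel"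
  by (simp_all add: circ_def)

lemma circ_measurable_iff [simp]: "borel_measurable circ = borel_measurable borel"
  by (rule measurable_cong_sets) simp_all

lemma emeasure_circ_space: "emeasure circ UNIV = 1"
proof -
  have "emeasure circ UNIV = emeasure lborel {0..2*pi} / emeasure lborel {0..2*pi}"
    unfolding circ_def by (subst emeasure_uniform_measure) auto
  also have "\<dots> = 1"
    by (rule ennreal_divide_self) auto
  finally show ?thesis .
qed

interpretation circ: finite_measure circ
  by standard (simp add: emeasure_circ_space)

lemma measure_circ_UNIV [simp]: "measure circ UNIV = 1"
  by (simp add: measure_def emeasure_circ_space)

lemma AE_circ_iff: "(AE t in circ. P t) \<longleftrightarrow> (AE t in lborel. t \<in> {0..2*pi} \<longrightarrow> P t)"
  unfolding circ_def by (rule AE_uniform_measure) auto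

lemma circ_integrable:
  fixes f :: "real \<Rightarrow> 'a::{banach, second_countable_topology}"
  assumes "f \<in> borel_measurable borel" "\<And>t. norm (f t) \<le> B"
  shows "integrable circ f"
  by (rule circ.integrable_const_bound[of _ B]) (use assms in auto)

lemma norm_circ_integral_le:
  fixes f :: "real \<Rightarrow> 'a::{banach, second_countable_topology}"
  assumes "f \<in> borel_measurable borel" "\<And>t. norm (f t) \<le> B"
  shows "norm (integral\<^sup>L circ f) \<le> B"
proof -
  have "norm (integral\<^sup>L circ f) \<le> (\<integral>t. norm (f t) \<partial>circ)"
    by simp
  also have "\<dots> \<le> (\<integral>t. B \<partial>circ)"
    by (rule integral_mono) (use circ_integrable[OF assms] assms in auto)
  finally show ?thesis by simp
qed

lemma circ_integral_eq:
  fixes f :: "real \<Rightarrow> complex"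
  assumes "f \<in> borel_measurable borel"
  shows "integral\<^sup>L circ f = (LBINT t. indicat_real {0..2*pi} t *\<^sub>R f t) / (2*pi)"
proof -
  have eq: "indicator {0..2*pi} t / emeasure lborel {0..2*pi} = ennreal (indicat_real {0..2*pi} t / (2*pi))" for t
  proof -
    have "indicator {0..2*pi} t / emeasure lborel {0..2*pi} =
          ennreal (indicat_real {0..2*pi} t) / ennreal (2*pi)"
      by (simp add: ennreal_indicator)
    also have "\<dots> = ennreal (indicat_real {0..2*pi} t / (2*pi))"
      by (rule divide_ennreal) auto
    finally show ?thesis .
  qed
  have "circ = density lborel (\<lambda>t. ennreal (indicat_real {0..2*pi} t / (2*pi)))"
    unfolding circ_def uniform_measure_def eq ..
  hence "integral\<^sup>L circ f =
      integral\<^sup>L (density lborel (\<lambda>t. ennreal (indicat_real {0..2*pi} t / (2*pi)))) f"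
    by simp
  also have "\<dots> = (LBINT t. (indicat_real {0..2*pi} t / (2*pi)) *\<^sub>R f t)"
    using assms by (intro integral_density) auto
  also have "\<dots> = (LBINT t. (1 / (2*pi)) *\<^sub>R (indicat_real {0..2*pi} t *\<^sub>R f t))"
    by (intro Bochner_Integration.integral_cong) auto
  also have "\<dots> = (1 / (2*pi)) *\<^sub>R (LBINT t. indicat_real {0..2*pi} t *\<^sub>R f t)"
    by (rule integral_scaleR_right)
  finally show ?thesis by (simp add: scaleR_conv_of_real)
qed

lemma circ_integral_cis:
  fixes n :: int
  shows "(\<integral>t. cis (of_int n * t) \<partial>circ) = (if n = 0 then 1 else 0)"
proof (cases "n = 0")
  case True
  thus ?thesis by (simp add: space_circ)
next
  case False
  let ?F = "\<lambda>t. cis (of_int n * t) / (\<i> * of_int n)"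
  have "(?F has_vector_derivative cis (of_int n * x)) (at x within S)" for x S
  proof -
    have "((\<lambda>t. exp (\<i> * of_int n * of_real t) / (\<i> * of_int n)) has_vector_derivative
          exp (\<i> * of_int n * of_real x)) (at x within S)"
      by (rule has_vector_derivative_real_field) (use False in \<open>auto intro!: derivative_eq_intros\<close>)
    thus ?thesis by (simp add: cis_conv_exp mult_ac)
  qed
  hence "(LBINT t. indicat_real {0..2*pi} t *\<^sub>R cis (of_int n * t)) = ?F (2*pi) - ?F 0"
    by (intro integral_FTC_Icc) (auto intro!: continuous_intros)
  also have "\<dots> = 0"
    using cis_multiple_2pi[of "of_int n"] by (simp add: mult_ac)
  finally show ?thesis
    using False by (subst circ_integral_eq) (auto intro!: borel_measurable_continuous_onI continuous_intros)
qed

text \<open>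
  The majorant makes the finite partial sums converge uniformly.
\<close>

lemma has_sum_circ_integral:
  fixes g :: "'a \<Rightarrow> real \<Rightarrow> complex"
  assumes M: "M summable_on I"
    and bound: "\<And>n t. n \<in> I \<Longrightarrow> norm (g n t) \<le> M n"
    and meas: "\<And>n. n \<in> I \<Longrightarrow> g n \<in> borel_measurable borel"
    and sum: "\<And>t. ((\<lambda>n. g n t) has_sum G t) I"
    and measG: "G \<in> borel_measurable borel"
  shows "((\<lambda>n. \<integral>t. g n t \<partial>circ) has_sum (\<integral>t. G t \<partial>circ)) I"
proof -
  have u: "uniform_limit UNIV (\<lambda>X t. \<Sum>n\<in>X. g n t) G (finite_subsets_at_top I)"
    by (rule Weierstrass_m_test_general'[where M = M]) (use assms in auto)
  have "norm (G t) \<le> infsum M I" for t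
    by (rule norm_infsum_le[OF sum has_sum_infsum[OF M] bound])
  hence intG: "integrable circ G"
    using measG by (intro circ_integrable) auto
  have int: "integrable circ (g n)" if "n \<in> I" for n
    using that bound meas by (intro circ_integrable) auto
  show ?thesis
    unfolding has_sum_def
  proof (rule tendstoI)
    fix e :: real assume "e > 0"
    hence "\<forall>\<^sub>F X in finite_subsets_at_top I. \<forall>t\<in>UNIV. dist (\<Sum>n\<in>X. g n t) (G t) < e/2"
      using u half_gt_zero unfolding uniform_limit_iff by blast
    moreover have "\<forall>\<^sub>F X in finite_subsets_at_top I. finite X \<and> X \<subseteq> I"
      by (rule eventually_finite_subsets_at_top_weakI) auto
    ultimately show "\<forall>\<^sub>F X in finite_subsets_at_top I.
        dist (\<Sum>n\<in>X. \<integral>t. g n t \<partial>circ) (\<integral>t. G t \<partial>circ) < e"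
    proof eventually_elim
      case (elim X)
      have "(\<Sum>n\<in>X. \<integral>t. g n t \<partial>circ) - (\<integral>t. G t \<partial>circ) = (\<integral>t. (\<Sum>n\<in>X. g n t) - G t \<partial>circ)"
        using elim int intG
        by (subst Bochner_Integration.integral_diff) (auto intro!: Bochner_Integration.integrable_sum simp: Bochner_Integration.integral_sum subset_iff)
      also have "norm \<dots> \<le> e/2"
        by (rule norm_circ_integral_le)
           (use elim meas measG in \<open>auto simp: dist_norm less_imp_le intro!: borel_measurable_diff borel_measurable_sum\<close>)
      finally show ?case using \<open>e > 0\<close> by (simp add: dist_norm)
    qed
  qed
qed

lemma fourier_continuous:
  fixes c :: "int \<Rightarrow> complex"
  assumes "(\<lambda>n. norm (c n)) summable_on UNIV"
    and "\<And>t. ((\<lambda>n. c n * cis (of_int n * t)) has_sum F t) UNIV"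
  shows "continuous_on UNIV F"
proof -
  have u: "uniform_limit UNIV (\<lambda>X t. \<Sum>n\<in>X. c n * cis (of_int n * t)) F (finite_subsets_at_top UNIV)"
    by (rule Weierstrass_m_test_general'[where M = "\<lambda>n. norm (c n)"]) (use assms in \<open>auto simp: norm_mult\<close>)
  show ?thesis
    by (rule uniform_limit_theorem[OF _ u]) (auto intro!: continuous_intros always_eventually)
qed

lemma fourier_coeff:
  fixes c :: "int \<Rightarrow> complex"
  assumes c: "(\<lambda>n. norm (c n)) summable_on UNIV"
    and F: "\<And>t. ((\<lambda>n. c n * cis (of_int n * t)) has_sum F t) UNIV"
  shows "(\<integral>t. F t * cis (- of_int k * t) \<partial>circ) = c k"
proof -
  have contF: "continuous_on UNIV F" by (rule fourier_continuous[OF c F])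
  have "((\<lambda>n. \<integral>t. c n * cis (of_int n * t) * cis (- of_int k * t) \<partial>circ) has_sum
        (\<integral>t. F t * cis (- of_int k * t) \<partial>circ)) UNIV"
  proof (rule has_sum_circ_integral[OF c])
    show "((\<lambda>n. c n * cis (of_int n * t) * cis (- of_int k * t)) has_sum F t * cis (- of_int k * t)) UNIV" for t
      by (rule has_sum_cmult_left[OF F])
  qed (auto simp: norm_mult intro!: borel_measurable_continuous_onI continuous_intros contF)
  moreover have "(\<integral>t. c n * cis (of_int n * t) * cis (- of_int k * t) \<partial>circ) = (if n = k then c k else 0)" for n
  proof -
    have "(\<integral>t. c n * cis (of_int n * t) * cis (- of_int k * t) \<partial>circ) =
          (\<integral>t. c n * cis (of_int (n - k) * t) \<partial>circ)"
      by (intro Bochner_Integration.integral_cong) (auto simp: cis_mult algebra_simps)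
    thus ?thesis using circ_integral_cis[of "n - k"] by simp
  qed
  ultimately have "((\<lambda>n. if n = k then c k else 0) has_sum
      (\<integral>t. F t * cis (- of_int k * t) \<partial>circ)) UNIV" by simp
  moreover have "((\<lambda>n. if n = k then c k else 0) has_sum c k) UNIV"
    by (rule has_sum_finite_neutralI[of "{k}"]) auto
  ultimately show ?thesis using has_sum_unique by blast
qed

text \<open>
  Integrating the series of \<open>F\<close> against the conjugate of \<open>F\<close> term by term leaves, for each index, the
  conjugate of a Fourier coefficient; this avoids a double series.
\<close>

lemma parseval:
  fixes c :: "int \<Rightarrow> complex"
  assumes c: "(\<lambda>n. norm (c n)) summable_on UNIV"
    and F: "\<And>t. ((\<lambda>n. c n * cis (of_int n * t)) has_sum F t) UNIV"
  shows "((\<lambda>n. (norm (c n))\<^sup>2) has_sum (\<integral>t. (norm (F t))\<^sup>2 \<partial>circ)) UNIV"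
proof -
  have contF: "continuous_on UNIV F" by (rule fourier_continuous[OF c F])
  define B where "B = infsum (\<lambda>n. norm (c n)) UNIV"
  have B: "norm (F t) \<le> B" for t
    unfolding B_def
    by (rule norm_infsum_le[OF F, where g = "\<lambda>n. norm (c n)"]) (use c in \<open>auto simp: norm_mult\<close>)
  have "((\<lambda>n. \<integral>t. c n * cis (of_int n * t) * cnj (F t) \<partial>circ) has_sum
        (\<integral>t. F t * cnj (F t) \<partial>circ)) UNIV"
  proof (rule has_sum_circ_integral[where M = "\<lambda>n. norm (c n) * B"])
    show "((\<lambda>n. c n * cis (of_int n * t) * cnj (F t)) has_sum F t * cnj (F t)) UNIV" for t
      by (rule has_sum_cmult_left[OF F])
    show "(\<lambda>n. norm (c n) * B) summable_on UNIV"
      by (rule summable_on_cmult_left[OF c])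
    show "norm (c n * cis (of_int n * t) * cnj (F t)) \<le> norm (c n) * B" for n t
      using B[of t] by (auto simp: norm_mult intro!: mult_left_mono)
  qed (auto intro!: borel_measurable_continuous_onI continuous_intros contF)
  moreover have "(\<integral>t. c n * cis (of_int n * t) * cnj (F t) \<partial>circ) = of_real ((norm (c n))\<^sup>2)" for n
  proof -
    have "(\<integral>t. c n * cis (of_int n * t) * cnj (F t) \<partial>circ) =
          c n * (\<integral>t. cnj (F t * cis (- of_int n * t)) \<partial>circ)"
      by (simp add: cis_cnj mult_ac)
    also have "(\<integral>t. cnj (F t * cis (- of_int n * t)) \<partial>circ) = cnj (c n)"
      by (subst Bochner_Integration.integral_cnj) (subst fourier_coeff[OF c F], rule refl)
    finally show ?thesis by (simp only: complex_norm_square)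
  qed
  moreover have "(\<integral>t. F t * cnj (F t) \<partial>circ) = of_real (\<integral>t. (norm (F t))\<^sup>2 \<partial>circ)"
    unfolding integral_complex_of_real[symmetric]
    by (intro Bochner_Integration.integral_cong) (simp_all only: complex_norm_square)
  ultimately show ?thesis by (simp only: has_sum_of_real_iff)
qed

section \<open>Laurent series and the weighted space\<close>

text \<open>
  Tannery's theorem over an arbitrary index set: outside a finite set both the sums and their limit
  are dominated by a small tail of the majorant.
\<close>

lemma tendsto_infsum_dominated:
  fixes a :: "'b \<Rightarrow> 'a \<Rightarrow> real"
  assumes M: "M summable_on I"
    and bd: "\<forall>\<^sub>F x in F. \<forall>n\<in>I. norm (a x n) \<le> M n"
    and lim: "\<And>n. n \<in> I \<Longrightarrow> ((\<lambda>x. a x n) \<longlongrightarrow> b n) F"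
    and F: "F \<noteq> bot"
  shows "((\<lambda>x. infsum (a x) I) \<longlongrightarrow> infsum b I) F"
proof (rule tendstoI)
  fix e :: real assume e: "e > 0"
  have bM: "norm (b n) \<le> M n" if n: "n \<in> I" for n
  proof (rule tendsto_upperbound[OF tendsto_norm[OF lim[OF n]] _ F])
    show "\<forall>\<^sub>F x in F. norm (a x n) \<le> M n"
      using bd by eventually_elim (use n in blast)
  qed
  obtain X where X: "finite X" "X \<subseteq> I" "dist (sum M X) (infsum M I) \<le> e / 4"
    using infsum_finite_approximation[OF M, of "e / 4"] e by auto
  have tail: "norm (infsum g I - sum g X) \<le> e / 4" if g: "\<And>n. n \<in> I \<Longrightarrow> norm (g n) \<le> M n"
    for g :: "'a \<Rightarrow> real"
  proof -
    have "(\<lambda>n. norm (g n)) summable_on I"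
      by (rule Infinite_Sum.abs_summable_on_comparison_test'[OF M g])
    hence gs: "g summable_on I" by (rule Infinite_Sum.abs_summable_summable)
    have "(g has_sum infsum g I - sum g X) (I - X)"
      by (rule has_sum_Diff[OF has_sum_infsum[OF gs] has_sum_finite[OF X(1)] X(2)])
    moreover have "(M has_sum infsum M I - sum M X) (I - X)"
      by (rule has_sum_Diff[OF has_sum_infsum[OF M] has_sum_finite[OF X(1)] X(2)])
    ultimately have "norm (infsum g I - sum g X) \<le> infsum M I - sum M X"
      by (rule norm_infsum_le) (use g in blast)
    also have "\<dots> \<le> e / 4" using X(3) unfolding dist_real_def by linarith
    finally show ?thesis .
  qed
  have "((\<lambda>x. sum (a x) X) \<longlongrightarrow> sum b X) F"
    by (rule tendsto_sum) (use lim X(2) in blast)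
  hence "\<forall>\<^sub>F x in F. dist (sum (a x) X) (sum b X) < e / 4"
    using e by (intro tendstoD) auto
  with bd show "\<forall>\<^sub>F x in F. dist (infsum (a x) I) (infsum b I) < e"
  proof eventually_elim
    case (elim x)
    have "norm (infsum (a x) I - sum (a x) X) \<le> e / 4" by (rule tail) (use elim in blast)
    moreover have "norm (infsum b I - sum b X) \<le> e / 4" by (rule tail) (use bM in blast)
    ultimately show ?case using elim(2) e unfolding dist_real_def real_norm_def by linarith
  qed
qed

lemma annulus_cis [simp]:
  "complex_of_real \<rho> * cis t \<in> annulus r \<longleftrightarrow> r < \<bar>\<rho>\<bar> \<and> \<bar>\<rho>\<bar> < 1"
  by (simp add: annulus_def norm_mult)

lemma powi_circle:
  "(complex_of_real \<rho> * cis t) powi n = complex_of_real (\<rho> powi n) * cis (of_int n * t)"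
  by (simp add: power_int_mult_distrib cis_power_int)

lemma has_laurentD: "has_laurent r f c \<Longrightarrow> z \<in> annulus r \<Longrightarrow> ((\<lambda>n. c n * z powi n) has_sum f z) UNIV"
  by (simp add: has_laurent_def)

lemma has_laurent_abs:
  assumes "has_laurent r f c" "z \<in> annulus r"
  shows "(\<lambda>n. norm (c n * z powi n)) summable_on UNIV"
  using has_sum_imp_summable[OF has_laurentD[OF assms]]
  by (rule summable_on_iff_abs_summable_on_complex[THEN iffD1])

lemma has_laurent_circle:
  assumes "has_laurent r f c" "0 < r" "r < \<rho>" "\<rho> < 1"
  shows "(\<lambda>n. norm (c n * complex_of_real (\<rho> powi n))) summable_on UNIV"
    and "((\<lambda>n. c n * complex_of_real (\<rho> powi n) * cis (of_int n * t)) has_sum f (of_real \<rho> * cis t)) UNIV"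
proof -
  have "of_real \<rho> * cis 0 \<in> annulus r" using assms(2-4) by (subst annulus_cis) auto
  from has_laurent_abs[OF assms(1) this]
  show "(\<lambda>n. norm (c n * complex_of_real (\<rho> powi n))) summable_on UNIV"
    unfolding powi_circle by (simp add: norm_mult)
  have "of_real \<rho> * cis t \<in> annulus r" using assms(2-4) by (subst annulus_cis) auto
  from has_laurentD[OF assms(1) this]
  show "((\<lambda>n. c n * complex_of_real (\<rho> powi n) * cis (of_int n * t)) has_sum f (of_real \<rho> * cis t)) UNIV"
    unfolding powi_circle by (simp add: mult_ac)
qed

lemma has_laurent_continuous_circle:
  assumes "has_laurent r f c" "0 < r" "r < \<rho>" "\<rho> < 1"
  shows "continuous_on UNIV (\<lambda>t. f (of_real \<rho> * cis t))"
  by (rule fourier_continuous[OF has_laurent_circle[OF assms]])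

lemma has_laurent_parseval:
  assumes "has_laurent r f c" "0 < r" "r < \<rho>" "\<rho> < 1"
  shows "((\<lambda>n. (norm (c n))\<^sup>2 * (\<rho> powi n)\<^sup>2) has_sum (\<integral>t. (norm (f (of_real \<rho> * cis t)))\<^sup>2 \<partial>circ)) UNIV"
  using parseval[OF has_laurent_circle[OF assms]] assms(2,3)
  by (simp add: norm_mult power_mult_distrib norm_power_int)

lemma has_laurent_coeff_integral:
  assumes "has_laurent r f c" "0 < r" "r < \<rho>" "\<rho> < 1"
  shows "c k * complex_of_real (\<rho> powi k) = (\<integral>t. f (of_real \<rho> * cis t) * cis (- of_int k * t) \<partial>circ)"
  by (rule fourier_coeff[OF has_laurent_circle[OF assms], symmetric])

lemma has_laurent_cong:
  "(\<And>z. z \<in> annulus r \<Longrightarrow> f z = g z) \<Longrightarrow> has_laurent r f c \<longleftrightarrow> has_laurent r g c"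
  by (simp add: has_laurent_def)

lemma has_laurent_unique:
  assumes "has_laurent r f c" "has_laurent r f d" "0 < r" "r < 1"
  shows "c = d"
proof
  fix k
  obtain \<rho> where \<rho>: "r < \<rho>" "\<rho> < 1" using dense[OF assms(4)] by blast
  have "c k * complex_of_real (\<rho> powi k) = d k * complex_of_real (\<rho> powi k)"
    using has_laurent_coeff_integral[OF assms(1,3) \<rho>] has_laurent_coeff_integral[OF assms(2,3) \<rho>] by simp
  moreover have "complex_of_real (\<rho> powi k) \<noteq> 0"
    using \<rho>(1) assms(3) by (subst of_real_eq_0_iff) (auto simp: power_int_eq_0_iff)
  ultimately show "c k = d k" by (metis mult_right_cancel)
qed

lemma laurent_coeff_eq:
  assumes "has_laurent r f c" "0 < r" "r < 1"
  shows "laurent_coeff r f = c"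
  unfolding laurent_coeff_def
  by (rule the_equality) (use assms has_laurent_unique in blast)+

definition conv :: "(int \<Rightarrow> complex) \<Rightarrow> (int \<Rightarrow> complex) \<Rightarrow> int \<Rightarrow> complex" where
  "conv a c n = (\<Sum>\<^sub>\<infinity>j. a j * c (n - j))"

text \<open>
  At each point both series converge absolutely, so the double series may be summed along the
  diagonals \<open>j + m = n\<close>.
\<close>

lemma has_laurent_mult:
  assumes f: "has_laurent r f a" and g: "has_laurent r g c" and r: "0 < r"
  shows "has_laurent r (\<lambda>z. f z * g z) (conv a c)"
  unfolding has_laurent_def
proof
  fix z assume z: "z \<in> annulus r"
  hence z0: "z \<noteq> 0" using r by (auto simp: annulus_def)
  define A where "A j = a j * z powi j" for j
  define C where "C m = c m * z powi m" for m
  have A: "(\<lambda>j. norm (A j)) summable_on UNIV" "(A has_sum f z) UNIV"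
    using has_laurent_abs[OF f z] has_laurentD[OF f z] by (simp_all add: A_def[abs_def])
  have C: "(\<lambda>j. norm (C j)) summable_on UNIV" "(C has_sum g z) UNIV"
    using has_laurent_abs[OF g z] has_laurentD[OF g z] by (simp_all add: C_def[abs_def])
  have "(\<lambda>x. norm (case x of (j, m) \<Rightarrow> A j * C m)) summable_on UNIV \<times> UNIV"
    using A(1) C(1)
    by (subst Infinite_Sum.abs_summable_on_Sigma_iff)
       (auto simp: norm_mult infsum_cmult_right' abs_mult infsum_nonneg
          intro!: summable_on_cmult_right summable_on_cmult_left)
  hence s: "(\<lambda>(j, m). A j * C m) summable_on UNIV \<times> UNIV"
    by (rule Infinite_Sum.abs_summable_summable)
  have "((\<lambda>(j, m). A j * C m) has_sum f z * g z) (UNIV \<times> UNIV)"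
  proof (rule has_sum_SigmaI[OF _ _ s])
    show "((\<lambda>y. case (x, y) of (j, m) \<Rightarrow> A j * C m) has_sum A x * g z) UNIV" for x
      using has_sum_cmult_right[OF C(2), of "A x"] by simp
    show "((\<lambda>x. A x * g z) has_sum f z * g z) UNIV"
      by (rule has_sum_cmult_left[OF A(2)])
  qed
  hence "((\<lambda>(n, j). A j * C (n - j)) has_sum f z * g z) (UNIV \<times> UNIV)"
    by (subst has_sum_reindex_bij_witness[where i = "\<lambda>(j, m). (j + m, j)" and j = "\<lambda>(n, j). (j, n - j)"
          and T = "UNIV \<times> UNIV" and h = "\<lambda>(j, m). A j * C m" and s' = "f z * g z"]) auto
  hence S: "((\<lambda>(n, j). a j * c (n - j) * z powi n) has_sum f z * g z) (UNIV \<times> UNIV)"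
  proof -
    have "(\<lambda>(n, j). A j * C (n - j)) = (\<lambda>(n, j). a j * c (n - j) * z powi n)"
      unfolding A_def C_def using z0 by (auto simp: fun_eq_iff power_int_diff)
    thus ?thesis using \<open>((\<lambda>(n, j). A j * C (n - j)) has_sum f z * g z) (UNIV \<times> UNIV)\<close> by simp
  qed
  show "((\<lambda>n. conv a c n * z powi n) has_sum f z * g z) UNIV"
  proof (rule has_sum_SigmaD[OF S])
    fix n :: int
    have "(\<lambda>j. a j * c (n - j) * z powi n) summable_on UNIV"
      using summable_on_SigmaD1[OF has_sum_imp_summable[OF S], of n] by simp
    hence "(\<lambda>j. a j * c (n - j) * z powi n * inverse (z powi n)) summable_on UNIV"
      by (rule summable_on_cmult_left)
    moreover have "(\<lambda>j. a j * c (n - j) * z powi n * inverse (z powi n)) = (\<lambda>j. a j * c (n - j))"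
      using z0 by (simp add: fun_eq_iff mult.assoc)
    ultimately have "(\<lambda>j. a j * c (n - j)) summable_on UNIV" by (simp only:)
    hence "((\<lambda>j. a j * c (n - j)) has_sum conv a c n) UNIV"
      unfolding conv_def by (rule has_sum_infsum)
    from has_sum_cmult_left[OF this, of "z powi n"]
    show "((\<lambda>y. case (n, y) of (n, j) \<Rightarrow> a j * c (n - j) * z powi n) has_sum conv a c n * z powi n) UNIV"
      by simp
  qed
qed

definition restr :: "int set \<Rightarrow> (int \<Rightarrow> complex) \<Rightarrow> int \<Rightarrow> complex" where
  "restr A c n = (if n \<in> A then c n else 0)"

lemma has_laurent_restrict:
  assumes "has_laurent r f c"
  shows "has_laurent r (\<lambda>z. \<Sum>\<^sub>\<infinity>n. restr A c n * z powi n) (restr A c)"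
  unfolding has_laurent_def
proof
  fix z assume "z \<in> annulus r"
  have "(\<lambda>n. norm (restr A c n * z powi n)) summable_on UNIV"
    by (rule Infinite_Sum.abs_summable_on_comparison_test'[OF has_laurent_abs[OF assms \<open>z \<in> annulus r\<close>]])
       (auto simp: restr_def)
  thus "((\<lambda>n. restr A c n * z powi n) has_sum (\<Sum>\<^sub>\<infinity>n. restr A c n * z powi n)) UNIV"
    by (rule has_sum_infsum[OF Infinite_Sum.abs_summable_summable])
qed

text \<open>
  Taylor coefficients at \<open>0\<close>, extended by zero to negative indices, so that a power series is a
  Laurent series.
\<close>

definition taylor_coeff :: "(complex \<Rightarrow> complex) \<Rightarrow> int \<Rightarrow> complex" where
  "taylor_coeff \<phi> n = (if n < 0 then 0 else (deriv ^^ nat n) \<phi> 0 / fact (nat n))"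

lemma taylor_coeff_neg [simp]: "n < 0 \<Longrightarrow> taylor_coeff \<phi> n = 0"
  by (simp add: taylor_coeff_def)

lemma has_sum_int_nat:
  fixes c :: "int \<Rightarrow> 'a::{comm_monoid_add, topological_space}"
  assumes "((\<lambda>k. c (int k)) has_sum S) UNIV" "\<And>n. n < 0 \<Longrightarrow> c n = 0"
  shows "(c has_sum S) UNIV"
proof -
  have "(c has_sum S) (range int)"
    using assms(1) by (subst has_sum_reindex) (auto simp: o_def)
  thus ?thesis
  proof (rule has_sum_cong_neutral[THEN iffD1, rotated -1])
    fix x :: int assume "x \<in> UNIV - range int"
    hence "x < 0" by (metis DiffD2 nat_0_le not_le rangeI)
    thus "c x = 0" by (rule assms(2))
  qed auto
qed

lemma taylor_has_sum:
  assumes "\<phi> holomorphic_on ball 0 1" "z \<in> ball 0 1"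
  shows "((\<lambda>n. taylor_coeff \<phi> n * z powi n) has_sum \<phi> z) UNIV"
proof (rule has_sum_int_nat)
  let ?b = "\<lambda>k. (deriv ^^ k) \<phi> 0 / fact k"
  have sums: "(\<lambda>k. ?b k * w ^ k) sums \<phi> w" if "w \<in> ball 0 1" for w
    using holomorphic_power_series[OF assms(1) that] by simp
  obtain x where x: "norm z < x" "x < 1" using assms(2) dense[of "norm z" 1] by auto
  have x0: "0 < x" using x(1) norm_ge_zero[of z] by linarith
  have "of_real x \<in> ball (0::complex) 1" using x x0 by simp
  hence "summable (\<lambda>k. ?b k * of_real x ^ k)" using sums sums_summable by blast
  hence "summable (\<lambda>k. norm (?b k * z ^ k))"
    by (rule powser_insidea) (use x x0 in simp)
  from norm_summable_imp_has_sum[OF this sums[OF assms(2)]]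
  show "((\<lambda>k. taylor_coeff \<phi> (int k) * z powi int k) has_sum \<phi> z) UNIV"
    by (simp add: taylor_coeff_def)
qed simp

lemma taylor_has_laurent:
  assumes "\<phi> holomorphic_on ball 0 1"
  shows "has_laurent r \<phi> (taylor_coeff \<phi>)"
  unfolding has_laurent_def using taylor_has_sum[OF assms] by (auto simp: annulus_def)

lemma H2A_weight_ge_1: "0 < r \<Longrightarrow> r < 1 \<Longrightarrow> 1 \<le> H2A_weight r n"
  by (auto simp: H2A_weight_def power_int_def power_le_one one_le_inverse_iff)

text \<open>
  The weights dominate the squared moduli of all monomials on the circles \<open>r \<le> norm z \<le> 1\<close>. This is the
  majorant for limits \<open>\<rho> \<rightarrow> 1\<close> in Parseval's identity: for \<open>n < 0\<close> the powers of \<open>\<rho>\<close> exceed \<open>1\<close>, and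
  square summability alone would not suffice.
\<close>

lemma H2A_weight_ge_powi:
  assumes "0 < r" "r \<le> \<rho>" "\<rho> \<le> 1"
  shows "(\<rho> powi n)\<^sup>2 \<le> H2A_weight r n"
proof (cases "n < 0")
  case True
  have "\<rho> powi n = inverse \<rho> ^ nat (- n)" "r powi n = inverse r ^ nat (- n)"
    using True by (simp_all add: power_int_def power_inverse)
  moreover have "inverse \<rho> ^ nat (- n) \<le> inverse r ^ nat (- n)"
    using assms by (intro power_mono le_imp_inverse_le) auto
  ultimately have "(\<rho> powi n)\<^sup>2 \<le> (r powi n)\<^sup>2"
    using assms by (intro power_mono) (auto intro: zero_le_power_int)
  also have "\<dots> = r powi (2 * n)"
    by (simp add: power_int_mult[of r 2 n] mult.commute[of 2 n] power_int_mult)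
  finally show ?thesis using True by (simp add: H2A_weight_def)
next
  case False
  have "\<rho> powi n = \<rho> ^ nat n" using False by (simp add: power_int_def)
  moreover have "(\<rho> ^ nat n)\<^sup>2 \<le> 1"
    using assms by (intro power_le_one zero_le_power) auto
  ultimately show ?thesis using False by (simp add: H2A_weight_def)
qed

definition H2A_seq :: "real \<Rightarrow> (int \<Rightarrow> complex) \<Rightarrow> bool" where
  "H2A_seq r c \<longleftrightarrow> (\<lambda>n. H2A_weight r n * (norm (c n))\<^sup>2) summable_on UNIV"

definition sq_sum :: "(int \<Rightarrow> complex) \<Rightarrow> real" where
  "sq_sum c = (\<Sum>\<^sub>\<infinity>n. (norm (c n))\<^sup>2)"

definition wt_sum :: "real \<Rightarrow> (int \<Rightarrow> complex) \<Rightarrow> real" where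
  "wt_sum r c = (\<Sum>\<^sub>\<infinity>n. H2A_weight r n * (norm (c n))\<^sup>2)"

lemma H2A_norm_eq:
  assumes "has_laurent r f c" "0 < r" "r < 1"
  shows "H2A_norm r f = sqrt (wt_sum r c)"
  by (simp add: H2A_norm_def wt_sum_def laurent_coeff_eq[OF assms])

lemma H2A_seq_l2:
  assumes "H2A_seq r c" "0 < r" "r < 1"
  shows "(\<lambda>n. (norm (c n))\<^sup>2) summable_on UNIV"
proof -
  have "(norm (c n))\<^sup>2 \<le> H2A_weight r n * (norm (c n))\<^sup>2" for n
    using mult_right_mono[OF H2A_weight_ge_1[OF assms(2,3), of n], of "(norm (c n))\<^sup>2"] by simp
  thus ?thesis
    by (intro summable_on_comparison_test[OF assms(1)[unfolded H2A_seq_def]]) auto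
qed

lemma H2A_seq_restrict:
  assumes "H2A_seq r c" "0 < r" "r < 1"
  shows "H2A_seq r (restr A c)"
  unfolding H2A_seq_def
proof (rule summable_on_comparison_test[OF assms(1)[unfolded H2A_seq_def]])
  fix n
  have "0 \<le> H2A_weight r n" using H2A_weight_ge_1[OF assms(2,3), of n] by linarith
  thus "H2A_weight r n * (norm (restr A c n))\<^sup>2 \<le> H2A_weight r n * (norm (c n))\<^sup>2"
    and "0 \<le> H2A_weight r n * (norm (restr A c n))\<^sup>2"
    by (auto simp: restr_def intro!: mult_left_mono mult_nonneg_nonneg)
qed

lemma circle_means_tendsto:
  assumes f: "has_laurent r f c" and c: "H2A_seq r c" and r: "0 < r" "r < 1"
  shows "((\<lambda>\<rho>. \<integral>t. (norm (f (of_real \<rho> * cis t)))\<^sup>2 \<partial>circ) \<longlongrightarrow> sq_sum c) (at_left 1)"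
proof -
  have ev: "\<forall>\<^sub>F \<rho> in at_left 1. r < \<rho> \<and> \<rho> < (1::real)"
    using r(2) eventually_at_left_field by blast
  have "((\<lambda>\<rho>. \<Sum>\<^sub>\<infinity>n. (norm (c n))\<^sup>2 * (\<rho> powi n)\<^sup>2) \<longlongrightarrow> (\<Sum>\<^sub>\<infinity>n. (norm (c n))\<^sup>2)) (at_left 1)"
  proof (rule tendsto_infsum_dominated[OF c[unfolded H2A_seq_def]])
    show "\<forall>\<^sub>F \<rho> in at_left 1. \<forall>n\<in>UNIV.
        norm ((norm (c n))\<^sup>2 * (\<rho> powi n)\<^sup>2) \<le> H2A_weight r n * (norm (c n))\<^sup>2"
      using ev
    proof eventually_elim
      case (elim \<rho>)
      have "(norm (c n))\<^sup>2 * (\<rho> powi n)\<^sup>2 \<le> (norm (c n))\<^sup>2 * H2A_weight r n" for n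
        using elim r by (intro mult_left_mono H2A_weight_ge_powi) auto
      thus ?case by (simp add: mult.commute)
    qed
    have "((\<lambda>\<rho>. (norm (c n))\<^sup>2 * (\<rho> powi n)\<^sup>2) \<longlongrightarrow> (norm (c n))\<^sup>2 * (1 powi n)\<^sup>2) (at_left 1)" for n
      by (intro tendsto_intros) auto
    thus "((\<lambda>\<rho>. (norm (c n))\<^sup>2 * (\<rho> powi n)\<^sup>2) \<longlongrightarrow> (norm (c n))\<^sup>2) (at_left 1)" for n
      by simp
  qed simp
  moreover have "\<forall>\<^sub>F \<rho> in at_left 1. (\<Sum>\<^sub>\<infinity>n. (norm (c n))\<^sup>2 * (\<rho> powi n)\<^sup>2) =
      (\<integral>t. (norm (f (of_real \<rho> * cis t)))\<^sup>2 \<partial>circ)"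
    using ev by eventually_elim (rule infsumI, rule has_laurent_parseval[OF f r(1)], auto)
  ultimately show ?thesis unfolding sq_sum_def by (rule Lim_transform_eventually)
qed

lemma kernel_summable:
  assumes "0 < r" "z \<in> annulus r"
  shows "(\<lambda>n. (norm z powi n)\<^sup>2 / H2A_weight r n) summable_on UNIV"
proof -
  have z: "r < norm z" "norm z < 1" using assms by (auto simp: annulus_def)
  define x where "x = norm z"
  have x: "r < x" "x < 1" "0 < x" using z assms(1) by (auto simp: x_def)
  let ?k = "\<lambda>n. (x powi n)\<^sup>2 / H2A_weight r n"
  have "(\<lambda>k. (x\<^sup>2) ^ k) summable_on (UNIV::nat set)"
    using x by (intro summable_nonneg_imp_summable_on summable_geometric) (auto simp: power_less_one_iff)
  hence "?k \<circ> int summable_on UNIV"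
    by (simp add: o_def H2A_weight_def power_int_def power_mult[symmetric] mult.commute)
  hence 1: "?k summable_on range int"
    by (subst summable_on_reindex) auto
  have "(\<lambda>k. ((r / x)\<^sup>2) ^ Suc k) summable_on (UNIV::nat set)"
    using x assms(1) by (intro summable_nonneg_imp_summable_on summable_geometric[THEN summable_Suc_iff[THEN iffD2]]) (auto simp: power_less_one_iff)
  moreover have "?k (- int m) = ((r / x)\<^sup>2) ^ m" if m: "m > 0" for m
  proof -
    have e: "2 * (- int m) = - int (2 * m)" by simp
    have 1: "x powi (- int m) = inverse (x ^ m)" by (simp only: power_int_minus power_int_of_nat)
    have 2: "H2A_weight r (- int m) = inverse (r ^ (2 * m))"
      unfolding H2A_weight_def e using m by (simp only: power_int_minus power_int_of_nat) simp
    have 3: "(inverse (x ^ m))\<^sup>2 = inverse (x ^ (2 * m))"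
      by (simp only: power_inverse power_mult[symmetric] mult.commute[of m 2])
    have 4: "((r / x)\<^sup>2) ^ m = r ^ (2 * m) / x ^ (2 * m)"
      by (simp only: power_mult power_divide)
    show ?thesis unfolding 1 2 3 4 by (simp add: field_simps)
  qed
  hence "?k \<circ> (\<lambda>k. - int (Suc k)) = (\<lambda>k. ((r / x)\<^sup>2) ^ Suc k)"
    unfolding o_def by (intro ext) blast
  ultimately have "?k \<circ> (\<lambda>k. - int (Suc k)) summable_on UNIV" by (simp only:)
  hence 2: "?k summable_on range (\<lambda>k. - int (Suc k))"
    by (subst summable_on_reindex) (auto simp: inj_on_def)
  have "n \<in> range int \<union> range (\<lambda>k. - int (Suc k))" for n
    by (cases n rule: int_cases) blast+
  hence "range int \<union> range (\<lambda>k. - int (Suc k)) = UNIV" by blast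
  with summable_on_union[OF 1 2] show ?thesis by (simp only: x_def)
qed

text \<open>
  The arithmetic-geometric mean inequality in each term. A bound of this form, rather than the
  sharp Cauchy-Schwarz one, is enough to see that functions in the unit ball are uniformly bounded at
  each point.
\<close>

lemma H2A_eval_bound:
  assumes f: "has_laurent r f c" and c: "H2A_seq r c" and r: "0 < r" "r < 1" and z: "z \<in> annulus r"
  shows "norm (f z) \<le> (wt_sum r c + (\<Sum>\<^sub>\<infinity>n. (norm z powi n)\<^sup>2 / H2A_weight r n)) / 2"
proof -
  let ?w = "H2A_weight r" and ?x = "norm z"
  have "((\<lambda>n. (?w n * (norm (c n))\<^sup>2 + (?x powi n)\<^sup>2 / ?w n) * (1/2)) has_sum
     ((\<Sum>\<^sub>\<infinity>n. ?w n * (norm (c n))\<^sup>2) + (\<Sum>\<^sub>\<infinity>n. (?x powi n)\<^sup>2 / ?w n)) * (1/2)) UNIV"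
    by (intro has_sum_cmult_left has_sum_add has_sum_infsum kernel_summable r z c[unfolded H2A_seq_def])
  hence "norm (f z) \<le> ((\<Sum>\<^sub>\<infinity>n. ?w n * (norm (c n))\<^sup>2) + (\<Sum>\<^sub>\<infinity>n. (?x powi n)\<^sup>2 / ?w n)) * (1/2)"
  proof (rule norm_infsum_le[OF has_laurentD[OF f z]])
    fix n
    have w: "?w n > 0" using H2A_weight_ge_1[OF r, of n] by linarith
    have "0 \<le> (sqrt (?w n) * norm (c n) - ?x powi n / sqrt (?w n))\<^sup>2" by simp
    also have "\<dots> = ?w n * (norm (c n))\<^sup>2 + (?x powi n)\<^sup>2 / ?w n - 2 * (norm (c n) * ?x powi n)"
      using w by (simp add: power2_diff power_mult_distrib power_divide)
    finally show "norm (c n * z powi n) \<le> (?w n * (norm (c n))\<^sup>2 + (?x powi n)\<^sup>2 / ?w n) * (1/2)"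
      by (simp add: norm_mult norm_power_int)
  qed
  thus ?thesis by (simp add: wt_sum_def)
qed

section \<open>Multiplication by functions holomorphic on the disk\<close>

lemma circ_integrable_continuous:
  fixes f :: "real \<Rightarrow> 'a::{banach, second_countable_topology}"
  assumes "continuous_on UNIV f"
  shows "integrable circ f"
proof -
  have "compact (f ` {0..2*pi})"
    by (rule compact_continuous_image) (use assms continuous_on_subset in \<open>auto intro: continuous_on_subset\<close>)
  then obtain B where B: "\<forall>x\<in>f ` {0..2*pi}. norm x \<le> B"
    using compact_imp_bounded bounded_iff by blast
  show ?thesis
  proof (rule circ.integrable_const_bound[of _ B])
    show "AE x in circ. norm (f x) \<le> B"
      unfolding AE_circ_iff using B by (intro AE_I2) blast
    show "f \<in> borel_measurable circ"
      using assms by (simp add: borel_measurable_continuous_onI)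
  qed
qed

lemma sq_sum_restr:
  assumes "(\<lambda>n. (norm (c n))\<^sup>2) summable_on UNIV"
  shows "((\<lambda>n. (norm (c n))\<^sup>2) has_sum sq_sum (restr A c)) A"
proof -
  have "(\<lambda>n. (norm (c n))\<^sup>2) summable_on A"
    by (rule summable_on_subset_banach[OF assms]) simp
  hence "((\<lambda>n. (norm (c n))\<^sup>2) has_sum infsum (\<lambda>n. (norm (c n))\<^sup>2) A) A"
    by (rule has_sum_infsum)
  moreover have "sq_sum (restr A c) = infsum (\<lambda>n. (norm (c n))\<^sup>2) A"
    unfolding sq_sum_def restr_def by (rule infsum_cong_neutral) auto
  ultimately show ?thesis by simp
qed

lemma sq_sum_nonneg: "0 \<le> sq_sum c"
  by (simp add: sq_sum_def infsum_nonneg)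

definition layer :: "real \<Rightarrow> int \<Rightarrow> real" where
  "layer r k = r powi (2 * k) - r powi (2 * (k + 1))"

lemma layer_pos:
  assumes "0 < r" "r < 1"
  shows "0 < layer r k"
proof -
  have "r powi (2 * (k + 1)) = r powi (2 * k) * r\<^sup>2"
    using assms by (simp add: ring_distribs power_int_add)
  moreover have "r\<^sup>2 < 1" using assms by (simp add: power_less_one_iff)
  ultimately show ?thesis using assms by (simp add: layer_def)
qed

lemma weight_eq_layers:
  "H2A_weight r n = 1 + (\<Sum>k\<in>{n..-1}. layer r k)"
proof (cases "n < 0")
  case True
  have "(\<Sum>k\<in>{- int m..-1}. layer r k) = r powi (2 * (- int m)) - 1" for m
  proof (induction m)
    case (Suc m)
    have "{- int (Suc m)..-1} = insert (- int (Suc m)) {- int m..-1}" by auto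
    hence "(\<Sum>k\<in>{- int (Suc m)..-1}. layer r k) =
        layer r (- int (Suc m)) + (\<Sum>k\<in>{- int m..-1}. layer r k)" by simp
    also have "\<dots> = r powi (2 * (- int (Suc m))) - 1"
      unfolding Suc.IH unfolding layer_def by simp
    finally show ?case .
  qed simp
  from this[of "nat (- n)"] show ?thesis using True by (simp add: H2A_weight_def)
qed (simp add: H2A_weight_def)

text \<open>
  Below \<open>0\<close> the weight is \<open>1\<close> plus the sum of the layers at \<open>n, \<dots>, -1\<close>. Summing the double family
  \<open>layer r k * (norm (c n))\<^sup>2\<close> over \<open>n \<le> k < 0\<close> in either order gives the equivalence; all terms are
  nonnegative, so summability carries over in both directions.
\<close>

lemma weight_layers:
  assumes c: "(\<lambda>n. (norm (c n))\<^sup>2) summable_on UNIV" and r: "0 < r" "r < 1"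
  shows "((\<lambda>n. H2A_weight r n * (norm (c n))\<^sup>2) has_sum (sq_sum c + X)) UNIV \<longleftrightarrow>
         ((\<lambda>k. layer r k * sq_sum (restr {..k} c)) has_sum X) {..<0}"
proof -
  let ?A = "Sigma UNIV (\<lambda>n::int. {n..-1})" and ?A' = "Sigma {..<0} (\<lambda>k::int. {..k})"
  let ?h = "\<lambda>(n, k). layer r k * (norm (c n))\<^sup>2" and ?h' = "\<lambda>(k, n). layer r k * (norm (c n))\<^sup>2"
  let ?W = "\<lambda>n. (H2A_weight r n - 1) * (norm (c n))\<^sup>2"
  have S: "((\<lambda>n. (norm (c n))\<^sup>2) has_sum sq_sum c) UNIV"
    unfolding sq_sum_def by (rule has_sum_infsum[OF c])
  have lp: "0 \<le> layer r k" for k using layer_pos[OF r, of k] by simp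
  have inner: "((\<lambda>k. ?h (n, k)) has_sum ?W n) {n..-1}" for n
    by (rule has_sum_finiteI) (auto simp: weight_eq_layers sum_distrib_right)
  have inner': "((\<lambda>n. ?h' (k, n)) has_sum layer r k * sq_sum (restr {..k} c)) {..k}" for k
    using has_sum_cmult_right[OF sq_sum_restr[OF c, of "{..k}"], of "layer r k"] by simp
  have "((\<lambda>n. H2A_weight r n * (norm (c n))\<^sup>2) has_sum (sq_sum c + X)) UNIV \<longleftrightarrow> (?W has_sum X) UNIV"
  proof
    assume "((\<lambda>n. H2A_weight r n * (norm (c n))\<^sup>2) has_sum (sq_sum c + X)) UNIV"
    from has_sum_add[OF this has_sum_uminusI[OF S]] show "(?W has_sum X) UNIV"
      by (simp add: algebra_simps)
  next
    assume "(?W has_sum X) UNIV"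
    from has_sum_add[OF S this]
    show "((\<lambda>n. H2A_weight r n * (norm (c n))\<^sup>2) has_sum (sq_sum c + X)) UNIV"
      by (simp add: algebra_simps)
  qed
  also have "(?W has_sum X) UNIV \<longleftrightarrow> (?h has_sum X) ?A"
  proof
    assume W: "(?W has_sum X) UNIV"
    show "(?h has_sum X) ?A"
    proof (rule has_sum_SigmaI[OF inner W])
      show "?h summable_on ?A"
        by (rule summable_on_SigmaI[OF inner has_sum_imp_summable[OF W]]) (use lp in auto)
    qed
  next
    assume "(?h has_sum X) ?A"
    thus "(?W has_sum X) UNIV" by (rule has_sum_SigmaD[OF _ inner])
  qed
  also have "(?h has_sum X) ?A \<longleftrightarrow> (?h' has_sum X) ?A'"
    by (rule has_sum_reindex_bij_witness[where i = prod.swap and j = prod.swap]) auto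
  also have "(?h' has_sum X) ?A' \<longleftrightarrow> ((\<lambda>k. layer r k * sq_sum (restr {..k} c)) has_sum X) {..<0}"
  proof
    assume W: "((\<lambda>k. layer r k * sq_sum (restr {..k} c)) has_sum X) {..<0}"
    show "(?h' has_sum X) ?A'"
    proof (rule has_sum_SigmaI[OF inner' W])
      show "?h' summable_on ?A'"
        by (rule summable_on_SigmaI[OF inner' has_sum_imp_summable[OF W]]) (use lp in auto)
    qed
  next
    assume "(?h' has_sum X) ?A'"
    thus "((\<lambda>k. layer r k * sq_sum (restr {..k} c)) has_sum X) {..<0}"
      by (rule has_sum_SigmaD[OF _ inner'])
  qed
  finally show ?thesis .
qed

lemma layers_has_sum:
  assumes "H2A_seq r c" "0 < r" "r < 1"
  shows "((\<lambda>k. layer r k * sq_sum (restr {..k} c)) has_sum (wt_sum r c - sq_sum c)) {..<0}"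
proof -
  have "((\<lambda>n. H2A_weight r n * (norm (c n))\<^sup>2) has_sum (sq_sum c + (wt_sum r c - sq_sum c))) UNIV"
    using has_sum_infsum[OF assms(1)[unfolded H2A_seq_def]] by (simp add: wt_sum_def)
  thus ?thesis by (subst (asm) weight_layers[OF H2A_seq_l2[OF assms] assms(2,3)])
qed

lemma layer_dominated:
  assumes c: "H2A_seq r c" and b: "(\<lambda>n. (norm (b n))\<^sup>2) summable_on UNIV" and r: "0 < r" "r < 1"
    and S: "sq_sum b \<le> M * sq_sum c"
    and Sk: "\<And>k. k < 0 \<Longrightarrow> sq_sum (restr {..k} b) \<le> M * sq_sum (restr {..k} c)"
  shows "H2A_seq r b" "wt_sum r b \<le> M * wt_sum r c"
proof -
  let ?t = "\<lambda>c k. layer r k * sq_sum (restr {..k} c)"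
  have C: "((\<lambda>k. M * ?t c k) has_sum M * (wt_sum r c - sq_sum c)) {..<0}"
    by (rule has_sum_cmult_right[OF layers_has_sum[OF c r]])
  have le: "?t b k \<le> M * ?t c k" if "k \<in> {..<0}" for k
    using mult_left_mono[OF Sk, of k "layer r k"] layer_pos[OF r, of k] that by (simp add: mult_ac)
  have "?t b summable_on {..<0}"
    by (rule summable_on_comparison_test[OF has_sum_imp_summable[OF C] le])
       (use layer_pos[OF r] sq_sum_nonneg in \<open>auto intro: mult_nonneg_nonneg less_imp_le\<close>)
  then obtain X where X: "(?t b has_sum X) {..<0}" using has_sum_infsum by blast
  hence W: "((\<lambda>n. H2A_weight r n * (norm (b n))\<^sup>2) has_sum (sq_sum b + X)) UNIV"
    by (subst weight_layers[OF b r])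
  thus "H2A_seq r b" unfolding H2A_seq_def by (rule has_sum_imp_summable)
  have "X \<le> M * (wt_sum r c - sq_sum c)" by (rule has_sum_mono[OF X C le])
  moreover have "wt_sum r b = sq_sum b + X" using W unfolding wt_sum_def by (rule infsumI)
  ultimately show "wt_sum r b \<le> M * wt_sum r c" using S by (simp add: algebra_simps)
qed

lemma layer_equality:
  assumes c: "H2A_seq r c" and b: "H2A_seq r b" and r: "0 < r" "r < 1"
    and S: "sq_sum b \<le> sq_sum c"
    and Sk: "\<And>k. k < 0 \<Longrightarrow> sq_sum (restr {..k} b) \<le> sq_sum (restr {..k} c)"
    and eq: "wt_sum r b = wt_sum r c"
  shows "sq_sum b = sq_sum c" "\<And>k. k < 0 \<Longrightarrow> sq_sum (restr {..k} b) = sq_sum (restr {..k} c)"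
proof -
  let ?t = "\<lambda>k. layer r k * sq_sum (restr {..k} c) - layer r k * sq_sum (restr {..k} b)"
  have T: "(?t has_sum (wt_sum r c - sq_sum c) - (wt_sum r b - sq_sum b)) {..<0}"
    using has_sum_add[OF layers_has_sum[OF c r] has_sum_uminusI[OF layers_has_sum[OF b r]]]
    by (simp add: algebra_simps)
  have nn: "0 \<le> ?t k" if "k \<in> {..<0}" for k
    using mult_left_mono[OF Sk, of k "layer r k"] layer_pos[OF r, of k] that by simp
  have "0 \<le> (wt_sum r c - sq_sum c) - (wt_sum r b - sq_sum b)"
    by (rule has_sum_nonneg[OF T nn])
  thus S': "sq_sum b = sq_sum c" using S eq by simp
  fix k :: int assume k: "k < 0"
  have "?t k = 0"
    by (rule nonneg_has_sum_le_0D[OF T]) (use S' eq nn k in auto)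
  thus "sq_sum (restr {..k} b) = sq_sum (restr {..k} c)"
    using layer_pos[OF r, of k] by (simp flip: right_diff_distrib)
qed

text \<open>
  On each circle of radius \<open>\<rho> < 1\<close> the mean square of the product is at most \<open>B\<^sup>2\<close> times that of
  \<open>f\<close>. By Parseval this bounds finite sums of the coefficients, and \<open>\<rho> \<rightarrow> 1\<close>.
\<close>

lemma mult_l2_bound:
  assumes f: "has_laurent r f c" and c: "H2A_seq r c" and r: "0 < r" "r < 1"
    and p: "has_laurent r (\<lambda>z. \<phi> z * f z) b"
    and B: "\<And>z. z \<in> annulus r \<Longrightarrow> norm (\<phi> z) \<le> B"
  shows "(\<lambda>n. (norm (b n))\<^sup>2) summable_on UNIV" "sq_sum b \<le> B\<^sup>2 * sq_sum c"
proof -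
  let ?M = "\<lambda>f \<rho>. \<integral>t. (norm (f (complex_of_real \<rho> * cis t)))\<^sup>2 \<partial>circ"
  have fin: "(\<Sum>n\<in>X. (norm (b n))\<^sup>2) \<le> B\<^sup>2 * sq_sum c" if X: "finite X" for X
  proof (rule tendsto_le)
    show "((\<lambda>\<rho>. B\<^sup>2 * ?M f \<rho>) \<longlongrightarrow> B\<^sup>2 * sq_sum c) (at_left 1)"
      by (rule tendsto_mult[OF tendsto_const circle_means_tendsto[OF f c r]])
    have "((\<lambda>\<rho>. \<Sum>n\<in>X. (norm (b n))\<^sup>2 * (\<rho> powi n)\<^sup>2) \<longlongrightarrow> (\<Sum>n\<in>X. (norm (b n))\<^sup>2 * (1 powi n)\<^sup>2)) (at_left 1)"
      by (intro tendsto_intros) auto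
    thus "((\<lambda>\<rho>. \<Sum>n\<in>X. (norm (b n))\<^sup>2 * (\<rho> powi n)\<^sup>2) \<longlongrightarrow> (\<Sum>n\<in>X. (norm (b n))\<^sup>2)) (at_left 1)"
      by simp
    have "\<forall>\<^sub>F \<rho> in at_left 1. r < \<rho> \<and> \<rho> < (1::real)"
      using r(2) eventually_at_left_field by blast
    thus "\<forall>\<^sub>F \<rho> in at_left 1. (\<Sum>n\<in>X. (norm (b n))\<^sup>2 * (\<rho> powi n)\<^sup>2) \<le> B\<^sup>2 * ?M f \<rho>"
    proof eventually_elim
      case (elim \<rho>)
      hence \<rho>: "r < \<rho>" "\<rho> < 1" by auto
      have "(\<Sum>n\<in>X. (norm (b n))\<^sup>2 * (\<rho> powi n)\<^sup>2) \<le> ?M (\<lambda>z. \<phi> z * f z) \<rho>"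
        by (rule finite_sum_le_has_sum[OF has_laurent_parseval[OF p r(1) \<rho>] X]) auto
      also have "\<dots> \<le> (\<integral>t. B\<^sup>2 * (norm (f (complex_of_real \<rho> * cis t)))\<^sup>2 \<partial>circ)"
      proof (rule integral_mono)
        show "integrable circ (\<lambda>t. (norm (\<phi> (complex_of_real \<rho> * cis t) * f (complex_of_real \<rho> * cis t)))\<^sup>2)"
          by (intro circ_integrable_continuous continuous_intros has_laurent_continuous_circle[OF p r(1) \<rho>])
        show "integrable circ (\<lambda>t. B\<^sup>2 * (norm (f (complex_of_real \<rho> * cis t)))\<^sup>2)"
          by (intro circ_integrable_continuous continuous_intros has_laurent_continuous_circle[OF f r(1) \<rho>])
        fix t
        have "complex_of_real \<rho> * cis t \<in> annulus r" using \<rho> r by (subst annulus_cis) auto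
        from B[OF this] show "(norm (\<phi> (complex_of_real \<rho> * cis t) * f (complex_of_real \<rho> * cis t)))\<^sup>2 \<le>
            B\<^sup>2 * (norm (f (complex_of_real \<rho> * cis t)))\<^sup>2"
          by (auto simp: norm_mult power_mult_distrib intro!: mult_right_mono power_mono)
      qed
      also have "\<dots> = B\<^sup>2 * ?M f \<rho>" by simp
      finally show ?case .
    qed
  qed simp
  show s: "(\<lambda>n. (norm (b n))\<^sup>2) summable_on UNIV"
    by (rule nonneg_bdd_above_summable_on) (use fin in \<open>auto intro!: bdd_aboveI[of _ "B\<^sup>2 * sq_sum c"]\<close>)
  show "sq_sum b \<le> B\<^sup>2 * sq_sum c"
    unfolding sq_sum_def[of b] by (rule infsum_le_finite_sums[OF s]) (use fin in blast)
qed

text \<open>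
  A series without negative powers moves indices only upwards, so the coefficients of the product up to \<open>k\<close>
  do not see those of the other factor beyond \<open>k\<close>.
\<close>

lemma conv_restr:
  assumes "\<And>j. j < 0 \<Longrightarrow> a j = 0" "n \<le> k"
  shows "conv a (restr {..k} c) n = conv a c n"
  unfolding conv_def by (rule infsum_cong) (use assms in \<open>auto simp: restr_def not_less\<close>)

lemma sq_sum_restr_le:
  assumes "(\<lambda>n. (norm (c n))\<^sup>2) summable_on UNIV" "\<And>n. n \<in> A \<Longrightarrow> c n = d n"
  shows "sq_sum (restr A d) \<le> sq_sum c"
proof -
  have "restr A d = restr A c" using assms(2) by (auto simp: restr_def fun_eq_iff)
  moreover have "sq_sum (restr A c) \<le> sq_sum c"
    by (rule has_sum_mono2[OF sq_sum_restr[OF assms(1)]])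
       (use has_sum_infsum[OF assms(1)] in \<open>auto simp: sq_sum_def\<close>)
  ultimately show ?thesis by simp
qed

context
  fixes r B :: real and \<phi> f :: "complex \<Rightarrow> complex" and c :: "int \<Rightarrow> complex"
  assumes r: "0 < r" "r < 1"
    and \<phi>: "\<phi> holomorphic_on ball 0 1" and B: "\<And>z. z \<in> annulus r \<Longrightarrow> norm (\<phi> z) \<le> B"
    and f: "has_laurent r f c" and c: "H2A_seq r c"
begin

lemma mult_laurent: "has_laurent r (\<lambda>z. \<phi> z * f z) (conv (taylor_coeff \<phi>) c)"
  by (rule has_laurent_mult[OF taylor_has_laurent[OF \<phi>] f r(1)])

lemma mult_l2:
  "(\<lambda>n. (norm (conv (taylor_coeff \<phi>) c n))\<^sup>2) summable_on UNIV"
  "sq_sum (conv (taylor_coeff \<phi>) c) \<le> B\<^sup>2 * sq_sum c"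
  by (rule mult_l2_bound[OF f c r mult_laurent B], assumption)+

lemma mult_restr_l2:
  "(\<lambda>n. (norm (conv (taylor_coeff \<phi>) (restr A c) n))\<^sup>2) summable_on UNIV"
  "sq_sum (conv (taylor_coeff \<phi>) (restr A c)) \<le> B\<^sup>2 * sq_sum (restr A c)"
proof -
  note R = has_laurent_restrict[OF f, of A] and Rs = H2A_seq_restrict[OF c r, of A]
  note M = mult_l2_bound[OF R Rs r has_laurent_mult[OF taylor_has_laurent[OF \<phi>] R r(1)] B]
  show "(\<lambda>n. (norm (conv (taylor_coeff \<phi>) (restr A c) n))\<^sup>2) summable_on UNIV" by (rule M(1))
  show "sq_sum (conv (taylor_coeff \<phi>) (restr A c)) \<le> B\<^sup>2 * sq_sum (restr A c)" by (rule M(2))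
qed

lemma restr_mult_le:
  "sq_sum (restr {..k} (conv (taylor_coeff \<phi>) c)) \<le> sq_sum (conv (taylor_coeff \<phi>) (restr {..k} c))"
  by (rule sq_sum_restr_le[OF mult_restr_l2(1)]) (simp add: conv_restr)

lemma mult_H2A_seq:
  "H2A_seq r (conv (taylor_coeff \<phi>) c)" "wt_sum r (conv (taylor_coeff \<phi>) c) \<le> B\<^sup>2 * wt_sum r c"
  by (rule layer_dominated[OF c mult_l2(1) r mult_l2(2)];
      rule order_trans[OF restr_mult_le mult_restr_l2(2)])+

end

text \<open>
  Every layer of the norm is nonincreasing under \<open>\<phi>\<close>, so equality of the norms forces equality in each
  layer. If the series has a negative index, its truncation at \<open>-1\<close> has a last nonzero
  coefficient; otherwise the series itself has a first one.
\<close>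

lemma mult_isometric_one_sided:
  assumes r: "0 < r" "r < 1"
    and \<phi>: "\<phi> holomorphic_on ball 0 1" and B: "\<And>z. z \<in> annulus r \<Longrightarrow> norm (\<phi> z) \<le> 1"
    and f: "has_laurent r f c" and c: "H2A_seq r c"
    and eq: "wt_sum r (conv (taylor_coeff \<phi>) c) = wt_sum r c" and nz: "c i \<noteq> 0"
  obtains g e m where "has_laurent r g e" "H2A_seq r e" "e m \<noteq> 0"
    "(\<forall>n<m. e n = 0) \<or> (\<forall>n>m. e n = 0)" "sq_sum (conv (taylor_coeff \<phi>) e) = sq_sum e"
proof -
  let ?b = "conv (taylor_coeff \<phi>) c"
  note A = r \<phi> B f c
  have S: "sq_sum ?b \<le> sq_sum c" using mult_l2(2)[OF A] by simp
  have Sr: "sq_sum (conv (taylor_coeff \<phi>) (restr {..k} c)) \<le> sq_sum (restr {..k} c)" for k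
    using mult_restr_l2(2)[OF A] by simp
  have Sk: "sq_sum (restr {..k} ?b) \<le> sq_sum (restr {..k} c)" for k
    by (rule order_trans[OF restr_mult_le[OF A] Sr])
  note E = layer_equality[OF c mult_H2A_seq(1)[OF A] r S Sk eq]
  show ?thesis
  proof (cases "\<exists>n<0. c n \<noteq> 0")
    case True
    then obtain n where n: "n < 0" "c n \<noteq> 0" by blast
    note R = has_laurent_restrict[OF f, of "{..-1}"] and Rs = H2A_seq_restrict[OF c r, of "{..-1}"]
    define j where "j = (LEAST j. restr {..-1} c (- int j) \<noteq> 0)"
    have "restr {..-1} c (- int (nat (- n))) \<noteq> 0" using n by (simp add: restr_def)
    hence j: "restr {..-1} c (- int j) \<noteq> 0"
      unfolding j_def by (rule LeastI)
    have "restr {..-1} c k = 0" if k: "k > - int j" for k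
    proof (cases "k < 0")
      case True
      hence "nat (- k) < j" using k by linarith
      from not_less_Least[OF this[unfolded j_def]] True show ?thesis by simp
    qed (simp add: restr_def)
    moreover have "sq_sum (conv (taylor_coeff \<phi>) (restr {..-1} c)) = sq_sum (restr {..-1} c)"
      using Sr[of "-1"] restr_mult_le[OF A, of "-1"] E(2)[of "-1"] by linarith
    ultimately show ?thesis using that[OF R Rs j] by blast
  next
    case False
    define j where "j = (LEAST j. c (int j) \<noteq> 0)"
    have "i \<ge> 0" using False nz by force
    hence "c (int (nat i)) \<noteq> 0" using nz by simp
    hence j: "c (int j) \<noteq> 0" unfolding j_def by (rule LeastI)
    have "c k = 0" if k: "k < int j" for k
    proof (cases "k < 0")
      case False
      hence "nat k < j" using k by linarith
      from not_less_Least[OF this[unfolded j_def]] False show ?thesis by simp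
    qed (use \<open>\<not> (\<exists>n<0. c n \<noteq> 0)\<close> in blast)
    thus ?thesis using that[OF f c j] E(1) by blast
  qed
qed

section \<open>A weighted mean value inequality\<close>

text \<open>
  The mean value property, read off the constant Taylor coefficient of the dilated function.
\<close>

lemma circ_mean_value:
  assumes "F holomorphic_on ball 0 R" "1 < R"
  shows "(\<integral>t. F (cis t) \<partial>circ) = F 0"
proof -
  have "(\<lambda>z. F (of_real R * z)) holomorphic_on ball 0 1"
    by (rule holomorphic_on_compose_gen[OF _ assms(1), unfolded o_def])
       (use assms(2) in \<open>auto intro!: holomorphic_intros simp: norm_mult\<close>)
  note L = taylor_has_laurent[OF this, of "inverse R / 2"]
  have "inverse R / 2 < inverse R" "inverse R < 1" "0 < inverse R / 2"
    using assms(2) by (simp_all add: inverse_less_1_iff)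
  from has_laurent_coeff_integral[OF L this(3,1,2), of 0]
  show ?thesis using assms(2) by (simp add: taylor_coeff_def mult.assoc[symmetric])
qed

text \<open>
  In the double sum for the squared modulus of a polynomial on the circle, a term with a negative power
  of \<open>z\<close> is replaced by its conjugate. This keeps the real part on the circle and leaves an analytic polynomial.
\<close>

definition sqmod_poly :: "(nat \<Rightarrow> complex) \<Rightarrow> nat \<Rightarrow> complex \<Rightarrow> complex" where
  "sqmod_poly \<alpha> d z = (\<Sum>m<d. \<Sum>n<d.
     if n \<le> m then \<alpha> m * cnj (\<alpha> n) * z ^ (m - n) else cnj (\<alpha> m) * \<alpha> n * z ^ (n - m))"

lemma holomorphic_sqmod_poly [holomorphic_intros]: "sqmod_poly \<alpha> d holomorphic_on A"
proof -
  have "(\<lambda>z. if n \<le> m then \<alpha> m * cnj (\<alpha> n) * z ^ (m - n) else cnj (\<alpha> m) * \<alpha> n * z ^ (n - m)) holomorphic_on A" for m n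
    by (cases "n \<le> m") (auto intro!: holomorphic_intros)
  thus ?thesis unfolding sqmod_poly_def[abs_def] by (intro holomorphic_on_sum)
qed

lemma Re_sqmod_poly:
  "Re (sqmod_poly \<alpha> d (cis t)) = (norm (\<Sum>n<d. \<alpha> n * cis (of_nat n * t)))\<^sup>2"
proof -
  let ?T = "\<lambda>m n. (\<alpha> m * cis (of_nat m * t)) * cnj (\<alpha> n * cis (of_nat n * t))"
  have "Re (if n \<le> m then \<alpha> m * cnj (\<alpha> n) * cis t ^ (m - n) else cnj (\<alpha> m) * \<alpha> n * cis t ^ (n - m)) = Re (?T m n)" for m n
  proof -
    have T: "?T m n = \<alpha> m * cnj (\<alpha> n) * cis ((of_nat m - of_nat n) * t)"
      by (simp add: cis_cnj cis_mult algebra_simps)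
    show ?thesis
    proof (cases "n \<le> m")
      case True
      have "cis t ^ (m - n) = cis ((of_nat m - of_nat n) * t)"
        using True by (simp add: Complex.DeMoivre of_nat_diff)
      thus ?thesis unfolding T using True by (simp only: if_True)
    next
      case False
      have "Re (?T m n) = Re (cnj (?T m n))" by (rule cnj.simps(1)[symmetric])
      also have "cnj (?T m n) = cnj (\<alpha> m) * \<alpha> n * cis ((of_nat n - of_nat m) * t)"
        unfolding T by (simp add: cis_cnj algebra_simps)
      also have "cis ((of_nat n - of_nat m) * t) = cis t ^ (n - m)"
        using False by (simp add: Complex.DeMoivre of_nat_diff)
      finally show ?thesis using False by (simp only: if_False)
    qed
  qed
  hence "Re (sqmod_poly \<alpha> d (cis t)) = Re (\<Sum>m<d. \<Sum>n<d. ?T m n)"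
    unfolding sqmod_poly_def Re_sum by (intro sum.cong refl)
  also have "(\<Sum>m<d. \<Sum>n<d. ?T m n) = (\<Sum>n<d. \<alpha> n * cis (of_nat n * t)) * cnj (\<Sum>n<d. \<alpha> n * cis (of_nat n * t))"
    by (simp add: sum_product cnj_sum)
  also have "\<dots> = of_real ((norm (\<Sum>n<d. \<alpha> n * cis (of_nat n * t)))\<^sup>2)"
    by (rule complex_norm_square[symmetric])
  finally show ?thesis by simp
qed

lemma sqmod_poly_0: "sqmod_poly \<alpha> d 0 = of_real (\<Sum>n<d. (norm (\<alpha> n))\<^sup>2)"
proof -
  have "(if n \<le> m then \<alpha> m * cnj (\<alpha> n) * 0 ^ (m - n) else cnj (\<alpha> m) * \<alpha> n * 0 ^ (n - m)) =
        (if m = n then of_real ((norm (\<alpha> m))\<^sup>2) else 0)" for m n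
    by (cases "m = n") (auto simp: complex_norm_square simp del: of_real_power)
  thus ?thesis unfolding sqmod_poly_def by simp
qed

text \<open>
  For a partial sum of \<open>\<Phi>\<close>, this is the mean value property of \<open>G * exp (N * (1 - q))\<close> with \<open>q\<close> the
  polynomial whose real part on the circle is the squared modulus of that partial sum; then pass to the limit.
\<close>

lemma weighted_mean_inequality:
  assumes G: "G holomorphic_on ball 0 R" and R: "1 < R" and N: "0 \<le> N"
    and \<alpha>: "summable (\<lambda>n. norm (\<alpha> n))"
    and \<Phi>: "\<And>t. (\<lambda>n. \<alpha> n * cis (of_nat n * t)) sums \<Phi> t"
  shows "norm (G 0) * exp (N * (1 - (\<Sum>n. (norm (\<alpha> n))\<^sup>2))) \<le>
         (\<integral>t. norm (G (cis t)) * exp (N * (1 - (norm (\<Phi> t))\<^sup>2)) \<partial>circ)"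
proof -
  define p where "p d t = (\<Sum>n<d. \<alpha> n * cis (of_nat n * t))" for d t
  have Gc: "continuous_on (ball 0 R) G" by (rule holomorphic_on_imp_continuous_on[OF G])
  have Gt: "continuous_on UNIV (\<lambda>t. G (cis t))"
    by (rule continuous_on_compose2[OF Gc]) (use R in \<open>auto intro!: continuous_intros\<close>)
  have pc: "continuous_on UNIV (p d)" for d
    unfolding p_def by (intro continuous_intros)
  have pt: "(\<lambda>d. p d t) \<longlonglongrightarrow> \<Phi> t" for t
    using \<Phi>[of t] by (simp add: sums_def p_def)
  have \<Phi>m: "\<Phi> \<in> borel_measurable borel"
    by (rule borel_measurable_LIMSEQ_metric[OF _ pt]) (use pc in \<open>auto intro: borel_measurable_continuous_onI\<close>)
  have fin: "norm (G 0) * exp (N * (1 - (\<Sum>n<d. (norm (\<alpha> n))\<^sup>2))) \<le>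
         (\<integral>t. norm (G (cis t)) * exp (N * (1 - (norm (p d t))\<^sup>2)) \<partial>circ)" for d
  proof -
    \<comment> \<open>On the circle the modulus of this function is the integrand, by \<open>Re_sqmod_poly\<close>.\<close>
    let ?F = "\<lambda>z. G z * exp (of_real N * (1 - sqmod_poly \<alpha> d z))"
    have "?F holomorphic_on ball 0 R"
      by (intro holomorphic_intros G)
    from circ_mean_value[OF this R]
    have "norm (?F 0) = norm (\<integral>t. ?F (cis t) \<partial>circ)" by simp
    also have "\<dots> \<le> (\<integral>t. norm (?F (cis t)) \<partial>circ)" by simp
    also have "(\<lambda>t. norm (?F (cis t))) = (\<lambda>t. norm (G (cis t)) * exp (N * (1 - (norm (p d t))\<^sup>2)))"
      by (simp add: norm_mult Re_sqmod_poly p_def)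
    also have "norm (?F 0) = norm (G 0) * exp (N * (1 - (\<Sum>n<d. (norm (\<alpha> n))\<^sup>2)))"
      by (simp add: norm_mult sqmod_poly_0)
    finally show ?thesis .
  qed
  show ?thesis
  proof (rule LIMSEQ_le)
    show "\<exists>M. \<forall>d\<ge>M. norm (G 0) * exp (N * (1 - (\<Sum>n<d. (norm (\<alpha> n))\<^sup>2))) \<le>
         (\<integral>t. norm (G (cis t)) * exp (N * (1 - (norm (p d t))\<^sup>2)) \<partial>circ)"
      using fin by blast
    have "summable (\<lambda>n. (norm (\<alpha> n))\<^sup>2)"
    proof (rule summable_comparison_test_ev[OF _ \<alpha>])
      have "\<forall>\<^sub>F n in sequentially. norm (norm (\<alpha> n)) < 1"
        using summable_LIMSEQ_zero[OF \<alpha>] by (auto simp: tendsto_iff dist_norm)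
      thus "\<forall>\<^sub>F n in sequentially. norm ((norm (\<alpha> n))\<^sup>2) \<le> norm (\<alpha> n)"
        by eventually_elim (auto simp: power2_eq_square mult_left_le)
    qed
    hence "(\<lambda>d. \<Sum>n<d. (norm (\<alpha> n))\<^sup>2) \<longlonglongrightarrow> (\<Sum>n. (norm (\<alpha> n))\<^sup>2)"
      by (rule summable_LIMSEQ)
    thus "(\<lambda>d. norm (G 0) * exp (N * (1 - (\<Sum>n<d. (norm (\<alpha> n))\<^sup>2)))) \<longlonglongrightarrow>
       norm (G 0) * exp (N * (1 - (\<Sum>n. (norm (\<alpha> n))\<^sup>2)))"
      by (intro tendsto_intros)
    show "(\<lambda>d. \<integral>t. norm (G (cis t)) * exp (N * (1 - (norm (p d t))\<^sup>2)) \<partial>circ) \<longlonglongrightarrow>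
       (\<integral>t. norm (G (cis t)) * exp (N * (1 - (norm (\<Phi> t))\<^sup>2)) \<partial>circ)"
    proof (rule integral_dominated_convergence[where w = "\<lambda>t. norm (G (cis t)) * exp N"])
      show "integrable circ (\<lambda>t. norm (G (cis t)) * exp N)"
        by (intro circ_integrable_continuous continuous_intros Gt)
      show "(\<lambda>t. norm (G (cis t)) * exp (N * (1 - (norm (p d t))\<^sup>2))) \<in> borel_measurable circ" for d
        by (simp, intro borel_measurable_continuous_onI continuous_intros Gt pc)
      have "(\<lambda>t. norm (G (cis t))) \<in> borel_measurable borel"
        by (intro borel_measurable_continuous_onI continuous_intros Gt)
      thus "(\<lambda>t. norm (G (cis t)) * exp (N * (1 - (norm (\<Phi> t))\<^sup>2))) \<in> borel_measurable circ"
        using \<Phi>m by simp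
      show "AE t in circ. (\<lambda>d. norm (G (cis t)) * exp (N * (1 - (norm (p d t))\<^sup>2))) \<longlonglongrightarrow>
          norm (G (cis t)) * exp (N * (1 - (norm (\<Phi> t))\<^sup>2))"
        by (intro AE_I2 tendsto_intros pt)
      have "N * (1 - x\<^sup>2) \<le> N" for x :: real using N by (simp add: mult_left_le)
      thus "AE t in circ. norm (norm (G (cis t)) * exp (N * (1 - (norm (p d t))\<^sup>2))) \<le> norm (G (cis t)) * exp N" for d
        by (intro AE_I2) (auto intro!: mult_left_mono)
    qed
  qed
qed

lemma power_series_ball:
  assumes "summable (\<lambda>j. norm (g j) * R ^ j)" "0 < R"
  obtains G where "G holomorphic_on ball 0 R" "\<And>w. w \<in> ball 0 R \<Longrightarrow> (\<lambda>j. g j * w ^ j) sums G w" "G 0 = (g 0 :: complex)"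
proof -
  define G where "G w = (\<Sum>j. g j * w ^ j)" for w
  have sums: "(\<lambda>j. g j * w ^ j) sums G w" if "w \<in> ball 0 R" for w
    unfolding G_def
  proof (rule summable_sums, rule summable_comparison_test[OF _ assms(1)], intro exI allI impI)
    fix j
    show "norm (g j * w ^ j) \<le> norm (g j) * R ^ j"
      using that by (auto simp: norm_mult norm_power intro!: mult_left_mono power_mono)
  qed
  show ?thesis
  proof
    show "G holomorphic_on ball 0 R"
      by (rule power_series_holomorphic[where a = g]) (use sums in simp)
    show "G 0 = g 0" by (simp add: G_def powser_zero)
  qed (rule sums)
qed

lemma int_series_inj:
  fixes c :: "int \<Rightarrow> 'a::banach"
  assumes "(\<lambda>n. norm (c n)) summable_on UNIV" "inj (h :: nat \<Rightarrow> int)"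
  shows "summable (\<lambda>j. norm (c (h j)))"
proof -
  have "(\<lambda>n. norm (c n)) summable_on range h"
    by (rule summable_on_subset_banach[OF assms(1)]) simp
  hence "(\<lambda>j. norm (c (h j))) summable_on UNIV"
    by (subst (asm) summable_on_reindex[OF assms(2)]) (simp add: o_def)
  thus ?thesis by (rule summable_on_imp_summable)
qed

lemma int_series_sums:
  fixes c :: "int \<Rightarrow> 'a::banach"
  assumes "(c has_sum S) UNIV" "inj (h :: nat \<Rightarrow> int)" "\<And>n. n \<notin> range h \<Longrightarrow> c n = 0"
  shows "(\<lambda>j. c (h j)) sums S"
proof -
  have "(c has_sum S) (range h)"
    by (rule has_sum_cong_neutral[THEN iffD1, OF _ _ _ assms(1)]) (use assms(3) in auto)
  hence "((\<lambda>j. c (h j)) has_sum S) UNIV"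
    by (subst (asm) has_sum_reindex[OF assms(2)]) (simp add: o_def)
  thus ?thesis by (rule has_sum_imp_sums)
qed

text \<open>
  On the circle the function is a monomial times the analytic function whose power series starts with the
  first coefficient.
\<close>

lemma ascending_series_factor:
  fixes d :: "int \<Rightarrow> complex"
  assumes q: "1 < q" and sm: "(\<lambda>n. norm (d n) * q powi n) summable_on UNIV"
    and F: "\<And>t. ((\<lambda>n. d n * cis (of_int n * t)) has_sum F t) UNIV" and side: "\<forall>n<m. d n = 0"
  obtains G where "G holomorphic_on ball 0 q" "G 0 = d m" "\<And>t. norm (G (cis t)) = norm (F t)"
proof -
  let ?h = "\<lambda>j. m + int j"
  have inj: "inj ?h" by (auto simp: inj_on_def)
  have notin: "d n = 0" if "n \<notin> range ?h" for n
  proof -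
    have "n < m"
    proof (rule ccontr)
      assume "\<not> n < m"
      hence "n = ?h (nat (n - m))" by simp
      thus False using that by blast
    qed
    thus ?thesis using side by blast
  qed
  have "summable (\<lambda>j. norm (norm (d (?h j)) * q powi ?h j))"
    by (rule int_series_inj[OF _ inj]) (use sm q in simp)
  hence "summable (\<lambda>j. norm (norm (d (?h j)) * q powi ?h j) * q powi (- m))"
    by (rule summable_mult2)
  also have "(\<lambda>j. norm (norm (d (?h j)) * q powi ?h j) * q powi (- m)) = (\<lambda>j. norm (d (?h j)) * q ^ j)"
    using q by (auto simp: fun_eq_iff power_int_add power_int_minus)
  finally have sm': "summable (\<lambda>j. norm (d (?h j)) * q ^ j)" .
  obtain G where G: "G holomorphic_on ball 0 q"
     "\<And>w. w \<in> ball 0 q \<Longrightarrow> (\<lambda>j. d (?h j) * w ^ j) sums G w" "G 0 = d (?h 0)"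
    using power_series_ball[OF sm' order_less_trans[OF zero_less_one q]] by blast
  show ?thesis
  proof (rule that[OF G(1)])
    show "G 0 = d m" using G(3) by simp
    fix t
    have "(\<lambda>j. d (?h j) * cis (of_int (?h j) * t)) sums F t"
      by (rule int_series_sums[OF F inj]) (simp add: notin)
    moreover have "(\<lambda>j. cis (of_int m * t) * (d (?h j) * cis t ^ j)) sums (cis (of_int m * t) * G (cis t))"
      by (rule sums_mult) (rule G(2), use q in simp)
    moreover have "(\<lambda>j. d (?h j) * cis (of_int (?h j) * t)) = (\<lambda>j. cis (of_int m * t) * (d (?h j) * cis t ^ j))"
      by (simp add: fun_eq_iff Complex.DeMoivre distrib_right flip: cis_mult)
    ultimately have "F t = cis (of_int m * t) * G (cis t)"
      using sums_unique2 by simp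
    thus "norm (G (cis t)) = norm (F t)" by (simp add: norm_mult)
  qed
qed

text \<open>
  Rescale the circle of radius \<open>\<rho>\<close> to the unit circle. A series with a last coefficient is turned into one with a first
  coefficient by conjugation, which on the circle amounts to reflection and reverses the indices. The radius of
  convergence exceeds \<open>1\<close> because the series still converges on a nearby circle of radius \<open>s\<close>.
\<close>

lemma one_sided_factor:
  assumes f: "has_laurent r f c" and r: "0 < r" "r < \<rho>" "\<rho> < 1"
    and side: "(\<forall>n<m. c n = 0) \<or> (\<forall>n>m. c n = 0)"
  obtains G R where "1 < R" "G holomorphic_on ball 0 R" "norm (G 0) = norm (c m) * \<rho> powi m"
    "\<And>t. norm (G (cis t)) = norm (f (of_real \<rho> * cis t))"
  using side
proof
  assume side: "\<forall>n<m. c n = 0"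
  \<comment> \<open>Ascending powers converge on a larger circle, descending ones on a smaller circle.\<close>
  obtain s where s: "\<rho> < s" "s < 1" using dense[OF r(3)] by blast
  have pos: "0 < \<rho>" "0 < s" "r < s" "1 < s / \<rho>" using r s by auto
  let ?d = "\<lambda>n. c n * complex_of_real (\<rho> powi n)"
  have "(\<lambda>n. norm (?d n) * (s / \<rho>) powi n) = (\<lambda>n. norm (c n * complex_of_real (s powi n)))"
    using pos by (simp add: fun_eq_iff norm_mult norm_power_int power_int_divide_distrib)
  hence "(\<lambda>n. norm (?d n) * (s / \<rho>) powi n) summable_on UNIV"
    using has_laurent_circle(1)[OF f r(1) pos(3) s(2)] by simp
  then obtain G where "G holomorphic_on ball 0 (s / \<rho>)" "G 0 = ?d m" "\<And>t. norm (G (cis t)) = norm (f (of_real \<rho> * cis t))"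
    using ascending_series_factor[OF pos(4) _ has_laurent_circle(2)[OF f r], of m] side by auto
  thus ?thesis using that[OF pos(4)] pos by (simp add: norm_mult norm_power_int)
next
  assume side: "\<forall>n>m. c n = 0"
  obtain s where s: "r < s" "s < \<rho>" using dense[OF r(2)] by blast
  have pos: "0 < \<rho>" "0 < s" "s < 1" "1 < \<rho> / s" using r s by auto
  let ?d = "\<lambda>n. cnj (c (- n)) * complex_of_real (\<rho> powi (- n))"
  have flip: "((\<lambda>n. g (- n)) has_sum S) UNIV" if "(g has_sum S) UNIV" for g :: "int \<Rightarrow> 'z::{comm_monoid_add,topological_space}" and S
    using that by (subst has_sum_reindex_bij_witness[where i = uminus and j = uminus and h = g and T = UNIV]) auto
  have "(\<lambda>n. norm (?d n) * (\<rho> / s) powi n) = (\<lambda>n. norm (c (- n) * complex_of_real (s powi (- n))))"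
    using pos by (simp add: fun_eq_iff norm_mult norm_power_int norm_divide power_int_divide_distrib power_int_minus divide_simps)
  hence "(\<lambda>n. norm (?d n) * (\<rho> / s) powi n) summable_on UNIV"
    using flip[OF has_sum_infsum[OF has_laurent_circle(1)[OF f r(1) s(1) pos(3)]]] has_sum_imp_summable by fastforce
  moreover have "((\<lambda>n. ?d n * cis (of_int n * t)) has_sum cnj (f (of_real \<rho> * cis t))) UNIV" for t
  proof -
    have "((\<lambda>n. cnj (c n * complex_of_real (\<rho> powi n) * cis (of_int n * t))) has_sum cnj (f (of_real \<rho> * cis t))) UNIV"
      using has_laurent_circle(2)[OF f r] by (subst has_sum_cnj_iff)
    from flip[OF this] show ?thesis by (simp add: cis_cnj)
  qed
  ultimately obtain G where "G holomorphic_on ball 0 (\<rho> / s)" "G 0 = ?d (- m)"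
    "\<And>t. norm (G (cis t)) = norm (cnj (f (of_real \<rho> * cis t)))"
    using ascending_series_factor[OF pos(4), of ?d "\<lambda>t. cnj (f (of_real \<rho> * cis t))" "- m"] side by auto
  thus ?thesis using that[OF pos(4)] pos by (simp add: norm_mult norm_power_int)
qed

definition one_seq :: "int \<Rightarrow> complex" where
  "one_seq n = (if n = 0 then 1 else 0)"

lemma one_seq_has_sum: "((\<lambda>n. x n * (norm (one_seq n))\<^sup>2) has_sum (x 0 :: real)) UNIV"
  by (rule has_sum_finite_neutralI[of "{0}"]) (auto simp: one_seq_def)

lemma one_seq_facts:
  "has_laurent r (\<lambda>_. 1) one_seq" "H2A_seq r one_seq" "sq_sum one_seq = 1" "wt_sum r one_seq = 1"
proof -
  have "((\<lambda>n. one_seq n * z powi n) has_sum 1) UNIV" for z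
    by (rule has_sum_finite_neutralI[of "{0}"]) (auto simp: one_seq_def)
  thus "has_laurent r (\<lambda>_. 1) one_seq" by (simp add: has_laurent_def)
  have w: "((\<lambda>n. H2A_weight r n * (norm (one_seq n))\<^sup>2) has_sum 1) UNIV"
    using one_seq_has_sum[of "H2A_weight r"] by (simp add: H2A_weight_def)
  thus "H2A_seq r one_seq" unfolding H2A_seq_def by (rule has_sum_imp_summable)
  show "wt_sum r one_seq = 1" unfolding wt_sum_def by (rule infsumI[OF w])
  show "sq_sum one_seq = 1"
    unfolding sq_sum_def using infsumI[OF one_seq_has_sum[of "\<lambda>_. 1"]] by simp
qed

lemma taylor_coeff_l2:
  assumes r: "0 < r" "r < 1" and \<phi>: "\<phi> holomorphic_on ball 0 1"
    and B: "\<And>z. z \<in> annulus r \<Longrightarrow> norm (\<phi> z) \<le> B"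
  shows "(\<lambda>n. (norm (taylor_coeff \<phi> n))\<^sup>2) summable_on UNIV" "sq_sum (taylor_coeff \<phi>) \<le> B\<^sup>2"
proof -
  have L: "has_laurent r (\<lambda>z. \<phi> z * 1) (taylor_coeff \<phi>)"
    using taylor_has_laurent[OF \<phi>] by simp
  note M = mult_l2_bound[OF one_seq_facts(1,2) r L B]
  show "(\<lambda>n. (norm (taylor_coeff \<phi> n))\<^sup>2) summable_on UNIV" by (rule M(1))
  show "sq_sum (taylor_coeff \<phi>) \<le> B\<^sup>2" using M(2) by (simp add: one_seq_facts)
qed

lemma one_sided_weighted_mean:
  assumes r: "0 < r" "r < \<rho>" "\<rho> < 1" and \<phi>: "\<phi> holomorphic_on ball 0 1"
    and B: "\<And>z. z \<in> annulus r \<Longrightarrow> norm (\<phi> z) \<le> 1"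
    and f: "has_laurent r f c"
    and side: "(\<forall>n<m. c n = 0) \<or> (\<forall>n>m. c n = 0)" and N: "0 \<le> N"
  shows "norm (c m) * \<rho> powi m * exp (N * (1 - sq_sum (taylor_coeff \<phi>))) \<le>
    (\<integral>t. norm (f (of_real \<rho> * cis t)) * exp (N * (1 - (norm (\<phi> (of_real \<rho> * cis t)))\<^sup>2)) \<partial>circ)"
proof -
  define a where "a = taylor_coeff \<phi>"
  have L: "has_laurent r \<phi> a" unfolding a_def by (rule taylor_has_laurent[OF \<phi>])
  obtain G R where G: "1 < R" "G holomorphic_on ball 0 R" "norm (G 0) = norm (c m) * \<rho> powi m"
    "\<And>t. norm (G (cis t)) = norm (f (of_real \<rho> * cis t))"
    using one_sided_factor[OF f r side] by blast
  let ?\<alpha> = "\<lambda>j. a (int j) * complex_of_real (\<rho> powi int j)"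
  have inj: "inj int" by (rule inj_of_nat)
  have neg: "a n = 0" if "n \<notin> range int" for n
  proof -
    have "n < 0"
    proof (rule ccontr)
      assume "\<not> n < 0"
      hence "n = int (nat n)" by simp
      thus False using that by blast
    qed
    thus ?thesis by (simp add: a_def)
  qed
  have \<alpha>: "summable (\<lambda>j. norm (?\<alpha> j))"
    by (rule int_series_inj[OF has_laurent_circle(1)[OF L r] inj])
  have \<Phi>: "(\<lambda>j. ?\<alpha> j * cis (of_nat j * t)) sums \<phi> (of_real \<rho> * cis t)" for t
    using int_series_sums[OF has_laurent_circle(2)[OF L r, of t] inj] neg by simp
  have sm: "((\<lambda>n. (norm (a n))\<^sup>2) has_sum sq_sum a) UNIV"
    unfolding sq_sum_def a_def
    by (rule has_sum_infsum[OF taylor_coeff_l2(1)[OF r(1) _ \<phi> B]]) (use r in auto)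
  have sums\<alpha>: "(\<lambda>j. (norm (a (int j)))\<^sup>2 * (\<rho> powi int j)\<^sup>2) sums (\<integral>t. (norm (\<phi> (of_real \<rho> * cis t)))\<^sup>2 \<partial>circ)"
    by (rule int_series_sums[OF has_laurent_parseval[OF L r] inj]) (simp add: neg)
  have "(\<lambda>j. (norm (?\<alpha> j))\<^sup>2) = (\<lambda>j. (norm (a (int j)))\<^sup>2 * (\<rho> powi int j)\<^sup>2)"
    using r by (simp add: norm_mult power_mult_distrib fun_eq_iff norm_power)
  hence "(\<Sum>j. (norm (?\<alpha> j))\<^sup>2) = (\<integral>t. (norm (\<phi> (of_real \<rho> * cis t)))\<^sup>2 \<partial>circ)"
    using sums_unique[OF sums\<alpha>] by simp
  also have "\<dots> \<le> sq_sum a"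
  proof (rule has_sum_mono[OF has_laurent_parseval[OF L r] sm])
    fix n
    show "(norm (a n))\<^sup>2 * (\<rho> powi n)\<^sup>2 \<le> (norm (a n))\<^sup>2"
    proof (cases "n < 0")
      case False
      have "(\<rho> powi n)\<^sup>2 \<le> H2A_weight r n" by (rule H2A_weight_ge_powi) (use r in auto)
      thus ?thesis using False by (simp add: H2A_weight_def mult_left_le)
    qed (simp add: a_def)
  qed
  finally have A: "(\<Sum>j. (norm (?\<alpha> j))\<^sup>2) \<le> sq_sum a" .
  have "norm (c m) * \<rho> powi m * exp (N * (1 - sq_sum a)) \<le> norm (G 0) * exp (N * (1 - (\<Sum>j. (norm (?\<alpha> j))\<^sup>2)))"
    unfolding G(3)[symmetric] using A N by (intro mult_left_mono) (auto intro: mult_left_mono)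
  also have "\<dots> \<le> (\<integral>t. norm (G (cis t)) * exp (N * (1 - (norm (\<phi> (of_real \<rho> * cis t)))\<^sup>2)) \<partial>circ)"
    by (rule weighted_mean_inequality[OF G(2,1) N \<alpha> \<Phi>])
  finally show ?thesis unfolding a_def G(4) .
qed

text \<open>
  Replaces the exponential weight by quantities with known means. With \<open>v = 1 - y\<^sup>2\<close>, which lies between
  \<open>0\<close> and \<open>1\<close>, it combines \<open>exp (N v) \<le> 1 + N v exp N\<close> with \<open>x \<le> \<delta> + x\<^sup>2 / \<delta>\<close>. The term \<open>x\<^sup>2 - (y x)\<^sup>2\<close>
  is the one whose mean tends to \<open>0\<close> for a norm-preserving multiplier.
\<close>

lemma weight_pointwise:
  fixes x y N \<delta> :: real
  assumes "0 \<le> x" "0 \<le> y" "y \<le> 1" "0 \<le> N" "0 < \<delta>"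
  shows "x * exp (N * (1 - y\<^sup>2)) \<le> 1 + x\<^sup>2 + N * exp N * (\<delta> + (x\<^sup>2 - (y * x)\<^sup>2) / \<delta>)"
proof -
  define v where "v = 1 - y\<^sup>2"
  have v: "0 \<le> v" "v \<le> 1" using assms by (auto simp: v_def power_le_one)
  have "1 - N * v \<le> exp (- (N * v))" using exp_ge_add_one_self[of "- (N * v)"] by simp
  hence "(1 - N * v) * exp (N * v) \<le> exp (- (N * v)) * exp (N * v)" by (rule mult_right_mono) simp
  hence "exp (N * v) \<le> 1 + N * v * exp (N * v)" by (simp add: algebra_simps flip: exp_add)
  also have "\<dots> \<le> 1 + N * v * exp N"
    using v assms by (intro add_left_mono mult_left_mono) (auto simp: mult_left_le)
  finally have e: "exp (N * v) \<le> 1 + N * v * exp N" .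
  have "x \<le> 1 + x\<^sup>2"
    using sum_power2_ge_zero[of "x - 1" 0] assms(1) by (simp add: power2_eq_square algebra_simps)
  have "0 \<le> (x - \<delta>)\<^sup>2" "0 \<le> x * \<delta>" using assms by auto
  hence "x * \<delta> \<le> \<delta>\<^sup>2 + x\<^sup>2" by (simp add: power2_diff)
  hence "x \<le> (\<delta>\<^sup>2 + x\<^sup>2) / \<delta>" using assms(5) by (simp add: pos_le_divide_eq)
  also have "\<dots> = \<delta> + x\<^sup>2 / \<delta>" using assms(5) by (simp add: add_divide_distrib power2_eq_square)
  finally have "x \<le> \<delta> + x\<^sup>2 / \<delta>" .
  hence "x * v \<le> (\<delta> + x\<^sup>2 / \<delta>) * v" using v by (intro mult_right_mono) auto
  also have "\<dots> \<le> \<delta> + x\<^sup>2 * v / \<delta>" using v assms by (simp add: distrib_right mult_left_le)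
  finally have xv: "x * v \<le> \<delta> + x\<^sup>2 * v / \<delta>" .
  have "x * exp (N * v) \<le> x * (1 + N * v * exp N)" by (rule mult_left_mono[OF e assms(1)])
  also have "\<dots> = x + N * exp N * (x * v)" by (simp add: algebra_simps)
  also have "\<dots> \<le> (1 + x\<^sup>2) + N * exp N * (\<delta> + x\<^sup>2 * v / \<delta>)"
    using \<open>x \<le> 1 + x\<^sup>2\<close> xv assms by (intro add_mono mult_left_mono) auto
  also have "x\<^sup>2 * v = x\<^sup>2 - (y * x)\<^sup>2" by (simp add: v_def algebra_simps)
  finally show ?thesis by (simp add: v_def)
qed

text \<open>
  As \<open>\<rho> \<rightarrow> 1\<close>, the means of \<open>(norm f)\<^sup>2\<close> and \<open>(norm (\<phi> f))\<^sup>2\<close> have the same limit, so the weighted mean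
  inequality leaves \<open>norm (c m) * exp (N * (1 - A)) \<le> 1 + sq_sum c + N * exp N * \<delta>\<close> for all \<open>N \<ge> 0\<close> and
  \<open>\<delta> > 0\<close>. For \<open>A < 1\<close> the left side is unbounded in \<open>N\<close>, whereas the last term can be made
  arbitrarily small after \<open>N\<close> is chosen.
\<close>

lemma isometric_imp_unit_norm:
  assumes r: "0 < r" "r < 1" and \<phi>: "\<phi> holomorphic_on ball 0 1"
    and B: "\<And>z. z \<in> annulus r \<Longrightarrow> norm (\<phi> z) \<le> 1"
    and f: "has_laurent r f c" and c: "H2A_seq r c" and nz: "c m \<noteq> 0"
    and side: "(\<forall>n<m. c n = 0) \<or> (\<forall>n>m. c n = 0)"
    and eq: "sq_sum (conv (taylor_coeff \<phi>) c) = sq_sum c"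
  shows "sq_sum (taylor_coeff \<phi>) = 1"
proof (rule ccontr)
  assume "sq_sum (taylor_coeff \<phi>) \<noteq> 1"
  moreover have "sq_sum (taylor_coeff \<phi>) \<le> 1" using taylor_coeff_l2(2)[OF r \<phi> B] by simp
  ultimately have A: "sq_sum (taylor_coeff \<phi>) < 1" by simp
  let ?A = "sq_sum (taylor_coeff \<phi>)"
  let ?p = "\<lambda>z. \<phi> z * f z"
  let ?M = "\<lambda>f \<rho>. \<integral>t. (norm (f (complex_of_real \<rho> * cis t)))\<^sup>2 \<partial>circ"
  note K = r \<phi> B f c
  have p: "has_laurent r ?p (conv (taylor_coeff \<phi>) c)" by (rule mult_laurent[OF K])
  have ps: "H2A_seq r (conv (taylor_coeff \<phi>) c)" by (rule mult_H2A_seq(1)[OF K])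
  have ev: "\<forall>\<^sub>F \<rho> in at_left 1. r < \<rho> \<and> \<rho> < (1::real)"
    using r(2) eventually_at_left_field by blast
  have step: "norm (c m) * exp (N * (1 - ?A)) \<le> 1 + sq_sum c + N * exp N * \<delta>" if N: "0 \<le> N" and \<delta>: "0 < \<delta>" for N \<delta>
  proof -
    let ?R = "\<lambda>\<rho>. 1 + ?M f \<rho> + N * exp N * (\<delta> + (?M f \<rho> - ?M ?p \<rho>) / \<delta>)"
    have "\<forall>\<^sub>F \<rho> in at_left 1. norm (c m) * \<rho> powi m * exp (N * (1 - ?A)) \<le> ?R \<rho>"
      using ev
    proof eventually_elim
      case (elim \<rho>)
      hence \<rho>: "r < \<rho>" "\<rho> < 1" by auto
      have fc: "continuous_on UNIV (\<lambda>t. f (of_real \<rho> * cis t))" by (rule has_laurent_continuous_circle[OF f r(1) \<rho>])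
      have pc: "continuous_on UNIV (\<lambda>t. \<phi> (of_real \<rho> * cis t))"
        by (rule has_laurent_continuous_circle[OF taylor_has_laurent[OF \<phi>] r(1) \<rho>])
      have I: "integrable circ (\<lambda>t. (norm (f (of_real \<rho> * cis t)))\<^sup>2)"
          "integrable circ (\<lambda>t. (norm (?p (of_real \<rho> * cis t)))\<^sup>2)"
        by (intro circ_integrable_continuous continuous_intros fc pc)+
      have "(\<integral>t. norm (f (of_real \<rho> * cis t)) * exp (N * (1 - (norm (\<phi> (of_real \<rho> * cis t)))\<^sup>2)) \<partial>circ) \<le>
        (\<integral>t. 1 + (norm (f (of_real \<rho> * cis t)))\<^sup>2 + N * exp N *
          (\<delta> + ((norm (f (of_real \<rho> * cis t)))\<^sup>2 - (norm (?p (of_real \<rho> * cis t)))\<^sup>2) / \<delta>) \<partial>circ)"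
      proof (rule integral_mono)
        show "integrable circ (\<lambda>t. norm (f (of_real \<rho> * cis t)) * exp (N * (1 - (norm (\<phi> (of_real \<rho> * cis t)))\<^sup>2)))"
          by (intro circ_integrable_continuous continuous_intros fc pc)
        show "integrable circ (\<lambda>t. 1 + (norm (f (of_real \<rho> * cis t)))\<^sup>2 + N * exp N *
          (\<delta> + ((norm (f (of_real \<rho> * cis t)))\<^sup>2 - (norm (?p (of_real \<rho> * cis t)))\<^sup>2) / \<delta>))"
          using \<delta> by (intro circ_integrable_continuous continuous_intros fc pc) auto
        fix t
        have "complex_of_real \<rho> * cis t \<in> annulus r" using \<rho> r by (subst annulus_cis) auto
        from weight_pointwise[OF norm_ge_zero norm_ge_zero B[OF this] N \<delta>, of "f (of_real \<rho> * cis t)"]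
        show "norm (f (of_real \<rho> * cis t)) * exp (N * (1 - (norm (\<phi> (of_real \<rho> * cis t)))\<^sup>2)) \<le>
          1 + (norm (f (of_real \<rho> * cis t)))\<^sup>2 + N * exp N *
          (\<delta> + ((norm (f (of_real \<rho> * cis t)))\<^sup>2 - (norm (?p (of_real \<rho> * cis t)))\<^sup>2) / \<delta>)"
          by (simp only: norm_mult)
      qed
      also have "\<dots> = 1 + ?M f \<rho> + N * exp N * (\<delta> + (?M f \<rho> - ?M ?p \<rho>) / \<delta>)"
        using I by simp
      finally show ?case
        using one_sided_weighted_mean[OF r(1) \<rho> \<phi> B f side N] by linarith
    qed
    moreover have "(?R \<longlongrightarrow> 1 + sq_sum c + N * exp N * (\<delta> + (sq_sum c - sq_sum (conv (taylor_coeff \<phi>) c)) / \<delta>)) (at_left 1)"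
      using \<delta> circle_means_tendsto[OF f c r] circle_means_tendsto[OF p ps r]
      by (intro tendsto_intros) auto
    moreover have "((\<lambda>\<rho>. norm (c m) * \<rho> powi m * exp (N * (1 - ?A))) \<longlongrightarrow> norm (c m) * 1 powi m * exp (N * (1 - ?A))) (at_left 1)"
      by (intro tendsto_intros) auto
    ultimately have "norm (c m) * 1 powi m * exp (N * (1 - ?A)) \<le>
        1 + sq_sum c + N * exp N * (\<delta> + (sq_sum c - sq_sum (conv (taylor_coeff \<phi>) c)) / \<delta>)"
      by (intro tendsto_le[of "at_left 1"]) auto
    thus ?thesis by (simp add: eq)
  qed
  \<comment> \<open>With this \<open>N\<close>, already \<open>exp x \<ge> 1 + x\<close> pushes the left side up to \<open>norm (c m) + 1 + sq_sum c\<close>.\<close>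
  define N where "N = (1 + sq_sum c) / (norm (c m) * (1 - ?A))"
  have N: "0 \<le> N" using A sq_sum_nonneg[of c] by (simp add: N_def)
  \<comment> \<open>The error term is then at most \<open>norm (c m) / 2\<close>.\<close>
  define \<delta> where "\<delta> = norm (c m) / (2 * (1 + N * exp N))"
  have pos: "0 < 1 + N * exp N" using N by (intro add_pos_nonneg) auto
  have \<delta>: "0 < \<delta>" using nz pos by (simp add: \<delta>_def)
  have "N * exp N * \<delta> \<le> (1 + N * exp N) * \<delta>" using \<delta> by (intro mult_right_mono) auto
  also have "\<dots> = norm (c m) / 2"
  proof -
    have "x * (y / (2 * x)) = y / 2" if "x > 0" for x y :: real using that by simp
    from this[OF pos] show ?thesis unfolding \<delta>_def .
  qed
  also have "norm (c m) / 2 < norm (c m)" using nz by simp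
  finally have "N * exp N * \<delta> < norm (c m)" .
  moreover have "norm (c m) * (1 + N * (1 - ?A)) \<le> norm (c m) * exp (N * (1 - ?A))"
    by (intro mult_left_mono exp_ge_add_one_self) auto
  moreover have "norm (c m) * (1 + N * (1 - ?A)) = norm (c m) + (1 + sq_sum c)"
    using nz A by (simp add: N_def field_simps)
  ultimately show False using step[OF N \<delta>] by linarith
qed

section \<open>Lipschitz functions are differentiable almost everywhere\<close>

text \<open>
  Vitali's covering theorem, for intervals that contain the point without being centred at it.
\<close>

lemma vitali_intervals:
  fixes S :: "real set"
  assumes W: "open W"
    and Q: "\<And>x d. x \<in> S \<Longrightarrow> 0 < d \<Longrightarrow> \<exists>a b. a \<le> x \<and> x \<le> b \<and> a < b \<and> b - a < d \<and> Q a b"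
  obtains C where "countable C" "disjoint_family_on (\<lambda>i. {fst i..snd i}) C"
    "\<And>i. i \<in> C \<Longrightarrow> fst i < snd i" "\<And>i. i \<in> C \<Longrightarrow> {fst i..snd i} \<subseteq> W" "\<And>i. i \<in> C \<Longrightarrow> Q (fst i) (snd i)"
    "negligible (S \<inter> W - (\<Union>i\<in>C. {fst i..snd i}))"
proof -
  let ?I = "\<lambda>i::real\<times>real. {fst i..snd i}"
  let ?mid = "\<lambda>i::real\<times>real. (fst i + snd i) / 2" and ?rad = "\<lambda>i::real\<times>real. (snd i - fst i) / 2"
  let ?K = "{i. fst i < snd i \<and> ?I i \<subseteq> W \<and> Q (fst i) (snd i)}"
  have cb: "cball (?mid i) (?rad i) = ?I i" for i
    by (simp add: cball_eq_atLeastAtMost field_simps)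
  have fine: "\<exists>i. i \<in> ?K \<and> x \<in> cball (?mid i) (?rad i) \<and> ?rad i < d" if x: "x \<in> S \<inter> W" and d: "0 < d" for x d
  proof -
    obtain e where e: "e > 0" "ball x e \<subseteq> W"
      using W x open_contains_ball by blast
    have "min d e > 0" using e d by simp
    from Q[OF IntD1[OF x] this] obtain a b where ab: "a \<le> x" "x \<le> b" "a < b" "b - a < min d e" "Q a b"
      by blast
    have "{a..b} \<subseteq> ball x e" using ab by (auto simp: dist_real_def)
    hence "(a, b) \<in> ?K" using ab e(2) by simp
    moreover have "x \<in> cball (?mid (a, b)) (?rad (a, b))" unfolding cb using ab by simp
    moreover have "?rad (a, b) < d" using ab by simp
    ultimately show ?thesis by blast
  qed
  obtain C where C: "countable C" "C \<subseteq> ?K"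
    "pairwise (\<lambda>i j. disjnt (cball (?mid i) (?rad i)) (cball (?mid j) (?rad j))) C"
    "negligible (S \<inter> W - (\<Union>i\<in>C. cball (?mid i) (?rad i)))"
    by (rule Vitali_covering_theorem_cballs[of ?K ?rad "S \<inter> W" ?mid, OF _ fine]) simp
  have "disjoint_family_on ?I C"
    using C(3) unfolding cb by (auto simp: disjoint_family_on_def pairwise_def disjnt_def)
  with C(1,2,4) that[of C] show ?thesis unfolding cb by blast
qed

text \<open>
  Cover almost all of \<open>S\<close> by disjoint intervals inside \<open>U\<close> of slope less than \<open>p\<close>, and then, inside these,
  by disjoint intervals of slope greater than \<open>q\<close>. Since \<open>F\<close> is monotone, its increments over the second
  family add up to at most those over the first, so the second family has total length at most
  \<open>p / q\<close> times the measure of \<open>U\<close>. The Stieltjes measure of \<open>F\<close> does the bookkeeping for the increments.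
\<close>

lemma steep_flat_cover_step:
  fixes F :: "real \<Rightarrow> real"
  assumes mono: "\<And>x y. x \<le> y \<Longrightarrow> F x \<le> F y" and cont: "continuous_on UNIV F"
    and pq: "0 < p" "p < q"
    and flat: "\<And>x d. x \<in> S \<Longrightarrow> 0 < d \<Longrightarrow>
        \<exists>a b. a \<le> x \<and> x \<le> b \<and> a < b \<and> b - a < d \<and> F b - F a < p * (b - a)"
    and steep: "\<And>x d. x \<in> S \<Longrightarrow> 0 < d \<Longrightarrow>
        \<exists>a b. a \<le> x \<and> x \<le> b \<and> a < b \<and> b - a < d \<and> F b - F a > q * (b - a)"
    and U: "open U" "S \<subseteq> U" "U \<in> lmeasurable"
  obtains T where "T \<in> lmeasurable" "S \<subseteq> T" "measure lebesgue T \<le> p / q * measure lebesgue U"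
proof -
  let ?I = "\<lambda>i::real\<times>real. {fst i..snd i}"
  obtain C1 where C1: "countable C1" "disjoint_family_on ?I C1"
    "\<And>i. i \<in> C1 \<Longrightarrow> fst i < snd i" "\<And>i. i \<in> C1 \<Longrightarrow> ?I i \<subseteq> U"
    "\<And>i. i \<in> C1 \<Longrightarrow> F (snd i) - F (fst i) < p * (snd i - fst i)"
    "negligible (S \<inter> U - (\<Union>i\<in>C1. ?I i))"
    using vitali_intervals[of U S "\<lambda>a b. F b - F a < p * (b - a)", OF U(1) flat] by blast
  define U1 where "U1 = (\<Union>i\<in>C1. {fst i<..<snd i})"
  have "open U1" by (auto simp: U1_def)
  have negl1: "negligible (S - U1)"
  proof (rule negligible_subset)
    show "S - U1 \<subseteq> (S \<inter> U - (\<Union>i\<in>C1. ?I i)) \<union> (fst ` C1 \<union> snd ` C1)"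
      using U(2) by (force simp: U1_def)
    have "negligible (fst ` C1 \<union> snd ` C1)"
      using C1(1) by (intro negligible_iff_null_sets[THEN iffD2] null_sets_completionI countable_imp_null_set_lborel) auto
    thus "negligible ((S \<inter> U - (\<Union>i\<in>C1. ?I i)) \<union> (fst ` C1 \<union> snd ` C1))"
      using C1(6) by simp
  qed
  obtain C2 where C2: "countable C2" "disjoint_family_on ?I C2"
    "\<And>i. i \<in> C2 \<Longrightarrow> fst i < snd i" "\<And>i. i \<in> C2 \<Longrightarrow> ?I i \<subseteq> U1"
    "\<And>i. i \<in> C2 \<Longrightarrow> F (snd i) - F (fst i) > q * (snd i - fst i)"
    "negligible (S \<inter> U1 - (\<Union>i\<in>C2. ?I i))"
    using vitali_intervals[of U1 S "\<lambda>a b. F b - F a > q * (b - a)", OF \<open>open U1\<close> steep] by blast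
  define V1 where "V1 = (\<Union>i\<in>C1. ?I i)"
  define V2 where "V2 = (\<Union>i\<in>C2. ?I i)"
  have "V2 \<subseteq> U1"
    unfolding V2_def by (intro UN_least C2(4))
  moreover have "U1 \<subseteq> V1"
    unfolding U1_def V1_def by (intro UN_mono) auto
  moreover have "V1 \<subseteq> U"
    unfolding V1_def by (intro UN_least C1(4))
  moreover have Vb: "V1 \<in> sets borel" "V2 \<in> sets borel"
    unfolding V1_def V2_def using C1(1) C2(1) by (intro sets.countable_UN''; simp)+
  ultimately have V12: "V2 \<subseteq> V1" "V1 \<subseteq> U" "V1 \<in> sets borel" "V2 \<in> sets borel"
    by (blast, blast, simp_all)
  let ?\<mu> = "interval_measure F"
  have em\<mu>: "emeasure ?\<mu> (?I i) = ennreal (F (snd i) - F (fst i))" if "fst i < snd i" for i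
    by (rule emeasure_interval_measure_Icc[OF less_imp_le[OF that] mono cont])
  have "ennreal q * emeasure lborel V2 = ennreal q * (\<integral>\<^sup>+i. emeasure lborel (?I i) \<partial>count_space C2)"
    unfolding V2_def using C2(1,2) by (subst emeasure_UN_countable) auto
  also have "\<dots> = (\<integral>\<^sup>+i. ennreal q * emeasure lborel (?I i) \<partial>count_space C2)"
    by (rule nn_integral_cmult[symmetric]) simp
  also have "\<dots> \<le> (\<integral>\<^sup>+i. emeasure ?\<mu> (?I i) \<partial>count_space C2)"
  proof (rule nn_integral_mono)
    fix i assume "i \<in> space (count_space C2)"
    hence i: "fst i < snd i" "F (snd i) - F (fst i) > q * (snd i - fst i)"
      by (auto intro: C2(3,5))
    have "ennreal q * emeasure lborel (?I i) = ennreal (q * (snd i - fst i))"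
      using i pq by (simp add: ennreal_mult'')
    also have "\<dots> \<le> emeasure ?\<mu> (?I i)"
      using i by (subst em\<mu>) (auto intro!: ennreal_leI)
    finally show "ennreal q * emeasure lborel (?I i) \<le> emeasure ?\<mu> (?I i)" .
  qed
  also have "\<dots> = emeasure ?\<mu> V2"
    unfolding V2_def using C2(1,2) by (subst emeasure_UN_countable) auto
  also have "\<dots> \<le> emeasure ?\<mu> V1"
    using V12 by (intro emeasure_mono) auto
  also have "\<dots> = (\<integral>\<^sup>+i. emeasure ?\<mu> (?I i) \<partial>count_space C1)"
    unfolding V1_def using C1(1,2) by (subst emeasure_UN_countable) auto
  also have "\<dots> \<le> (\<integral>\<^sup>+i. ennreal p * emeasure lborel (?I i) \<partial>count_space C1)"
  proof (rule nn_integral_mono)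
    fix i assume "i \<in> space (count_space C1)"
    hence i: "fst i < snd i" "F (snd i) - F (fst i) < p * (snd i - fst i)"
      by (auto intro: C1(3,5))
    have "emeasure ?\<mu> (?I i) \<le> ennreal (p * (snd i - fst i))"
      using i by (subst em\<mu>) (auto intro!: ennreal_leI)
    also have "\<dots> = ennreal p * emeasure lborel (?I i)"
      using i pq by (simp add: ennreal_mult'')
    finally show "emeasure ?\<mu> (?I i) \<le> ennreal p * emeasure lborel (?I i)" .
  qed
  also have "\<dots> = ennreal p * (\<integral>\<^sup>+i. emeasure lborel (?I i) \<partial>count_space C1)"
    by (rule nn_integral_cmult) simp
  also have "\<dots> = ennreal p * emeasure lborel V1"
    unfolding V1_def using C1(1,2) by (subst emeasure_UN_countable) auto
  also have "\<dots> \<le> ennreal p * emeasure lborel U"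
    using V12 U by (intro mult_left_mono emeasure_mono) auto
  finally have key: "ennreal q * emeasure lborel V2 \<le> ennreal p * emeasure lborel U" .
  have lm: "V2 \<in> lmeasurable"
    by (rule fmeasurableI2[OF U(3)]) (use V12 in auto)
  have e1: "emeasure lborel U = ennreal (measure lebesgue U)"
    using emeasure_eq_measure2[OF U(3)] U(1) by simp
  have e2: "emeasure lborel V2 = ennreal (measure lebesgue V2)"
    using emeasure_eq_measure2[OF lm] V12(4) by simp
  have "ennreal (q * measure lebesgue V2) \<le> ennreal (p * measure lebesgue U)"
    using key pq unfolding e1 e2 by (simp add: ennreal_mult)
  hence le: "q * measure lebesgue V2 \<le> p * measure lebesgue U"
    using pq by (subst (asm) ennreal_le_iff) (auto intro!: mult_nonneg_nonneg)
  have negl: "negligible (S - V2)"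
  proof (rule negligible_subset)
    show "S - V2 \<subseteq> (S - U1) \<union> (S \<inter> U1 - V2)" by auto
    show "negligible ((S - U1) \<union> (S \<inter> U1 - V2))"
      using negl1 C2(6) by (simp add: V2_def)
  qed
  show ?thesis
  proof (rule that[of "V2 \<union> (S - V2)"])
    show "V2 \<union> (S - V2) \<in> lmeasurable"
      using lm negl by (intro fmeasurable.Un) (auto intro: negligible_imp_measurable)
    have "measure lebesgue (V2 \<union> (S - V2)) \<le> measure lebesgue V2 + measure lebesgue (S - V2)"
      using lm negl by (intro measure_Un_le) (auto dest: negligible_imp_sets)
    also have "\<dots> = measure lebesgue V2"
      using negl by (simp add: negligible_imp_measure0)
    also have "\<dots> \<le> p / q * measure lebesgue U"
      using le pq by (simp add: field_simps)
    finally show "measure lebesgue (V2 \<union> (S - V2)) \<le> p / q * measure lebesgue U" .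
  qed auto
qed

text \<open>
  The covering step contracts the outer measure of \<open>S\<close>, the infimum \<open>m\<close> of the measures of its
  measurable supersets, by the factor \<open>p / q < 1\<close>; so \<open>m = 0\<close>.
\<close>

lemma steep_flat_negligible:
  fixes F :: "real \<Rightarrow> real"
  assumes mono: "\<And>x y. x \<le> y \<Longrightarrow> F x \<le> F y" and cont: "continuous_on UNIV F"
    and pq: "0 < p" "p < q" and bdd: "bounded S"
    and flat: "\<And>x d. x \<in> S \<Longrightarrow> 0 < d \<Longrightarrow>
        \<exists>a b. a \<le> x \<and> x \<le> b \<and> a < b \<and> b - a < d \<and> F b - F a < p * (b - a)"
    and steep: "\<And>x d. x \<in> S \<Longrightarrow> 0 < d \<Longrightarrow>
        \<exists>a b. a \<le> x \<and> x \<le> b \<and> a < b \<and> b - a < d \<and> F b - F a > q * (b - a)"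
  shows "negligible S"
proof -
  define V where "V = {measure lebesgue T |T. T \<in> lmeasurable \<and> S \<subseteq> T}"
  have V0: "bdd_below V" "V \<noteq> {}"
  proof -
    show "bdd_below V" by (auto simp: V_def intro!: bdd_belowI[of _ 0])
    obtain x B where "S \<subseteq> cball x B" using bdd by (meson bounded_subset_cball)
    thus "V \<noteq> {}" unfolding V_def using lmeasurable_cball by blast
  qed
  define m where "m = Inf V"
  have m_le: "m \<le> measure lebesgue T" if "T \<in> lmeasurable" "S \<subseteq> T" for T
    unfolding m_def by (rule cInf_lower[OF _ V0(1)]) (use that in \<open>auto simp: V_def\<close>)
  have m_approx: "\<exists>T. T \<in> lmeasurable \<and> S \<subseteq> T \<and> measure lebesgue T < e" if "m < e" for e
    using that cInf_lessD[OF V0(2), of e] unfolding m_def by (auto simp: V_def)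
  have "m \<le> 0"
  proof (rule ccontr)
    assume "\<not> m \<le> 0"
    hence "m < q / p * m" using pq by (simp add: field_simps)
    then obtain e where e: "m < e" "e < q / p * m" using dense by blast
    from m_approx[OF e(1)] obtain T where T: "T \<in> lmeasurable" "S \<subseteq> T" "measure lebesgue T < e" by blast
    define d where "d = e - measure lebesgue T"
    have "d > 0" using T by (simp add: d_def)
    obtain U where U: "open U" "T \<subseteq> U" "U - T \<in> lmeasurable" "emeasure lebesgue (U - T) < ennreal d"
      using sets_lebesgue_outer_open[of T d] T \<open>d > 0\<close> by (auto simp: fmeasurable_def)
    have UTd: "measure lebesgue (U - T) < d"
      using U(3,4) \<open>d > 0\<close> by (simp add: emeasure_eq_measure2 ennreal_less_iff)
    have Ueq: "U = T \<union> (U - T)" using U by auto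
    have Ulm: "U \<in> lmeasurable"
      by (subst Ueq) (rule fmeasurable.Un[OF T(1) U(3)])
    have "measure lebesgue U \<le> measure lebesgue T + measure lebesgue (U - T)"
      by (subst Ueq) (rule measure_Un_le[OF fmeasurableD[OF T(1)] fmeasurableD[OF U(3)]])
    hence Ue: "measure lebesgue U < e" using UTd by (simp add: d_def)
    have SU: "S \<subseteq> U" using T(2) U(2) by blast
    obtain T' where T': "T' \<in> lmeasurable" "S \<subseteq> T'" "measure lebesgue T' \<le> p / q * measure lebesgue U"
      by (rule steep_flat_cover_step[OF mono cont pq flat steep U(1) SU Ulm])
    have "p / q * measure lebesgue U < p / q * (q / p * m)"
      using Ue e pq by (intro mult_strict_left_mono) auto
    also have "\<dots> = m" using pq by simp
    finally show False using m_le[OF T'(1,2)] T'(3) by simp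
  qed
  thus ?thesis
    unfolding negligible_outer_le using m_approx by (meson less_imp_le order_le_less_trans)
qed

text \<open>
  Adding a linear function makes \<open>f\<close> monotone with slopes at least \<open>1\<close>. Where the derivative fails to
  exist, two rationals separate the lower and the upper derivative, and there are only countably many such
  pairs.
\<close>

lemma lipschitz_differentiable_ae:
  fixes f :: "real \<Rightarrow> real"
  assumes L: "\<And>x y. \<bar>f x - f y\<bar> \<le> L * \<bar>x - y\<bar>"
  shows "negligible {x. \<nexists>D. (f has_real_derivative D) (at x)}"
proof -
  \<comment> \<open>All difference quotients of this function lie between \<open>1\<close> and \<open>2 * L + 1\<close>.\<close>
  define F where "F x = f x + (L + 1) * x" for x
  have L0: "L \<ge> 0" using order_trans[OF abs_ge_zero L[of 1 0]] by simp
  have slope: "y - x \<le> F y - F x" "F y - F x \<le> (2 * L + 1) * (y - x)" if "x \<le> y" for x y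
    using L[of y x] that by (auto simp: F_def algebra_simps)
  have mono: "F x \<le> F y" if "x \<le> y" for x y using slope[OF that] that by simp
  have cont: "continuous_on UNIV F"
  proof -
    have "L-lipschitz_on UNIV f" using L L0 by (intro lipschitz_onI) (auto simp: dist_real_def)
    hence "continuous_on UNIV f" by (rule lipschitz_on_continuous_on)
    thus ?thesis unfolding F_def by (intro continuous_intros)
  qed
  define s where "s x h = (F (x + h) - F x) / h" for x h
  have s_bd: "1 \<le> s x h" "s x h \<le> 2 * L + 1" if "h \<noteq> 0" for x h
  proof -
    have "1 \<le> s x h \<and> s x h \<le> 2 * L + 1"
    proof (cases "h > 0")
      case True
      thus ?thesis using slope[of x "x + h"] by (auto simp: s_def field_simps)
    next
      case False
      thus ?thesis using slope[of "x + h" x] that by (auto simp: s_def field_simps)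
    qed
    thus "1 \<le> s x h" "s x h \<le> 2 * L + 1" by auto
  qed
  define Flat where "Flat p = {x. \<forall>d>0. \<exists>a b. a \<le> x \<and> x \<le> b \<and> a < b \<and> b - a < d \<and> F b - F a < p * (b - a)}" for p
  define Steep where "Steep q = {x. \<forall>d>0. \<exists>a b. a \<le> x \<and> x \<le> b \<and> a < b \<and> b - a < d \<and> F b - F a > q * (b - a)}" for q
  have freq: "\<exists>h. h \<noteq> 0 \<and> \<bar>h\<bar> < d \<and> P h" if "\<exists>\<^sub>F h in at (0::real). P h" "d > 0" for P d
    using that unfolding frequently_at by (auto simp: dist_real_def)
  have slope_at: "\<exists>a b. a \<le> x \<and> x \<le> b \<and> a < b \<and> b - a = \<bar>h\<bar> \<and> F b - F a = s x h * (b - a)" if "h \<noteq> 0" for x h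
  proof (cases "h > 0")
    case True
    thus ?thesis by (intro exI[of _ x] exI[of _ "x + h"]) (auto simp: s_def)
  next
    case False
    thus ?thesis using that by (intro exI[of _ "x + h"] exI[of _ x]) (auto simp: s_def)
  qed
  have inFlat: "x \<in> Flat p" if fr: "\<exists>\<^sub>F h in at 0. s x h < p" for x p
    unfolding Flat_def
  proof safe
    fix d :: real assume "d > 0"
    from freq[OF fr this] obtain h where h: "h \<noteq> 0" "\<bar>h\<bar> < d" "s x h < p" by blast
    from slope_at[OF h(1)] obtain a b where ab: "a \<le> x" "x \<le> b" "a < b" "b - a = \<bar>h\<bar>" "F b - F a = s x h * (b - a)"
      by blast
    have "F b - F a < p * (b - a)" unfolding ab(5) using ab(3) h(3) by (intro mult_strict_right_mono) auto
    moreover have "b - a < d" using ab(4) h(2) by simp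
    ultimately show "\<exists>a b. a \<le> x \<and> x \<le> b \<and> a < b \<and> b - a < d \<and> F b - F a < p * (b - a)"
      using ab(1-3) by blast
  qed
  have inSteep: "x \<in> Steep p" if fr: "\<exists>\<^sub>F h in at 0. s x h > p" for x p
    unfolding Steep_def
  proof safe
    fix d :: real assume "d > 0"
    from freq[OF fr this] obtain h where h: "h \<noteq> 0" "\<bar>h\<bar> < d" "s x h > p" by blast
    from slope_at[OF h(1)] obtain a b where ab: "a \<le> x" "x \<le> b" "a < b" "b - a = \<bar>h\<bar>" "F b - F a = s x h * (b - a)"
      by blast
    have "F b - F a > p * (b - a)" unfolding ab(5) using ab(3) h(3) by (intro mult_strict_right_mono) auto
    moreover have "b - a < d" using ab(4) h(2) by simp
    ultimately show "\<exists>a b. a \<le> x \<and> x \<le> b \<and> a < b \<and> b - a < d \<and> F b - F a > p * (b - a)"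
      using ab(1-3) by blast
  qed
  have main: "\<exists>p q::rat. 0 < p \<and> p < q \<and> x \<in> Flat (of_rat p) \<inter> Steep (of_rat q)"
    if nd: "\<nexists>D. (f has_real_derivative D) (at x)" for x
  proof -
    let ?s = "\<lambda>h. ereal (s x h)"
    let ?l = "Liminf (at 0) ?s" and ?u = "Limsup (at 0) ?s"
    have ev: "\<forall>\<^sub>F h in at (0::real). h \<noteq> 0" by (simp add: eventually_at_filter)
    have l1: "1 \<le> ?l" by (rule Liminf_bounded) (use ev s_bd in \<open>auto elim!: eventually_mono\<close>)
    have u1: "?u \<le> ereal (2 * L + 1)" by (rule Limsup_bounded) (use ev s_bd in \<open>auto elim!: eventually_mono\<close>)
    have lu: "?l \<le> ?u" by (rule Liminf_le_Limsup) simp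
    have "?l \<noteq> ?u"
    proof
      assume eq: "?l = ?u"
      have "\<bar>?l\<bar> \<noteq> \<infinity>" using l1 u1 eq by auto
      then obtain D where D: "?l = ereal D" by (metis ereal_real)
      have "(?s \<longlongrightarrow> ereal D) (at 0)" using D eq by (intro Liminf_eq_Limsup) auto
      hence "(s x \<longlongrightarrow> D) (at 0)" by (simp add: lim_ereal)
      moreover have "s x = (\<lambda>h. (F (x + h) - F x) / h)" by (auto simp: s_def)
      ultimately have "(F has_real_derivative D) (at x)" by (simp add: DERIV_def)
      hence "((\<lambda>x. F x - (L + 1) * x) has_real_derivative (D - (L + 1))) (at x)"
        by (auto intro!: derivative_eq_intros)
      moreover have "(\<lambda>x. F x - (L + 1) * x) = f" by (auto simp: F_def)
      ultimately show False using nd by auto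
    qed
    hence "?l < ?u" using lu by simp
    then obtain q where q: "?l < ereal (of_rat q)" "ereal (of_rat q) < ?u" using ereal_dense3 by blast
    obtain p where p: "?l < ereal (of_rat p)" "ereal (of_rat p) < ereal (of_rat q)" using ereal_dense3[OF q(1)] by blast
    have "x \<in> Flat (of_rat p)"
    proof (rule inFlat, rule ccontr)
      assume "\<not> (\<exists>\<^sub>F h in at 0. s x h < of_rat p)"
      hence "\<forall>\<^sub>F h in at 0. ereal (of_rat p) \<le> ?s h" by (simp add: not_frequently not_less)
      hence "ereal (of_rat p) \<le> ?l" by (rule Liminf_bounded)
      thus False using p by simp
    qed
    moreover have "x \<in> Steep (of_rat q)"
    proof (rule inSteep, rule ccontr)
      assume "\<not> (\<exists>\<^sub>F h in at 0. s x h > of_rat q)"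
      hence "\<forall>\<^sub>F h in at 0. ?s h \<le> ereal (of_rat q)" by (simp add: not_frequently not_less)
      hence "?u \<le> ereal (of_rat q)" by (rule Limsup_bounded)
      thus False using q by simp
    qed
    moreover have "0 < p"
    proof -
      have "1 < ereal (of_rat p)" by (rule order.strict_trans1[OF l1 p(1)])
      hence "(1::real) < of_rat p" by (simp add: one_ereal_def)
      hence "(0::real) < of_rat p" by linarith
      thus ?thesis by simp
    qed
    ultimately show ?thesis using p(2) by (auto simp: of_rat_less)
  qed
  define Z where "Z p q k = Flat (of_rat p) \<inter> Steep (of_rat q) \<inter> cball 0 (real k)" for p q k
  have "negligible (Z p q k)" if "0 < p" "p < q" for p q k
  proof (rule steep_flat_negligible[OF mono cont])
    show "0 < (of_rat p :: real)" "(of_rat p :: real) < of_rat q" using that by (auto simp: of_rat_less)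
    show "bounded (Z p q k)" by (rule bounded_subset[OF bounded_cball]) (auto simp: Z_def)
  qed (auto simp only: Z_def Flat_def Steep_def Int_iff mem_Collect_eq)
  hence "negligible (\<Union>((\<lambda>(p, q, k). Z p q k) ` {(p, q, k). 0 < p \<and> p < q}))"
    by (intro negligible_countable_Union) auto
  moreover have "{x. \<nexists>D. (f has_real_derivative D) (at x)} \<subseteq> \<Union>((\<lambda>(p, q, k). Z p q k) ` {(p, q, k). 0 < p \<and> p < q})"
  proof safe
    fix x assume "\<nexists>D. (f has_real_derivative D) (at x)"
    from main[OF this] obtain p q :: rat where "0 < p" "p < q" "x \<in> Flat (of_rat p) \<inter> Steep (of_rat q)" by blast
    moreover obtain k where "\<bar>x\<bar> \<le> real k" using real_arch_simple by blast
    ultimately have "x \<in> (\<lambda>(p, q, k). Z p q k) (p, q, k)" by (auto simp: Z_def)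
    thus "x \<in> \<Union>((\<lambda>(p, q, k). Z p q k) ` {(p, q, k). 0 < p \<and> p < q})"
      using \<open>0 < p\<close> \<open>p < q\<close> by blast
  qed
  ultimately show ?thesis by (rule negligible_subset)
qed

section \<open>Radial limits of bounded holomorphic functions\<close>

lemma circlepath_eq_circ_integral:
  assumes g: "continuous_on (sphere 0 1) g"
    and I: "(g has_contour_integral I) (circlepath 0 1)"
  shows "I = 2 * pi * \<i> * (\<integral>t. g (cis t) * cis t \<partial>circ)"
proof -
  let ?h = "\<lambda>t. g (cis t) * (\<i> * cis t)"
  have gc: "continuous_on UNIV (\<lambda>t. g (cis t))"
    by (rule continuous_on_compose2[OF g]) (auto intro!: continuous_intros)
  have hc: "continuous_on UNIV ?h" by (intro continuous_intros gc)
  have "(?h has_integral I) {0..2*pi}"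
    using I unfolding circlepath_def has_contour_integral_part_circlepath_iff[of 0 "2*pi", simplified]
    by (simp add: cis_conv_exp mult_ac)
  hence "integral {0..2*pi} ?h = I" by (rule integral_unique)
  moreover have "set_integrable lborel {0..2*pi} ?h"
    by (rule borel_integrable_atLeastAtMost') (rule continuous_on_subset[OF hc], simp)
  ultimately have "I = (LBINT t. indicat_real {0..2*pi} t *\<^sub>R ?h t)"
    using set_borel_integral_eq_integral(2) by (metis set_lebesgue_integral_def)
  also have "\<dots> = 2 * pi * (\<integral>t. ?h t \<partial>circ)"
    using hc by (subst circ_integral_eq) (auto intro: borel_measurable_continuous_onI)
  also have "(\<integral>t. ?h t \<partial>circ) = (\<integral>t. \<i> * (g (cis t) * cis t) \<partial>circ)"
    by (simp add: mult_ac)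
  also have "\<dots> = \<i> * (\<integral>t. g (cis t) * cis t \<partial>circ)"
    by (rule integral_mult_right_zero)
  finally show ?thesis by (simp add: mult_ac)
qed

text \<open>
  The Cauchy kernel for the derivative at the point \<open>\<rho>\<close>, minus the kernel with the reflected pole \<open>1 / \<rho>\<close>, which
  integrates to zero against analytic functions. The difference decays faster away from \<open>w = 1\<close>: against a
  function of size \<open>norm (w - 1)\<close>, the Cauchy kernel alone would leave a logarithmic divergence as \<open>\<rho> \<rightarrow> 1\<close>,
  whereas the difference is controlled by the Poisson kernel.
\<close>

definition dkernel :: "real \<Rightarrow> complex \<Rightarrow> complex" where
  "dkernel \<rho> w = 1 / (w - of_real \<rho>)\<^sup>2 - 1 / (1 - of_real \<rho> * w)\<^sup>2"

lemma circle_minus_real_nonzero: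
  assumes "norm w = 1" "0 < \<rho>" "\<rho> < 1"
  shows "w - complex_of_real \<rho> \<noteq> 0" "1 - complex_of_real \<rho> * w \<noteq> 0"
proof -
  show "w - complex_of_real \<rho> \<noteq> 0" using assms by auto
  show "1 - complex_of_real \<rho> * w \<noteq> 0"
  proof
    assume "1 - complex_of_real \<rho> * w = 0"
    hence "norm (complex_of_real \<rho> * w) = norm (1::complex)" by simp
    thus False using assms by (simp add: norm_mult)
  qed
qed

lemma norm_one_minus_circle:
  assumes "norm w = 1"
  shows "norm (1 - complex_of_real \<rho> * w) = norm (w - complex_of_real \<rho>)"
proof -
  have "w * cnj w = 1" using complex_norm_square[of w] assms by simp
  hence "1 - complex_of_real \<rho> * w = w * cnj (w - complex_of_real \<rho>)" by (simp add: algebra_simps)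
  hence "norm (1 - complex_of_real \<rho> * w) = norm w * norm (cnj (w - complex_of_real \<rho>))"
    by (simp only: norm_mult)
  thus ?thesis using assms by (simp only: complex_mod_cnj)
qed

lemma deriv_eq_circ_integral:
  assumes E: "continuous_on (cball 0 1) E" "E holomorphic_on ball 0 1" and \<rho>: "0 < \<rho>" "\<rho> < 1"
  shows "deriv E (of_real \<rho>) = (\<integral>t. E (cis t) * dkernel \<rho> (cis t) * cis t \<partial>circ)"
proof -
  have nz: "1 - complex_of_real \<rho> * w \<noteq> 0" if "norm w \<le> 1" for w
  proof
    assume "1 - complex_of_real \<rho> * w = 0"
    hence "norm (complex_of_real \<rho> * w) = norm (1::complex)" by simp
    hence "\<rho> * norm w = 1" using \<rho> by (simp add: norm_mult)
    moreover have "\<rho> * norm w \<le> \<rho> * 1" using that \<rho> by (intro mult_left_mono) auto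
    ultimately show False using \<rho> by simp
  qed
  have 1: "((\<lambda>u. E u / (u - of_real \<rho>) ^ Suc 1) has_contour_integral
      complex_of_real (2 * pi) * \<i> / fact 1 * (deriv ^^ 1) E (of_real \<rho>)) (circlepath 0 1)"
    by (rule Cauchy_has_contour_integral_higher_derivative_circlepath[OF E]) (use \<rho> in simp)
  \<comment> \<open>The factor \<open>u\<close> lets the Cauchy formula at \<open>0\<close> show that the second kernel integrates to zero.\<close>
  let ?H = "\<lambda>u. E u * u / (1 - of_real \<rho> * u)\<^sup>2"
  have "((\<lambda>u. ?H u / (u - 0)) has_contour_integral 2 * complex_of_real pi * \<i> * ?H 0) (circlepath 0 1)"
  proof (rule Cauchy_integral_circlepath)
    show "continuous_on (cball 0 1) ?H" using nz by (intro continuous_intros E) auto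
    show "?H holomorphic_on ball 0 1" using nz by (intro holomorphic_intros E) auto
  qed simp
  hence "((\<lambda>u. ?H u / (u - 0)) has_contour_integral 0) (circlepath 0 1)" by simp
  hence 2: "((\<lambda>u. E u / (1 - of_real \<rho> * u)\<^sup>2) has_contour_integral 0) (circlepath 0 1)"
    by (rule has_contour_integral_eq) auto
  have 3: "((\<lambda>u. E u / (u - of_real \<rho>) ^ Suc 1 - E u / (1 - of_real \<rho> * u)\<^sup>2) has_contour_integral
      complex_of_real (2 * pi) * \<i> / fact 1 * (deriv ^^ 1) E (of_real \<rho>) - 0) (circlepath 0 1)"
    by (rule has_contour_integral_diff[OF 1 2])
  have 4: "((\<lambda>u. E u * dkernel \<rho> u) has_contour_integral 2 * pi * \<i> * deriv E (of_real \<rho>)) (circlepath 0 1)"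
  proof -
    have "(\<lambda>u. E u / (u - of_real \<rho>) ^ Suc 1 - E u / (1 - of_real \<rho> * u)\<^sup>2) = (\<lambda>u. E u * dkernel \<rho> u)"
      by (simp add: dkernel_def fun_eq_iff right_diff_distrib power2_eq_square)
    with 3 show ?thesis by simp
  qed
  have "continuous_on (sphere 0 1) (\<lambda>u. E u * dkernel \<rho> u)"
    unfolding dkernel_def
    by (intro continuous_intros continuous_on_subset[OF E(1)]) (use circle_minus_real_nonzero \<rho> in auto)
  from circlepath_eq_circ_integral[OF this 4] show ?thesis by simp
qed

lemma norm_dkernel_le:
  assumes w: "norm w = 1" and \<rho>: "0 < \<rho>" "\<rho> < 1"
  shows "norm (dkernel \<rho> w) \<le> 4 * (1 - \<rho>) * norm (w - 1) / norm (w - of_real \<rho>) ^ 4"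
    and "norm (w - 1) \<le> 2 * norm (w - of_real \<rho>)"
proof -
  note nz = circle_minus_real_nonzero[OF w \<rho>]
  have "dkernel \<rho> w = ((1 + of_real \<rho>) * (1 - w) * (1 - of_real \<rho>) * (1 + w)) /
      ((w - of_real \<rho>)\<^sup>2 * (1 - of_real \<rho> * w)\<^sup>2)"
    unfolding dkernel_def using nz by (simp add: divide_simps) (simp add: power2_eq_square algebra_simps)
  hence "norm (dkernel \<rho> w) = (norm (1 + complex_of_real \<rho>) * norm (1 - w) * norm (1 - complex_of_real \<rho>) * norm (1 + w)) /
      ((norm (w - of_real \<rho>))\<^sup>2 * (norm (1 - of_real \<rho> * w))\<^sup>2)"
    by (simp only: norm_mult norm_divide norm_power)
  also have "norm (1 - complex_of_real \<rho> * w) = norm (w - of_real \<rho>)" by (rule norm_one_minus_circle[OF w])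
  also have "norm (1 - complex_of_real \<rho>) = 1 - \<rho>"
    using \<rho> by (metis abs_of_pos diff_gt_0_iff_gt norm_of_real of_real_1 of_real_diff)
  also have "norm (1 + complex_of_real \<rho>) = 1 + \<rho>"
    using \<rho> by (metis abs_of_pos add_pos_pos norm_of_real of_real_1 of_real_add zero_less_one)
  also have "(1 + \<rho>) * norm (1 - w) * (1 - \<rho>) * norm (1 + w) / ((norm (w - of_real \<rho>))\<^sup>2 * (norm (w - of_real \<rho>))\<^sup>2) \<le>
      2 * norm (1 - w) * (1 - \<rho>) * 2 / ((norm (w - of_real \<rho>))\<^sup>2 * (norm (w - of_real \<rho>))\<^sup>2)"
  proof (intro divide_right_mono mult_mono)
    show "norm (1 + w) \<le> 2" using norm_triangle_ineq[of 1 w] w by simp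
  qed (use \<rho> in auto)
  also have "\<dots> = 4 * (1 - \<rho>) * norm (w - 1) / norm (w - of_real \<rho>) ^ 4"
    by (simp add: norm_minus_commute power4_eq_xxxx power2_eq_square mult_ac)
  finally show "norm (dkernel \<rho> w) \<le> 4 * (1 - \<rho>) * norm (w - 1) / norm (w - of_real \<rho>) ^ 4" .
  have "1 - \<rho> \<le> norm (w - of_real \<rho>)"
    using norm_triangle_ineq2[of w "of_real \<rho>"] w \<rho> by simp
  moreover have "norm (w - 1) \<le> norm (w - of_real \<rho>) + norm (complex_of_real \<rho> - 1)"
    using norm_triangle_ineq[of "w - of_real \<rho>" "of_real \<rho> - 1"] by simp
  moreover have "norm (complex_of_real \<rho> - 1) = 1 - \<rho>"
    using \<rho> by (metis abs_of_pos diff_gt_0_iff_gt norm_minus_commute norm_of_real of_real_1 of_real_diff)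
  ultimately show "norm (w - 1) \<le> 2 * norm (w - of_real \<rho>)" by linarith
qed

definition poisson :: "real \<Rightarrow> real \<Rightarrow> real" where
  "poisson \<rho> t = (1 - \<rho>\<^sup>2) / (norm (cis t - of_real \<rho>))\<^sup>2"

lemma poisson_continuous:
  assumes "0 < \<rho>" "\<rho> < 1"
  shows "continuous_on UNIV (poisson \<rho>)"
  unfolding poisson_def[abs_def]
  by (intro continuous_intros) (use circle_minus_real_nonzero(1)[OF _ assms] in auto)

text \<open>
  The Poisson kernel is the real part on the circle of \<open>(1 + \<rho> z) / (1 - \<rho> z)\<close>, which is analytic on the
  closed disk and has the value \<open>1\<close> at the centre.
\<close>

lemma poisson_mean:
  assumes \<rho>: "0 < \<rho>" "\<rho> < 1"
  shows "(\<integral>t. poisson \<rho> t \<partial>circ) = 1"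
proof -
  let ?F = "\<lambda>z. (1 + of_real \<rho> * z) / (1 - of_real \<rho> * z)"
  have "?F holomorphic_on ball 0 (1 / \<rho>)"
  proof (intro holomorphic_intros)
    fix z :: complex assume "z \<in> ball 0 (1 / \<rho>)"
    hence "norm (complex_of_real \<rho> * z) < 1" using \<rho> by (simp add: norm_mult field_simps)
    thus "1 - complex_of_real \<rho> * z \<noteq> 0" by auto
  qed
  hence "(\<integral>t. ?F (cis t) \<partial>circ) = ?F 0"
    by (rule circ_mean_value) (use \<rho> in simp)
  moreover have "integrable circ (\<lambda>t. ?F (cis t))"
    by (intro circ_integrable_continuous continuous_intros) (use circle_minus_real_nonzero(2)[OF _ \<rho>] in auto)
  ultimately have "(\<integral>t. Re (?F (cis t)) \<partial>circ) = 1"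
    by (subst integral_Re) auto
  moreover have "Re (?F (cis t)) = poisson \<rho> t" for t
  proof -
    let ?w = "cis t"
    have nz: "1 - complex_of_real \<rho> * ?w \<noteq> 0" by (rule circle_minus_real_nonzero(2)[OF _ \<rho>]) simp
    have "a / u = a * cnj u / of_real ((norm u)\<^sup>2)" if "u \<noteq> 0" for a u
      unfolding complex_norm_square using that by simp
    from this[OF nz] have "?F ?w = (1 + of_real \<rho> * ?w) * cnj (1 - of_real \<rho> * ?w) / of_real ((norm (1 - of_real \<rho> * ?w))\<^sup>2)" .
    hence "Re (?F ?w) = Re ((1 + of_real \<rho> * ?w) * cnj (1 - of_real \<rho> * ?w)) / (norm (1 - of_real \<rho> * ?w))\<^sup>2"
      by (simp only: Re_divide_of_real)
    also have "Re ((1 + of_real \<rho> * ?w) * cnj (1 - of_real \<rho> * ?w)) = 1 - (\<rho> * cos t * (\<rho> * cos t) + \<rho> * sin t * (\<rho> * sin t))"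
      by (simp add: algebra_simps)
    also have "\<dots> = 1 - \<rho>\<^sup>2 * ((cos t)\<^sup>2 + (sin t)\<^sup>2)"
      unfolding power2_eq_square by (simp only: distrib_left mult_ac)
    also have "\<dots> = 1 - \<rho>\<^sup>2" by simp
    finally show ?thesis unfolding poisson_def by (simp add: norm_one_minus_circle)
  qed
  ultimately show ?thesis by simp
qed

text \<open>
  Near \<open>1\<close> the integrand for the derivative is at most \<open>16 * \<eta>\<close> times the Poisson kernel; away from
  \<open>1\<close> the kernel carries a factor \<open>1 - \<rho>\<close> and is otherwise bounded.
\<close>

lemma radial_deriv_tendsto_0:
  assumes lip: "\<And>z. z \<in> cball 0 1 \<Longrightarrow> norm (E z) \<le> M * norm (z - 1)"
    and E: "continuous_on (cball 0 1) E" "E holomorphic_on ball 0 1"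
    and small: "\<And>\<eta>. 0 < \<eta> \<Longrightarrow> \<exists>d>0. \<forall>w. norm w = 1 \<longrightarrow> norm (w - 1) < d \<longrightarrow> norm (E w) \<le> \<eta> * norm (w - 1)"
  shows "((\<lambda>\<rho>. deriv E (of_real \<rho>)) \<longlongrightarrow> 0) (at_left 1)"
proof (rule tendstoI)
  fix e :: real assume e: "0 < e"
  \<comment> \<open>The final bound \<open>16 * \<eta> = e / 2\<close> leaves room for the part away from \<open>1\<close>.\<close>
  define \<eta> where "\<eta> = e / 32"
  have \<eta>: "0 < \<eta>" using e by (simp add: \<eta>_def)
  from small[OF \<eta>] obtain d where d: "d > 0" "\<And>w. norm w = 1 \<Longrightarrow> norm (w - 1) < d \<Longrightarrow> norm (E w) \<le> \<eta> * norm (w - 1)" by blast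
  have M0: "0 \<le> M" using order_trans[OF norm_ge_zero lip[of 0]] by simp
  have bound: "norm (deriv E (of_real \<rho>)) \<le> 16 * \<eta> + 64 * M * (1 - \<rho>) / d\<^sup>2" if \<rho>: "0 < \<rho>" "\<rho> < 1" for \<rho>
  proof -
    have Ec: "continuous_on UNIV (\<lambda>t. E (cis t))"
      by (rule continuous_on_compose2[OF E(1)]) (auto intro!: continuous_intros)
    have Kc: "continuous_on UNIV (\<lambda>t. dkernel \<rho> (cis t))"
      unfolding dkernel_def
      by (intro continuous_intros) (use circle_minus_real_nonzero[OF _ \<rho>] in auto)
    have "norm (deriv E (of_real \<rho>)) \<le> (\<integral>t. norm (E (cis t) * dkernel \<rho> (cis t) * cis t) \<partial>circ)"
      unfolding deriv_eq_circ_integral[OF E \<rho>] by simp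
    also have "\<dots> \<le> (\<integral>t. 16 * \<eta> * poisson \<rho> t + 64 * M * (1 - \<rho>) / d\<^sup>2 \<partial>circ)"
    proof (rule integral_mono)
      show "integrable circ (\<lambda>t. norm (E (cis t) * dkernel \<rho> (cis t) * cis t))"
        by (intro circ_integrable_continuous continuous_intros Ec Kc)
      show "integrable circ (\<lambda>t. 16 * \<eta> * poisson \<rho> t + 64 * M * (1 - \<rho>) / d\<^sup>2)"
        using d(1) by (intro circ_integrable_continuous continuous_intros poisson_continuous \<rho>) auto
      fix t
      define w where "w = cis t"
      define x where "x = norm (w - 1)"
      define y where "y = norm (w - of_real \<rho>)"
      have w: "norm w = 1" by (simp add: w_def)
      have y: "0 < y" using circle_minus_real_nonzero(1)[OF w \<rho>] by (simp add: y_def)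
      have x: "0 \<le> x" "x \<le> 2 * y" using norm_dkernel_le(2)[OF w \<rho>] by (simp_all add: x_def y_def)
      have K: "norm (dkernel \<rho> w) \<le> 4 * (1 - \<rho>) * x / y ^ 4"
        using norm_dkernel_le(1)[OF w \<rho>] by (simp add: x_def y_def)
      have quad: "(k * x) * (4 * (1 - \<rho>) * x / y ^ 4) \<le> 16 * k * (1 - \<rho>) / y\<^sup>2" if "0 \<le> k" for k
      proof -
        have "x * x \<le> (2 * y) * (2 * y)" using x y by (intro mult_mono) auto
        hence "(4 * k * (1 - \<rho>)) * (x * x) / y ^ 4 \<le> (4 * k * (1 - \<rho>)) * (4 * (y * y)) / y ^ 4"
          using that \<rho> y by (intro divide_right_mono mult_left_mono) auto
        also have "\<dots> = 16 * k * (1 - \<rho>) / y\<^sup>2"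
          using y by (simp add: power4_eq_xxxx power2_eq_square)
        finally show ?thesis by (simp add: mult_ac)
      qed
      have "norm (E w) * norm (dkernel \<rho> w) \<le> 16 * \<eta> * poisson \<rho> t + 64 * M * (1 - \<rho>) / d\<^sup>2"
      proof (cases "x < d")
        case True
        hence "norm (E w) \<le> \<eta> * x" using d(2)[OF w] by (simp add: x_def)
        hence "norm (E w) * norm (dkernel \<rho> w) \<le> (\<eta> * x) * (4 * (1 - \<rho>) * x / y ^ 4)"
          using K \<eta> x by (intro mult_mono) auto
        also have "\<dots> \<le> 16 * \<eta> * (1 - \<rho>) / y\<^sup>2" by (rule quad) (use \<eta> in simp)
        also have "\<dots> \<le> 16 * \<eta> * (1 - \<rho>\<^sup>2) / y\<^sup>2"
        proof (intro divide_right_mono mult_left_mono)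
          have "\<rho>\<^sup>2 \<le> \<rho>" using \<rho> by (simp add: power2_eq_square mult_left_le)
          thus "1 - \<rho> \<le> 1 - \<rho>\<^sup>2" by simp
        qed (use \<eta> in auto)
        also have "\<dots> = 16 * \<eta> * poisson \<rho> t" by (simp add: poisson_def y_def w_def)
        also have "\<dots> \<le> 16 * \<eta> * poisson \<rho> t + 64 * M * (1 - \<rho>) / d\<^sup>2"
          using M0 \<rho> by simp
        finally show ?thesis .
      next
        case False
        have "norm (E w) \<le> M * x" using lip[of w] w by (simp add: x_def)
        hence "norm (E w) * norm (dkernel \<rho> w) \<le> (M * x) * (4 * (1 - \<rho>) * x / y ^ 4)"
          using K M0 x by (intro mult_mono) auto
        also have "\<dots> \<le> 16 * M * (1 - \<rho>) / y\<^sup>2" by (rule quad[OF M0])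
        also have "\<dots> \<le> 16 * M * (1 - \<rho>) / (d / 2)\<^sup>2"
          using False x y d(1) M0 \<rho> by (intro divide_left_mono power_mono mult_pos_pos zero_less_power) auto
        also have "\<dots> = 64 * M * (1 - \<rho>) / d\<^sup>2" by (simp add: power_divide)
        also have "\<dots> \<le> 16 * \<eta> * poisson \<rho> t + 64 * M * (1 - \<rho>) / d\<^sup>2"
        proof -
          have "\<rho>\<^sup>2 \<le> 1" using \<rho> by (simp add: power_le_one)
          thus ?thesis using \<eta> by (simp add: poisson_def)
        qed
        finally show ?thesis .
      qed
      thus "norm (E (cis t) * dkernel \<rho> (cis t) * cis t) \<le> 16 * \<eta> * poisson \<rho> t + 64 * M * (1 - \<rho>) / d\<^sup>2"
        by (simp add: norm_mult w_def)
    qed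
    also have "\<dots> = 16 * \<eta> + 64 * M * (1 - \<rho>) / d\<^sup>2"
      using poisson_mean[OF \<rho>] circ_integrable_continuous[OF poisson_continuous[OF \<rho>]] by simp
    finally show ?thesis .
  qed
  have "((\<lambda>\<rho>. 16 * \<eta> + 64 * M * (1 - \<rho>) / d\<^sup>2) \<longlongrightarrow> 16 * \<eta> + 64 * M * (1 - 1) / d\<^sup>2) (at_left 1)"
    using d(1) by (intro tendsto_intros) auto
  moreover have "16 * \<eta> + 64 * M * (1 - 1) / d\<^sup>2 < e" using e by (simp add: \<eta>_def)
  ultimately have "\<forall>\<^sub>F \<rho> in at_left 1. 16 * \<eta> + 64 * M * (1 - \<rho>) / d\<^sup>2 < e"
    by (rule order_tendstoD(2))
  moreover have "\<forall>\<^sub>F \<rho> in at_left 1. 0 < \<rho> \<and> \<rho> < (1::real)"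
    using zero_less_one eventually_at_left_field by blast
  ultimately show "\<forall>\<^sub>F \<rho> in at_left 1. dist (deriv E (of_real \<rho>)) 0 < e"
    by eventually_elim (use bound in \<open>auto simp: dist_norm intro: order_le_less_trans\<close>)
qed

lemma Ln_near_1: "\<exists>d>0. \<forall>w. norm (w - 1) < d \<longrightarrow> norm (Ln w) \<le> 2 * norm (w - 1)"
proof -
  have "(Ln has_field_derivative inverse 1) (at 1)" by (rule has_field_derivative_Ln) simp
  hence "((\<lambda>w. (Ln w - Ln 1) / (w - 1)) \<longlongrightarrow> 1) (at 1)"
    by (simp add: has_field_derivative_iff)
  hence "\<forall>\<^sub>F w in at 1. norm ((Ln w - Ln 1) / (w - 1)) < 2"
    by (intro order_tendstoD(2)[OF tendsto_norm, of _ 1]) auto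
  then obtain d where d: "d > 0" "\<And>w. w \<noteq> 1 \<Longrightarrow> dist w 1 < d \<Longrightarrow> norm ((Ln w - Ln 1) / (w - 1)) < 2"
    unfolding eventually_at by auto
  have "norm (Ln w) \<le> 2 * norm (w - 1)" if "norm (w - 1) < d" for w
  proof (cases "w = 1")
    case False
    hence "norm (Ln w / (w - 1)) < 2" using d(2)[of w] that by (simp add: dist_norm)
    thus ?thesis using False by (simp add: norm_divide divide_less_eq)
  qed simp
  thus ?thesis using d(1) by blast
qed

text \<open>
  Rewrites a vanishing derivative in the angle as smallness in the distance to \<open>1\<close> along the circle; the
  angle of \<open>w\<close> is the imaginary part of \<open>Ln w\<close>.
\<close>

lemma circle_small_o:
  assumes "((\<lambda>s. E (cis s)) has_vector_derivative 0) (at 0)" "E 1 = 0" "0 < \<eta>"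
  shows "\<exists>d>0. \<forall>w. norm w = 1 \<longrightarrow> norm (w - 1) < d \<longrightarrow> norm (E w) \<le> \<eta> * norm (w - 1 :: complex)"
proof -
  have "((\<lambda>s. E (cis s)) has_derivative (\<lambda>_. 0)) (at 0)"
    using assms(1) by (simp add: has_vector_derivative_def)
  hence "\<forall>e>0. \<exists>d>0. \<forall>y. norm (y - 0) < d \<longrightarrow> norm (E (cis y) - E (cis 0) - 0) \<le> e * norm (y - 0)"
    unfolding has_derivative_at_alt by blast
  moreover have "0 < \<eta> / 2" using assms(3) by simp
  ultimately obtain d1 where "d1 > 0" "\<forall>y. norm (y - 0) < d1 \<longrightarrow> norm (E (cis y) - E (cis 0) - 0) \<le> \<eta> / 2 * norm (y - 0)"
    by blast
  hence d1: "d1 > 0" "\<And>s. norm s < d1 \<Longrightarrow> norm (E (cis s)) \<le> \<eta> / 2 * norm s"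
    using assms(2) by simp_all
  obtain d2 where d2: "d2 > 0" "\<And>w. norm (w - 1) < d2 \<Longrightarrow> norm (Ln w) \<le> 2 * norm (w - 1)"
    using Ln_near_1 by blast
  show ?thesis
  proof (intro exI[of _ "min d2 (d1 / 2)"] conjI allI impI)
    show "0 < min d2 (d1 / 2)" using d1 d2 by simp
    fix w :: complex assume w: "norm w = 1" "norm (w - 1) < min d2 (d1 / 2)"
    have w0: "w \<noteq> 0" using w(1) by auto
    define s where "s = Im (Ln w)"
    have "Re (Ln w) = 0" using w0 w(1) by simp
    hence "Ln w = \<i> * of_real s" by (simp add: complex_eq_iff s_def)
    hence ws: "w = cis s" using exp_Ln[OF w0] by (simp add: cis_conv_exp)
    have s: "norm s \<le> 2 * norm (w - 1)" using abs_Im_le_cmod[of "Ln w"] d2(2)[of w] w(2) by (simp add: s_def)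
    hence "norm (E (cis s)) \<le> \<eta> / 2 * norm s" using d1(2)[of s] w(2) by simp
    also have "\<dots> \<le> \<eta> / 2 * (2 * norm (w - 1))" using s assms(3) by (intro mult_left_mono) auto
    finally show "norm (E w) \<le> \<eta> * norm (w - 1)" using ws by simp
  qed
qed

text \<open>
  Rotate the point to \<open>1\<close> and subtract the tangent, a linear function of \<open>z\<close>: the remainder \<open>E\<close> is
  \<open>o (norm (z - 1))\<close> along the circle, and its derivative, which is \<open>\<phi>\<close> up to rotation and a constant, tends to
  \<open>0\<close> along the radius.
\<close>

lemma fatou_at_differentiable_point:
  assumes FF: "B-lipschitz_on (cball 0 1) F" and F': "\<And>z. z \<in> ball 0 1 \<Longrightarrow> (F has_field_derivative \<phi> z) (at z)"
    and D: "((\<lambda>t. F (cis t)) has_vector_derivative L) (at t\<^sub>0)"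
  shows "((\<lambda>\<rho>. \<phi> (of_real \<rho> * cis t\<^sub>0)) \<longlongrightarrow> L / (\<i> * cis t\<^sub>0)) (at_left 1)"
proof -
  define \<zeta> where "\<zeta> = cis t\<^sub>0"
  define C where "C = L / \<i>"
  define E where "E z = F (\<zeta> * z) - F \<zeta> - C * (z - 1)" for z
  have \<zeta>: "norm \<zeta> = 1" "\<zeta> \<noteq> 0" by (simp_all add: \<zeta>_def)
  have Eder: "(E has_field_derivative \<phi> (\<zeta> * z) * \<zeta> - C) (at z)" if "z \<in> ball 0 1" for z
  proof -
    have "\<zeta> * z \<in> ball 0 1" using that \<zeta> by (simp add: norm_mult)
    from DERIV_chain2[where f = F and g = "\<lambda>z. \<zeta> * z" and Db = \<zeta> and x = z and s = UNIV, OF F'[OF this]]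
    have "((\<lambda>z. F (\<zeta> * z)) has_field_derivative \<phi> (\<zeta> * z) * \<zeta>) (at z)"
      by (auto intro!: derivative_eq_intros)
    thus ?thesis unfolding E_def by (auto intro!: derivative_eq_intros)
  qed
  have "((\<lambda>\<rho>. deriv E (of_real \<rho>)) \<longlongrightarrow> 0) (at_left 1)"
  proof (rule radial_deriv_tendsto_0[where M = "B + norm C"])
    fix z :: complex assume z: "z \<in> cball 0 1"
    have "norm (F (\<zeta> * z) - F \<zeta>) \<le> B * norm (\<zeta> * z - \<zeta>)"
      using lipschitz_onD[OF FF, of "\<zeta> * z" \<zeta>] z \<zeta> by (simp add: norm_mult dist_norm)
    also have "norm (\<zeta> * z - \<zeta>) = norm (z - 1)"
      using \<zeta> by (metis mult.right_neutral mult_1 norm_mult right_diff_distrib)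
    finally have "norm (F (\<zeta> * z) - F \<zeta>) \<le> B * norm (z - 1)" .
    moreover have "norm (E z) \<le> norm (F (\<zeta> * z) - F \<zeta>) + norm (C * (z - 1))"
      unfolding E_def by (rule norm_triangle_ineq4)
    ultimately show "norm (E z) \<le> (B + norm C) * norm (z - 1)" unfolding norm_mult distrib_right by linarith
  next
    have Fc: "continuous_on (cball 0 1) F" by (rule lipschitz_on_continuous_on[OF FF])
    have "continuous_on (cball 0 1) (\<lambda>z. F (\<zeta> * z))"
      by (rule continuous_on_compose2[OF Fc]) (use \<zeta> in \<open>auto intro!: continuous_intros simp: norm_mult\<close>)
    thus "continuous_on (cball 0 1) E" unfolding E_def by (intro continuous_intros)
    show "E holomorphic_on ball 0 1"
      unfolding holomorphic_on_open[OF open_ball] using Eder by blast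
    have "((\<lambda>s. t\<^sub>0 + s) has_vector_derivative 1) (at 0)"
      by (auto intro!: derivative_eq_intros simp: has_vector_derivative_def)
    from vector_diff_chain_at[OF this, of "\<lambda>t. F (cis t)" L] D
    have 1: "((\<lambda>s. F (cis (t\<^sub>0 + s))) has_vector_derivative L) (at 0)"
      by (simp add: o_def)
    have "((\<lambda>s. exp (\<i> * of_real s)) has_vector_derivative \<i>) (at 0)"
      by (rule has_vector_derivative_real_field[where f = "\<lambda>z. exp (\<i> * z)"])
         (auto intro!: derivative_eq_intros)
    hence 2: "(cis has_vector_derivative \<i>) (at 0)"
      by (simp add: cis_conv_exp[abs_def])
    have "((\<lambda>s. F (cis (t\<^sub>0 + s)) - F \<zeta> - C * (cis s - 1)) has_vector_derivative (L - 0 - C * (\<i> - 0))) (at 0)"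
      by (intro has_vector_derivative_diff has_vector_derivative_mult_right has_vector_derivative_const 1 2)
    moreover have "(\<lambda>s. F (cis (t\<^sub>0 + s)) - F \<zeta> - C * (cis s - 1)) = (\<lambda>s. E (cis s))"
      by (simp add: E_def \<zeta>_def cis_mult)
    moreover have e0: "L - 0 - C * (\<i> - 0) = 0"
      by (simp add: C_def complex_eq_iff)
    ultimately have 3: "((\<lambda>s. E (cis s)) has_vector_derivative 0) (at 0)"
      by (simp only: e0)
    have 4: "E 1 = 0" by (simp add: E_def)
    show "\<exists>d>0. \<forall>w. norm w = 1 \<longrightarrow> norm (w - 1) < d \<longrightarrow> norm (E w) \<le> \<eta> * norm (w - 1)" if "0 < \<eta>" for \<eta>
      by (rule circle_small_o[OF 3 4 that])
  qed
  moreover have "\<forall>\<^sub>F \<rho> in at_left 1. deriv E (of_real \<rho>) = \<phi> (of_real \<rho> * \<zeta>) * \<zeta> - C"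
  proof -
    have "\<forall>\<^sub>F \<rho> in at_left 1. 0 < \<rho> \<and> \<rho> < (1::real)"
      using zero_less_one eventually_at_left_field by blast
    thus ?thesis
    proof eventually_elim
      case (elim \<rho>)
      hence "complex_of_real \<rho> \<in> ball 0 1" by simp
      from DERIV_imp_deriv[OF Eder[OF this]] show ?case by (simp add: mult.commute)
    qed
  qed
  ultimately have "((\<lambda>\<rho>. \<phi> (of_real \<rho> * \<zeta>) * \<zeta> - C) \<longlongrightarrow> 0) (at_left 1)"
    by (rule Lim_transform_eventually)
  hence "((\<lambda>\<rho>. (\<phi> (of_real \<rho> * \<zeta>) * \<zeta> - C + C) / \<zeta>) \<longlongrightarrow> (0 + C) / \<zeta>) (at_left 1)"
    using \<zeta> by (intro tendsto_intros) auto
  hence "((\<lambda>\<rho>. \<phi> (of_real \<rho> * \<zeta>)) \<longlongrightarrow> C / \<zeta>) (at_left 1)"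
    using \<zeta>(2) by simp
  thus ?thesis unfolding C_def \<zeta>_def divide_divide_eq_left .
qed

lemma norm_cis_diff_le: "norm (cis s - cis t) \<le> \<bar>s - t\<bar>"
proof -
  have "norm (cis s - cis t) \<le> 1 * norm (s - t)"
  proof (rule differentiable_bound[of UNIV cis "\<lambda>x h. h *\<^sub>R (\<i> * cis x)"])
    fix x :: real
    have "((\<lambda>s. exp (\<i> * of_real s)) has_vector_derivative \<i> * cis x) (at x)"
      by (rule has_vector_derivative_real_field[where f = "\<lambda>z. exp (\<i> * z)"])
         (auto intro!: derivative_eq_intros simp: cis_conv_exp)
    thus "(cis has_derivative (\<lambda>h. h *\<^sub>R (\<i> * cis x))) (at x within UNIV)"
      by (simp add: cis_conv_exp[abs_def] has_vector_derivative_def)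
    show "onorm (\<lambda>h. h *\<^sub>R (\<i> * cis x)) \<le> 1"
      by (rule onorm_le) (simp add: norm_mult)
  qed auto
  thus ?thesis by simp
qed

text \<open>
  The antiderivative of \<open>\<phi>\<close> is Lipschitz and extends to the closed disk. Its real and imaginary parts are
  therefore differentiable almost everywhere as functions of the angle.
\<close>

theorem fatou_radial_limits:
  assumes \<phi>: "\<phi> holomorphic_on ball 0 1" and B: "\<And>z. z \<in> ball 0 1 \<Longrightarrow> norm (\<phi> z) \<le> B"
  shows "AE t in lborel. \<exists>L. ((\<lambda>\<rho>. \<phi> (of_real \<rho> * cis t)) \<longlongrightarrow> L) (at_left 1)"
proof -
  obtain F0 where F0: "\<And>z. z \<in> ball 0 1 \<Longrightarrow> (F0 has_field_derivative \<phi> z) (at z)"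
    using holomorphic_convex_primitive'[OF convex_ball open_ball \<phi>] by (auto simp: at_within_open[OF _ open_ball])
  have B0: "0 \<le> B" using order_trans[OF norm_ge_zero B[of 0]] by simp
  have "B-lipschitz_on (ball 0 1) F0"
  proof (rule lipschitz_onI[OF _ B0])
    fix x y :: complex assume xy: "x \<in> ball 0 1" "y \<in> ball 0 1"
    have "norm (F0 x - F0 y) \<le> B * norm (x - y)"
      by (rule field_differentiable_bound[OF convex_ball _ B xy])
         (use F0 has_field_derivative_at_within in blast)
    thus "dist (F0 x) (F0 y) \<le> B * dist x y" by (simp add: dist_norm)
  qed
  from lipschitz_extend_closure[OF this]
  obtain F where F: "B-lipschitz_on (cball 0 1) F" "\<And>z. z \<in> ball 0 1 \<Longrightarrow> F z = F0 z" by auto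
  have F': "(F has_field_derivative \<phi> z) (at z)" if "z \<in> ball 0 1" for z
    by (rule has_field_derivative_transform_within_open[OF F0[OF that] open_ball that]) (simp add: F(2))
  have lip: "norm (F (cis s) - F (cis t)) \<le> B * \<bar>s - t\<bar>" for s t
  proof -
    have "norm (F (cis s) - F (cis t)) \<le> B * norm (cis s - cis t)"
      using lipschitz_onD[OF F(1), of "cis s" "cis t"] by (simp add: dist_norm)
    also have "\<dots> \<le> B * \<bar>s - t\<bar>" by (rule mult_left_mono[OF norm_cis_diff_le B0])
    finally show ?thesis .
  qed
  have "\<bar>Re (F (cis s)) - Re (F (cis t))\<bar> \<le> B * \<bar>s - t\<bar>" for s t
    using order_trans[OF abs_Re_le_cmod lip[of s t]] by simp
  note NR = lipschitz_differentiable_ae[of "\<lambda>t. Re (F (cis t))", OF this]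
  have "\<bar>Im (F (cis s)) - Im (F (cis t))\<bar> \<le> B * \<bar>s - t\<bar>" for s t
    using order_trans[OF abs_Im_le_cmod lip[of s t]] by simp
  note NI = lipschitz_differentiable_ae[of "\<lambda>t. Im (F (cis t))", OF this]
  have ae: "AE t in lborel. t \<notin> N" if "negligible N" for N :: "real set"
  proof -
    have "AE t in lebesgue. t \<notin> N" using that by (intro AE_not_in) (simp add: negligible_iff_null_sets)
    thus ?thesis by (simp add: AE_completion_iff)
  qed
  from ae[OF NR] ae[OF NI] show ?thesis
  proof eventually_elim
    case (elim t)
    then obtain D1 D2 where D1: "((\<lambda>t. Re (F (cis t))) has_real_derivative D1) (at t)"
      and D2: "((\<lambda>t. Im (F (cis t))) has_real_derivative D2) (at t)" by blast
    have "((\<lambda>t. F (cis t)) has_vector_derivative Complex D1 D2) (at t)"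
      using D1 D2 by (simp add: has_vector_derivative_complex_iff has_real_derivative_iff_has_vector_derivative)
    from fatou_at_differentiable_point[OF F(1) F' this] show ?case by blast
  qed
qed

section \<open>Inner functions and subinner multipliers\<close>

lemma annulus_subset_ball: "annulus r \<subseteq> ball 0 1"
  by (auto simp: annulus_def)

lemma H2A_iff: "f \<in> H2A r \<longleftrightarrow> f holomorphic_on annulus r \<and> (\<exists>c. has_laurent r f c \<and> H2A_seq r c)"
  by (simp add: H2A_def H2A_seq_def)

lemma wt_sum_nonneg: "0 < r \<Longrightarrow> r < 1 \<Longrightarrow> 0 \<le> wt_sum r c"
  unfolding wt_sum_def using H2A_weight_ge_1[of r]
  by (intro infsum_nonneg mult_nonneg_nonneg) (auto intro: order_trans[OF zero_le_one])

lemma one_in_H2A: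
  assumes "0 < r" "r < 1"
  shows "(\<lambda>_. 1) \<in> H2A r" "H2A_norm r (\<lambda>_. 1) = 1"
  using one_seq_facts(1)[of r] one_seq_facts(2)[of r] one_seq_facts(4)[of r] H2A_norm_eq[OF one_seq_facts(1) assms]
  by (auto simp: H2A_iff)

lemma H2A_disk_mult:
  assumes r: "0 < r" "r < 1" and \<phi>: "\<phi> holomorphic_on ball 0 1"
    and B: "\<And>z. z \<in> annulus r \<Longrightarrow> norm (\<phi> z) \<le> B" and B0: "0 \<le> B" and f: "f \<in> H2A r"
  shows "(\<lambda>z. \<phi> z * f z) \<in> H2A r" "H2A_norm r (\<lambda>z. \<phi> z * f z) \<le> B * H2A_norm r f"
proof -
  obtain c where c: "f holomorphic_on annulus r" "has_laurent r f c" "H2A_seq r c"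
    using f by (auto simp: H2A_iff)
  note K = r \<phi> B c(2,3)
  have "(\<lambda>z. \<phi> z * f z) holomorphic_on annulus r"
    by (intro holomorphic_on_mult c(1) holomorphic_on_subset[OF \<phi>] annulus_subset_ball)
  thus "(\<lambda>z. \<phi> z * f z) \<in> H2A r"
    using mult_laurent[OF K] mult_H2A_seq(1)[OF K] by (auto simp: H2A_iff)
  have "sqrt (wt_sum r (conv (taylor_coeff \<phi>) c)) \<le> sqrt (B\<^sup>2 * wt_sum r c)"
    by (rule real_sqrt_le_mono[OF mult_H2A_seq(2)[OF K]])
  thus "H2A_norm r (\<lambda>z. \<phi> z * f z) \<le> B * H2A_norm r f"
    using B0 by (simp add: H2A_norm_eq[OF c(2) r] H2A_norm_eq[OF mult_laurent[OF K] r] real_sqrt_mult)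
qed

text \<open>
  Evaluation at \<open>z\<close> is bounded on the unit ball, so the powers of \<open>\<phi> z\<close> stay bounded.
\<close>

lemma power_bounded_imp_le_1:
  assumes r: "0 < r" "r < 1"
    and pow: "\<And>n. (\<lambda>z. \<phi> z ^ n) \<in> H2A r" "\<And>n. H2A_norm r (\<lambda>z. \<phi> z ^ n) \<le> 1"
    and z: "z \<in> annulus r"
  shows "norm (\<phi> z) \<le> 1"
proof (rule ccontr)
  assume "\<not> norm (\<phi> z) \<le> 1"
  let ?\<kappa> = "\<Sum>\<^sub>\<infinity>n. (norm z powi n)\<^sup>2 / H2A_weight r n"
  obtain n where n: "(1 + ?\<kappa>) / 2 < norm (\<phi> z) ^ n"
    using real_arch_pow[of "norm (\<phi> z)" "(1 + ?\<kappa>) / 2"] \<open>\<not> norm (\<phi> z) \<le> 1\<close> unfolding not_le by blast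
  obtain c where c: "has_laurent r (\<lambda>z. \<phi> z ^ n) c" "H2A_seq r c"
    using pow(1)[of n] by (auto simp: H2A_iff)
  have "wt_sum r c \<le> 1"
    using pow(2)[of n] wt_sum_nonneg[OF r, of c] unfolding H2A_norm_eq[OF c(1) r] by simp
  hence "norm (\<phi> z ^ n) \<le> (1 + ?\<kappa>) / 2"
    using H2A_eval_bound[OF c r z] by simp
  thus False using n by (simp add: norm_power)
qed

lemma mult_norm_ge:
  assumes "f \<in> H2A r" "H2A_norm r f \<le> 1"
  shows "ereal (H2A_norm r (\<lambda>z. \<phi> z * f z)) \<le> mult_norm r \<phi>"
  unfolding mult_norm_def by (rule SUP_upper) (use assms in simp)

lemma contractive_multiplier_bounded:
  assumes r: "0 < r" "r < 1" and m: "\<phi> \<in> Mult_H2A r" "mult_norm r \<phi> \<le> 1" and z: "z \<in> annulus r"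
  shows "norm (\<phi> z) \<le> 1"
proof -
  have "(\<lambda>z. \<phi> z ^ n) \<in> H2A r \<and> H2A_norm r (\<lambda>z. \<phi> z ^ n) \<le> 1" for n
  proof (induction n)
    case 0
    show ?case using one_in_H2A[OF r] by simp
  next
    case (Suc n)
    have "\<forall>f\<in>H2A r. (\<lambda>z. \<phi> z * f z) \<in> H2A r" using m(1) by (simp add: Mult_H2A_def)
    from bspec[OF this conjunct1[OF Suc]] have "(\<lambda>z. \<phi> z * \<phi> z ^ n) \<in> H2A r" .
    moreover have "ereal (H2A_norm r (\<lambda>z. \<phi> z * \<phi> z ^ n)) \<le> ereal 1"
      using order_trans[OF mult_norm_ge[of "\<lambda>z. \<phi> z ^ n" r \<phi>] m(2)] Suc by (simp add: one_ereal_def)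
    ultimately show ?case by simp
  qed
  thus ?thesis by (intro power_bounded_imp_le_1[OF r _ _ z]) auto
qed

lemma taylor_H2A_seq:
  assumes "(\<lambda>n. (norm (taylor_coeff \<phi> n))\<^sup>2) summable_on UNIV"
  shows "H2A_seq r (taylor_coeff \<phi>)" "wt_sum r (taylor_coeff \<phi>) = sq_sum (taylor_coeff \<phi>)"
proof -
  have "(\<lambda>n. H2A_weight r n * (norm (taylor_coeff \<phi> n))\<^sup>2) = (\<lambda>n. (norm (taylor_coeff \<phi> n))\<^sup>2)"
    by (auto simp: fun_eq_iff H2A_weight_def)
  thus "H2A_seq r (taylor_coeff \<phi>)" "wt_sum r (taylor_coeff \<phi>) = sq_sum (taylor_coeff \<phi>)"
    using assms by (simp_all add: H2A_seq_def wt_sum_def sq_sum_def)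
qed

text \<open>
  Radii tending to \<open>1\<close>: dominated convergence needs a sequence.
\<close>

definition radius_seq :: "nat \<Rightarrow> real" where
  "radius_seq k = 1 - 1 / (real k + 2)"

lemma radius_seq: "0 < radius_seq k" "radius_seq k < 1"
  by (auto simp: radius_seq_def field_simps)

lemma radius_seq_filterlim: "filterlim radius_seq (at_left 1) sequentially"
proof -
  have "(\<lambda>k. 1 / real (k + 2)) \<longlonglongrightarrow> 0" by (rule LIMSEQ_ignore_initial_segment[OF lim_1_over_n])
  hence "(\<lambda>k. 1 - 1 / real (k + 2)) \<longlonglongrightarrow> 1 - 0" by (intro tendsto_intros)
  hence "radius_seq \<longlonglongrightarrow> 1" by (simp add: radius_seq_def[abs_def] add.commute)
  thus ?thesis
    unfolding filterlim_at using radius_seq by (auto intro!: always_eventually less_imp_neq)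
qed

lemma disk_circle_continuous:
  assumes "\<phi> holomorphic_on ball 0 1" "\<bar>\<rho>\<bar> < 1"
  shows "continuous_on UNIV (\<lambda>t. \<phi> (of_real \<rho> * cis t))"
  by (rule continuous_on_compose2[OF holomorphic_on_imp_continuous_on[OF assms(1)]])
     (use assms(2) in \<open>auto intro!: continuous_intros simp: norm_mult\<close>)

text \<open>
  Dominated convergence computes the limit of the circle means from the radial limits, and Parseval
  computes it from the Taylor coefficients.
\<close>

lemma radial_square_mean:
  assumes \<phi>: "\<phi> holomorphic_on ball 0 1" and B: "\<And>z. z \<in> ball 0 1 \<Longrightarrow> norm (\<phi> z) \<le> B"
    and l: "l \<in> borel_measurable borel"
    and lim: "AE t in circ. (\<lambda>k. (norm (\<phi> (of_real (radius_seq k) * cis t)))\<^sup>2) \<longlonglongrightarrow> l t"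
  shows "integrable circ l" "(\<integral>t. l t \<partial>circ) = sq_sum (taylor_coeff \<phi>)"
proof -
  define g where "g k t = (norm (\<phi> (of_real (radius_seq k) * cis t)))\<^sup>2" for k t
  have inball: "of_real (radius_seq k) * cis t \<in> ball 0 1" for k t
    using radius_seq[of k] by (simp add: norm_mult)
  have gm: "g k \<in> borel_measurable circ" for k
    unfolding g_def circ_measurable_iff
    by (intro borel_measurable_continuous_onI continuous_intros disk_circle_continuous[OF \<phi>])
       (use radius_seq[of k] in auto)
  have gB: "norm (g k t) \<le> B\<^sup>2" for k t
    using B[OF inball] by (auto simp: g_def intro!: power_mono)
  have lm: "l \<in> borel_measurable circ" using l by simp
  have D: "integrable circ (\<lambda>_. B\<^sup>2)" "AE t in circ. (\<lambda>k. g k t) \<longlonglongrightarrow> l t" "\<And>k. AE t in circ. norm (g k t) \<le> B\<^sup>2"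
    using lim gB by (auto simp: g_def)
  show "integrable circ l" by (rule integrable_dominated_convergence[OF lm gm D])
  have 1: "(\<lambda>k. \<integral>t. g k t \<partial>circ) \<longlonglongrightarrow> (\<integral>t. l t \<partial>circ)"
    by (rule integral_dominated_convergence[OF lm gm D])
  have r: "0 < (1/2::real)" "(1/2::real) < 1" by auto
  have Ba: "norm (\<phi> z) \<le> B" if "z \<in> annulus (1/2)" for z using B annulus_subset_ball that by blast
  have "((\<lambda>\<rho>. \<integral>t. (norm (\<phi> (of_real \<rho> * cis t)))\<^sup>2 \<partial>circ) \<longlongrightarrow> sq_sum (taylor_coeff \<phi>)) (at_left 1)"
    by (rule circle_means_tendsto[OF taylor_has_laurent[OF \<phi>] taylor_H2A_seq(1)[OF taylor_coeff_l2(1)[OF r \<phi> Ba]] r])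
  from filterlim_compose[OF this radius_seq_filterlim]
  have "(\<lambda>k. \<integral>t. g k t \<partial>circ) \<longlonglongrightarrow> sq_sum (taylor_coeff \<phi>)" by (simp add: g_def)
  with 1 show "(\<integral>t. l t \<partial>circ) = sq_sum (taylor_coeff \<phi>)" by (rule LIMSEQ_unique)
qed

lemma Hinf_diskD:
  assumes "\<phi> \<in> Hinf_disk"
  obtains B where "0 \<le> B" "\<phi> holomorphic_on ball 0 1" "\<And>z. z \<in> ball 0 1 \<Longrightarrow> norm (\<phi> z) \<le> B"
proof -
  obtain B where "\<forall>x\<in>\<phi> ` ball 0 1. norm x \<le> B"
    using assms unfolding Hinf_disk_def bounded_iff by blast
  hence B: "norm (\<phi> z) \<le> B" if "z \<in> ball 0 1" for z using that by blast
  have "0 \<le> B" by (rule order_trans[OF norm_ge_zero B[of 0]]) simp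
  moreover have "\<phi> holomorphic_on ball 0 1" using assms by (simp add: Hinf_disk_def)
  ultimately show ?thesis using that B by blast
qed

lemma inner_disk_iff:
  assumes "\<phi> \<in> Hinf_disk"
  shows "inner_disk \<phi> \<longleftrightarrow> (AE t in circ. \<exists>L. norm L = 1 \<and> ((\<lambda>\<rho>. \<phi> (of_real \<rho> * cis t)) \<longlongrightarrow> L) (at_left 1))"
  using assms unfolding inner_disk_def AE_circ_iff by simp

lemma inner_imp_unit_norm:
  assumes "\<phi> \<in> Hinf_disk" "inner_disk \<phi>"
  shows "sq_sum (taylor_coeff \<phi>) = 1"
proof -
  obtain B where B: "\<phi> holomorphic_on ball 0 1" "\<And>z. z \<in> ball 0 1 \<Longrightarrow> norm (\<phi> z) \<le> B"
    using Hinf_diskD[OF assms(1)] by metis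
  have "AE t in circ. (\<lambda>k. (norm (\<phi> (of_real (radius_seq k) * cis t)))\<^sup>2) \<longlonglongrightarrow> 1"
    using assms(2)[unfolded inner_disk_iff[OF assms(1)]]
  proof eventually_elim
    case (elim t)
    then obtain L where L: "norm L = 1" "((\<lambda>\<rho>. \<phi> (of_real \<rho> * cis t)) \<longlongrightarrow> L) (at_left 1)" by blast
    have "(\<lambda>k. (norm (\<phi> (of_real (radius_seq k) * cis t)))\<^sup>2) \<longlonglongrightarrow> (norm L)\<^sup>2"
      by (intro tendsto_intros filterlim_compose[OF L(2) radius_seq_filterlim])
    thus ?case using L(1) by simp
  qed
  from radial_square_mean(2)[OF B _ this] show ?thesis by simp
qed

lemma inner_disk_power:
  assumes "inner_disk \<phi>"
  shows "inner_disk (\<lambda>z. \<phi> z ^ n)"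
proof -
  have \<phi>: "\<phi> \<in> Hinf_disk" using assms by (simp add: inner_disk_def)
  obtain B where B: "0 \<le> B" "\<phi> holomorphic_on ball 0 1" "\<And>z. z \<in> ball 0 1 \<Longrightarrow> norm (\<phi> z) \<le> B"
    using Hinf_diskD[OF \<phi>] by metis
  have "norm (\<phi> z ^ n) \<le> B ^ n" if "z \<in> ball 0 1" for z
    unfolding norm_power by (rule power_mono[OF B(3)[OF that]]) simp
  hence "bounded ((\<lambda>z. \<phi> z ^ n) ` ball 0 1)" unfolding bounded_iff by blast
  hence "(\<lambda>z. \<phi> z ^ n) \<in> Hinf_disk"
    using B(2) by (auto simp: Hinf_disk_def intro!: holomorphic_intros)
  moreover have "AE t in circ. \<exists>L. norm L = 1 \<and> ((\<lambda>\<rho>. \<phi> (of_real \<rho> * cis t) ^ n) \<longlongrightarrow> L) (at_left 1)"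
    using assms[unfolded inner_disk_iff[OF \<phi>]]
  proof eventually_elim
    case (elim t)
    then obtain L where L: "norm L = 1" "((\<lambda>\<rho>. \<phi> (of_real \<rho> * cis t)) \<longlongrightarrow> L) (at_left 1)" by blast
    have "norm (L ^ n) = 1" using L(1) by (simp add: norm_power)
    moreover have "((\<lambda>\<rho>. \<phi> (of_real \<rho> * cis t) ^ n) \<longlongrightarrow> L ^ n) (at_left 1)"
      by (intro tendsto_intros L(2))
    ultimately show ?case by blast
  qed
  ultimately show ?thesis by (simp add: inner_disk_iff)
qed

lemma inner_H2A:
  assumes r: "0 < r" "r < 1" and "inner_disk \<phi>"
  shows "\<phi> \<in> H2A r" "H2A_norm r \<phi> = 1"
proof -
  have H: "\<phi> \<in> Hinf_disk" using assms(3) by (simp add: inner_disk_def)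
  obtain B where B: "\<phi> holomorphic_on ball 0 1" "\<And>z. z \<in> ball 0 1 \<Longrightarrow> norm (\<phi> z) \<le> B"
    using Hinf_diskD[OF H] by metis
  have Ba: "norm (\<phi> z) \<le> B" if "z \<in> annulus r" for z using B(2) annulus_subset_ball that by blast
  note l2 = taylor_coeff_l2(1)[OF r B(1) Ba]
  have w: "wt_sum r (taylor_coeff \<phi>) = 1"
    using taylor_H2A_seq(2)[OF l2, of r] inner_imp_unit_norm[OF H assms(3)] by simp
  note L = taylor_has_laurent[OF B(1), of r]
  show "\<phi> \<in> H2A r"
    using L taylor_H2A_seq(1)[OF l2, of r] holomorphic_on_subset[OF B(1) annulus_subset_ball] by (auto simp: H2A_iff)
  show "H2A_norm r \<phi> = 1"
    unfolding H2A_norm_eq[OF L r] w by simp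
qed

lemma inner_imp_subinner:
  assumes r: "0 < r" "r < 1" and inner: "inner_disk \<phi>"
  shows "subinner r \<phi>"
proof -
  have \<phi>: "\<phi> holomorphic_on ball 0 1" using inner by (simp add: inner_disk_def Hinf_disk_def)
  have B: "norm (\<phi> z) \<le> 1" if "z \<in> annulus r" for z
    using inner_H2A[OF r inner_disk_power[OF inner]] by (intro power_bounded_imp_le_1[OF r _ _ that]) auto
  note M = H2A_disk_mult[OF r \<phi> B zero_le_one]
  note one = one_in_H2A[OF r]
  have n1: "H2A_norm r (\<lambda>z. \<phi> z * 1) = 1" using inner_H2A(2)[OF r inner] by simp
  have "mult_norm r \<phi> \<le> 1"
    unfolding mult_norm_def
  proof (rule SUP_least)
    fix f assume f: "f \<in> {f \<in> H2A r. H2A_norm r f \<le> 1}"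
    hence "H2A_norm r (\<lambda>z. \<phi> z * f z) \<le> 1" using M(2)[of f] by simp
    thus "ereal (H2A_norm r (\<lambda>z. \<phi> z * f z)) \<le> 1" by simp
  qed
  moreover have "1 \<le> mult_norm r \<phi>"
    using mult_norm_ge[OF one(1), of \<phi>] one(2) n1 by (simp add: one_ereal_def)
  ultimately have "mult_norm r \<phi> = 1" by (rule antisym)
  moreover have "\<phi> \<in> Mult_H2A r" using M(1) by (simp add: Mult_H2A_def)
  moreover have "\<exists>h\<in>H2A r. (\<exists>z\<in>annulus r. h z \<noteq> 0) \<and> H2A_norm r (\<lambda>z. \<phi> z * h z) = H2A_norm r h"
  proof (intro bexI[OF _ one(1)] conjI)
    obtain x where "r < x" "x < 1" using dense[OF r(2)] by blast
    hence "complex_of_real x \<in> annulus r" using r by (simp add: annulus_def)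
    thus "\<exists>z\<in>annulus r. (1::complex) \<noteq> 0" by auto
    show "H2A_norm r (\<lambda>z. \<phi> z * 1) = H2A_norm r (\<lambda>_. 1)" using n1 one(2) by simp
  qed
  ultimately show ?thesis by (simp add: subinner_def)
qed

text \<open>
  The radial limits, which exist almost everywhere by Fatou's theorem, have modulus at most \<open>1\<close> and mean
  square \<open>1\<close>.
\<close>

lemma unit_norm_imp_inner:
  assumes r: "0 < r" "r < 1" and H: "\<phi> \<in> Hinf_disk"
    and le1: "\<And>z. z \<in> annulus r \<Longrightarrow> norm (\<phi> z) \<le> 1"
    and unit: "sq_sum (taylor_coeff \<phi>) = 1"
  shows "inner_disk \<phi>"
proof -
  obtain B where B: "\<phi> holomorphic_on ball 0 1" "\<And>z. z \<in> ball 0 1 \<Longrightarrow> norm (\<phi> z) \<le> B"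
    using Hinf_diskD[OF H] by metis
  define g where "g k t = (norm (\<phi> (of_real (radius_seq k) * cis t)))\<^sup>2" for k t
  define l where "l t = lim (\<lambda>k. g k t)" for t
  have gm: "g k \<in> borel_measurable borel" for k
    unfolding g_def
    by (intro borel_measurable_continuous_onI continuous_intros disk_circle_continuous[OF B(1)])
       (use radius_seq[of k] in auto)
  have lm: "l \<in> borel_measurable borel"
    unfolding l_def by (rule borel_measurable_lim_metric[OF gm])
  have F: "AE t in circ. \<exists>L. ((\<lambda>\<rho>. \<phi> (of_real \<rho> * cis t)) \<longlongrightarrow> L) (at_left 1)"
  proof -
    have "AE t in lborel. \<exists>L. ((\<lambda>\<rho>. \<phi> (of_real \<rho> * cis t)) \<longlongrightarrow> L) (at_left 1)"
      by (rule fatou_radial_limits[OF B])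
    thus ?thesis unfolding AE_circ_iff by eventually_elim blast
  qed
  have lL: "l t = (norm L)\<^sup>2" "(\<lambda>k. g k t) \<longlonglongrightarrow> l t" "norm L \<le> 1"
    if "((\<lambda>\<rho>. \<phi> (of_real \<rho> * cis t)) \<longlongrightarrow> L) (at_left 1)" for t L
  proof -
    have "(\<lambda>k. g k t) \<longlonglongrightarrow> (norm L)\<^sup>2"
      unfolding g_def by (intro tendsto_intros filterlim_compose[OF that radius_seq_filterlim])
    thus "l t = (norm L)\<^sup>2" "(\<lambda>k. g k t) \<longlonglongrightarrow> l t" unfolding l_def by (simp_all add: limI)
    have "\<forall>\<^sub>F \<rho> in at_left 1. r < \<rho> \<and> \<rho> < (1::real)"
      using r(2) eventually_at_left_field by blast
    hence "\<forall>\<^sub>F \<rho> in at_left 1. norm (\<phi> (of_real \<rho> * cis t)) \<le> 1"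
    proof eventually_elim
      case (elim \<rho>)
      hence "complex_of_real \<rho> * cis t \<in> annulus r" using r by (subst annulus_cis) auto
      thus ?case by (rule le1)
    qed
    thus "norm L \<le> 1" by (rule tendsto_upperbound[OF tendsto_norm[OF that]]) simp
  qed
  have lim: "AE t in circ. (\<lambda>k. (norm (\<phi> (of_real (radius_seq k) * cis t)))\<^sup>2) \<longlonglongrightarrow> l t"
    using F by eventually_elim (use lL(2) in \<open>auto simp: g_def\<close>)
  note R = radial_square_mean[OF B lm lim]
  have l1: "AE t in circ. 0 \<le> 1 - l t"
    using F by eventually_elim (use lL in \<open>auto simp: power_le_one\<close>)
  have "(\<integral>t. 1 - l t \<partial>circ) = 0" using R unit by simp
  hence "AE t in circ. 1 - l t = 0"
    using integral_nonneg_eq_0_iff_AE[OF _ l1] R(1) by simp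
  with F have "AE t in circ. \<exists>L. norm L = 1 \<and> ((\<lambda>\<rho>. \<phi> (of_real \<rho> * cis t)) \<longlongrightarrow> L) (at_left 1)"
  proof eventually_elim
    case (elim t)
    then obtain L where L: "((\<lambda>\<rho>. \<phi> (of_real \<rho> * cis t)) \<longlongrightarrow> L) (at_left 1)" by blast
    have "(norm L)\<^sup>2 = 1" using lL(1)[OF L] elim(2) by simp
    hence "norm L = 1" by (simp add: power2_eq_1_iff) (use norm_ge_zero[of L] in linarith)
    thus ?case using L by blast
  qed
  thus ?thesis by (simp add: inner_disk_iff[OF H])
qed

lemma subinner_imp_inner:
  assumes r: "0 < r" "r < 1" and H: "\<phi> \<in> Hinf_disk" and sub: "subinner r \<phi>"
  shows "inner_disk \<phi>"
proof -
  have \<phi>: "\<phi> holomorphic_on ball 0 1" using H by (simp add: Hinf_disk_def)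
  have le1: "norm (\<phi> z) \<le> 1" if "z \<in> annulus r" for z
    using sub by (intro contractive_multiplier_bounded[OF r _ _ that]) (auto simp: subinner_def)
  obtain h where h: "h \<in> H2A r" "\<exists>z\<in>annulus r. h z \<noteq> 0" "H2A_norm r (\<lambda>z. \<phi> z * h z) = H2A_norm r h"
    using sub by (auto simp: subinner_def)
  obtain c where c: "has_laurent r h c" "H2A_seq r c" using h(1) by (auto simp: H2A_iff)
  obtain i where i: "c i \<noteq> 0"
  proof (rule ccontr)
    assume "\<not> thesis"
    hence "c n = 0" for n using that by blast
    hence "h z = 0" if "z \<in> annulus r" for z
      using has_laurentD[OF c(1) that] by (simp add: has_sum_unique[OF _ has_sum_0_simp])
    thus False using h(2) by blast
  qed
  note K = r \<phi> le1 c
  have L: "has_laurent r (\<lambda>z. \<phi> z * h z) (conv (taylor_coeff \<phi>) c)" by (rule mult_laurent[OF K])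
  have "wt_sum r (conv (taylor_coeff \<phi>) c) = wt_sum r c"
    using h(3) unfolding H2A_norm_eq[OF c(1) r] H2A_norm_eq[OF L r] by simp
  from mult_isometric_one_sided[OF K this i] obtain g e m where
    g: "has_laurent r g e" "H2A_seq r e" "e m \<noteq> 0"
    "(\<forall>n<m. e n = 0) \<or> (\<forall>n>m. e n = 0)" "sq_sum (conv (taylor_coeff \<phi>) e) = sq_sum e"
    by blast
  show ?thesis
    by (rule unit_norm_imp_inner[OF r H le1 isometric_imp_unit_norm[OF r \<phi> le1 g]])
qed

section \<open>Boundedness of multipliers that are holomorphic on the disk\<close>

text \<open>
  The reciprocal of the norm of the Szego kernel at \<open>z\<close>.
\<close>

definition bdist :: "complex \<Rightarrow> real" where
  "bdist z = sqrt (1 - (norm z)\<^sup>2)"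

lemma bdist_facts:
  assumes "z \<in> ball 0 1"
  shows "0 < bdist z" "bdist z \<le> 1" "(bdist z)\<^sup>2 = 1 - (norm z)\<^sup>2" "(bdist z)\<^sup>2 \<le> 2 * (1 - norm z)"
proof -
  have n: "0 \<le> norm z" "norm z < 1" using assms by auto
  have "(norm z)\<^sup>2 < 1" using n by (simp add: power_less_one_iff)
  thus "0 < bdist z" "bdist z \<le> 1" and sq: "(bdist z)\<^sup>2 = 1 - (norm z)\<^sup>2" by (simp_all add: bdist_def)
  have "1 - (norm z)\<^sup>2 = (1 + norm z) * (1 - norm z)" by (simp add: power2_eq_square algebra_simps)
  also have "\<dots> \<le> 2 * (1 - norm z)" using n by (intro mult_right_mono) auto
  finally show "(bdist z)\<^sup>2 \<le> 2 * (1 - norm z)" unfolding sq .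
qed

text \<open>
  Each term is estimated by the arithmetic-geometric mean inequality, balanced by \<open>bdist z\<close> so that the
  bound has the order \<open>1 / bdist z\<close> of the optimal one.
\<close>

lemma l2_growth:
  assumes G: "G holomorphic_on ball 0 1" and c: "(\<lambda>n. (norm (taylor_coeff G n))\<^sup>2) summable_on UNIV"
    and z: "z \<in> ball 0 1"
  shows "norm (G z) \<le> (sq_sum (taylor_coeff G) + 1) / (2 * bdist z)"
proof -
  let ?c = "taylor_coeff G" and ?s = "bdist z"
  let ?x = "\<lambda>n::int. if n < 0 then 0 else ((norm z)\<^sup>2) ^ nat n"
  note s = bdist_facts[OF z]
  have "norm ((norm z)\<^sup>2) < 1" using z by (simp add: power_less_one_iff)
  hence "(\<lambda>k. ((norm z)\<^sup>2) ^ k) sums (1 / (1 - (norm z)\<^sup>2))" by (rule geometric_sums)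
  hence "((\<lambda>k. ((norm z)\<^sup>2) ^ k) has_sum (1 / (1 - (norm z)\<^sup>2))) UNIV"
    by (rule sums_nonneg_imp_has_sum) simp
  hence "(?x has_sum (1 / ?s\<^sup>2)) UNIV"
    unfolding s(3) by (intro has_sum_int_nat) auto
  moreover have "((\<lambda>n. (norm (?c n))\<^sup>2) has_sum sq_sum ?c) UNIV"
    unfolding sq_sum_def by (rule has_sum_infsum[OF c])
  ultimately have H: "((\<lambda>n. (norm (?c n))\<^sup>2 * (1 / (2 * ?s)) + ?x n * (?s / 2)) has_sum
      (sq_sum ?c * (1 / (2 * ?s)) + (1 / ?s\<^sup>2) * (?s / 2))) UNIV"
    by (intro has_sum_add has_sum_cmult_left)
  have "norm (G z) \<le> sq_sum ?c * (1 / (2 * ?s)) + (1 / ?s\<^sup>2) * (?s / 2)"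
  proof (rule norm_infsum_le[OF taylor_has_sum[OF G z] H])
    fix n
    show "norm (?c n * z powi n) \<le> (norm (?c n))\<^sup>2 * (1 / (2 * ?s)) + ?x n * (?s / 2)"
    proof (cases "n < 0")
      case False
      define p where "p = norm (?c n)"
      define q where "q = norm z ^ nat n"
      have x: "?x n = q\<^sup>2" using False by (simp add: q_def power_mult[symmetric] mult.commute)
      have "0 \<le> (p - ?s * q)\<^sup>2" by simp
      hence "2 * ?s * (p * q) \<le> p\<^sup>2 + ?s\<^sup>2 * q\<^sup>2" by (simp add: power2_diff power_mult_distrib mult_ac)
      hence "p * q \<le> (p\<^sup>2 + ?s\<^sup>2 * q\<^sup>2) / (2 * ?s)" using s(1) by (simp add: pos_le_divide_eq mult_ac)
      also have "\<dots> = p\<^sup>2 * (1 / (2 * ?s)) + q\<^sup>2 * (?s / 2)"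
        using s(1) by (simp add: add_divide_distrib power2_eq_square)
      finally show ?thesis using False unfolding x
        by (simp add: norm_mult norm_power power_int_def p_def q_def)
    qed simp
  qed
  also have "\<dots> = (sq_sum ?c + 1) / (2 * ?s)"
    using s(1) by (simp add: field_simps power2_eq_square)
  finally show ?thesis .
qed

lemma has_sum_geometric_complex:
  assumes "norm (w::complex) < 1"
  shows "((\<lambda>n. w ^ n) has_sum (1 / (1 - w))) (UNIV :: nat set)"
  by (rule norm_summable_imp_has_sum[OF _ geometric_sums[OF assms]])
     (use assms in \<open>simp add: norm_power summable_geometric\<close>)

lemma has_sum_half_powers: "((\<lambda>k. (1/2::real) ^ k) has_sum 2) (UNIV :: nat set)"
  using sums_nonneg_imp_has_sum[OF geometric_sums[of "1/2::real"]] by simp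

text \<open>
  The function \<open>F\<close> below is the superposition, with coefficients \<open>(1/2) ^ k\<close>, of the Szego kernels
  at the points \<open>\<zeta> k\<close>, normalised by \<open>s k = bdist (\<zeta> k)\<close>.
\<close>

locale kernel_sum =
  fixes \<zeta> :: "nat \<Rightarrow> complex"
  assumes \<zeta>: "\<And>k. \<zeta> k \<in> ball 0 1"
begin

abbreviation s where "s k \<equiv> bdist (\<zeta> k)"

definition \<beta> :: "nat \<Rightarrow> complex" where "\<beta> k = of_real ((1/2) ^ k * s k)"

definition F :: "complex \<Rightarrow> complex" where
  "F z = (\<Sum>\<^sub>\<infinity>k. \<beta> k / (1 - cnj (\<zeta> k) * z))"

definition cf :: "nat \<Rightarrow> complex" where
  "cf n = (\<Sum>\<^sub>\<infinity>k. \<beta> k * cnj (\<zeta> k) ^ n)"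

lemma norm_\<beta>: "norm (\<beta> k) = (1/2) ^ k * s k" "norm (\<beta> k) \<le> (1/2) ^ k"
proof -
  show e: "norm (\<beta> k) = (1/2) ^ k * s k"
    unfolding \<beta>_def norm_of_real using bdist_facts(1)[OF \<zeta>[of k]] by (simp add: abs_mult)
  show "norm (\<beta> k) \<le> (1/2) ^ k"
    unfolding e using bdist_facts(2)[OF \<zeta>[of k]] by (simp add: mult_left_le)
qed

lemma \<zeta>_lt: "norm (\<zeta> k) < 1"
  using \<zeta>[of k] by simp

lemma \<zeta>z_le: "norm (cnj (\<zeta> k) * z) \<le> norm z"
  using \<zeta>_lt[of k] by (simp add: norm_mult mult_left_le_one_le)

lemma double_summable:
  assumes z: "z \<in> ball 0 1"
  shows "(\<lambda>(k, n). \<beta> k * (cnj (\<zeta> k) * z) ^ n) summable_on UNIV \<times> UNIV"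
proof (rule Infinite_Sum.abs_summable_summable)
  have zn: "norm z < 1" using z by simp
  have "(\<lambda>(k, n). (1/2) ^ k * norm z ^ n) summable_on UNIV \<times> (UNIV::nat set)"
  proof (rule summable_on_SigmaI)
    show "((\<lambda>n. case (k, n) of (k, n) \<Rightarrow> (1/2) ^ k * norm z ^ n) has_sum (1/2) ^ k * (1 / (1 - norm z))) UNIV" for k :: nat
      using has_sum_cmult_right[OF sums_nonneg_imp_has_sum[OF geometric_sums[of "norm z"]], of "(1/2) ^ k"] zn by simp
    show "(\<lambda>k. (1/2::real) ^ k * (1 / (1 - norm z))) summable_on UNIV"
      by (rule summable_on_cmult_left[OF has_sum_imp_summable[OF has_sum_half_powers]])
  qed auto
  thus "(\<lambda>x. norm (case x of (k, n) \<Rightarrow> \<beta> k * (cnj (\<zeta> k) * z) ^ n)) summable_on UNIV \<times> UNIV"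
  proof (rule Infinite_Sum.abs_summable_on_comparison_test')
    fix x :: "nat \<times> nat"
    obtain k n where x: "x = (k, n)" by (cases x)
    have "norm (\<beta> k * (cnj (\<zeta> k) * z) ^ n) \<le> (1/2) ^ k * norm z ^ n"
      unfolding norm_mult[of "\<beta> k"] norm_power
      by (intro mult_mono norm_\<beta> power_mono \<zeta>z_le) auto
    thus "norm (case x of (k, n) \<Rightarrow> \<beta> k * (cnj (\<zeta> k) * z) ^ n) \<le> (case x of (k, n) \<Rightarrow> (1/2) ^ k * norm z ^ n)"
      by (simp add: x)
  qed
qed

lemma inner_sum:
  assumes z: "z \<in> ball 0 1"
  shows "((\<lambda>n. \<beta> k * (cnj (\<zeta> k) * z) ^ n) has_sum (\<beta> k / (1 - cnj (\<zeta> k) * z))) UNIV"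
proof -
  have "norm (cnj (\<zeta> k) * z) < 1" using \<zeta>z_le[of k z] z by simp
  from has_sum_cmult_right[OF has_sum_geometric_complex[OF this], of "\<beta> k"] show ?thesis by simp
qed

lemma F_has_sum:
  assumes z: "z \<in> ball 0 1"
  shows "((\<lambda>k. \<beta> k / (1 - cnj (\<zeta> k) * z)) has_sum F z) UNIV"
proof -
  obtain S where S: "((\<lambda>(k, n). \<beta> k * (cnj (\<zeta> k) * z) ^ n) has_sum S) (UNIV \<times> UNIV)"
    using has_sum_infsum[OF double_summable[OF z]] by blast
  have "((\<lambda>k. \<beta> k / (1 - cnj (\<zeta> k) * z)) has_sum S) UNIV"
    by (rule has_sum_SigmaD[OF S]) (use inner_sum[OF z] in simp)
  thus ?thesis unfolding F_def by (rule has_sum_infsum[OF has_sum_imp_summable])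
qed

lemma cf_has_sum: "((\<lambda>k. \<beta> k * cnj (\<zeta> k) ^ n) has_sum cf n) UNIV"
  unfolding cf_def
proof (rule has_sum_infsum, rule Infinite_Sum.abs_summable_summable,
       rule Infinite_Sum.abs_summable_on_comparison_test'[OF has_sum_imp_summable[OF has_sum_half_powers]])
  fix k
  have "norm (\<beta> k) * norm (\<zeta> k) ^ n \<le> (1/2) ^ k * 1"
    by (intro mult_mono norm_\<beta> power_le_one less_imp_le[OF \<zeta>_lt]) auto
  thus "norm (\<beta> k * cnj (\<zeta> k) ^ n) \<le> (1/2) ^ k" by (simp add: norm_mult norm_power)
qed

lemma F_power_series:
  assumes z: "z \<in> ball 0 1"
  shows "((\<lambda>n. cf n * z ^ n) has_sum F z) UNIV"
proof -
  have "((\<lambda>(k, n). \<beta> k * (cnj (\<zeta> k) * z) ^ n) has_sum F z) (UNIV \<times> UNIV)"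
    by (rule has_sum_SigmaI[OF _ F_has_sum[OF z] double_summable[OF z]]) (use inner_sum[OF z] in simp)
  hence "((\<lambda>(n, k). \<beta> k * (cnj (\<zeta> k) * z) ^ n) has_sum F z) (UNIV \<times> UNIV)"
    by (subst (asm) has_sum_swap) simp
  thus ?thesis
  proof (rule has_sum_SigmaD)
    fix n :: nat
    show "((\<lambda>k. case (n, k) of (n, k) \<Rightarrow> \<beta> k * (cnj (\<zeta> k) * z) ^ n) has_sum cf n * z ^ n) UNIV"
      using has_sum_cmult_left[OF cf_has_sum[of n], of "z ^ n"] by (simp add: power_mult_distrib mult_ac)
  qed
qed

lemma F_holomorphic: "F holomorphic_on ball 0 1"
  by (rule power_series_holomorphic[where a = cf]) (use has_sum_imp_sums[OF F_power_series] in simp)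

text \<open>
  The normalised Szego kernel is a unit vector.
\<close>

lemma L2_set_kernel:
  assumes X: "finite X"
  shows "L2_set (\<lambda>n. norm (\<beta> k * cnj (\<zeta> k) ^ n)) X \<le> (1/2) ^ k"
proof -
  note s = bdist_facts[OF \<zeta>[of k]]
  have "norm ((norm (\<zeta> k))\<^sup>2) < 1" using \<zeta>_lt[of k] by (simp add: power_less_one_iff)
  note g = geometric_sums[OF this]
  have "(\<Sum>n\<in>X. ((norm (\<zeta> k))\<^sup>2) ^ n) \<le> (\<Sum>n. ((norm (\<zeta> k))\<^sup>2) ^ n)"
    by (rule sum_le_suminf[OF sums_summable[OF g] X]) simp
  also have "\<dots> = 1 / (s k)\<^sup>2" unfolding s(3) by (rule sums_unique[OF g, symmetric])
  finally have le: "(\<Sum>n\<in>X. ((norm (\<zeta> k))\<^sup>2) ^ n) \<le> 1 / (s k)\<^sup>2" .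
  have "(\<Sum>n\<in>X. (norm (\<beta> k * cnj (\<zeta> k) ^ n))\<^sup>2) = (norm (\<beta> k))\<^sup>2 * (\<Sum>n\<in>X. ((norm (\<zeta> k))\<^sup>2) ^ n)"
    unfolding sum_distrib_left
    by (intro sum.cong refl) (simp add: norm_mult norm_power power_mult_distrib power_mult[symmetric] mult.commute)
  also have "\<dots> \<le> (norm (\<beta> k))\<^sup>2 * (1 / (s k)\<^sup>2)" by (rule mult_left_mono[OF le]) simp
  also have "\<dots> = ((1/2) ^ k)\<^sup>2"
    unfolding norm_\<beta>(1) power_mult_distrib using s(1) by simp
  finally have "sqrt (\<Sum>n\<in>X. (norm (\<beta> k * cnj (\<zeta> k) ^ n))\<^sup>2) \<le> sqrt (((1/2) ^ k)\<^sup>2)"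
    by (rule real_sqrt_le_mono)
  thus ?thesis by (simp add: L2_set_def)
qed

text \<open>
  The triangle inequality in the Euclidean norm on \<open>X\<close> bounds the partial sums over \<open>k\<close> by
  \<open>\<Sum>k. (1/2) ^ k = 2\<close>.
\<close>

lemma cf_l2:
  assumes X: "finite X"
  shows "(\<Sum>n\<in>X. (norm (cf n))\<^sup>2) \<le> 4"
proof -
  define p where "p K n = (\<Sum>k<K. \<beta> k * cnj (\<zeta> k) ^ n)" for K n
  have L2: "L2_set (\<lambda>n. norm (p K n)) X \<le> (\<Sum>k<K. (1/2) ^ k)" for K
  proof (induction K)
    case (Suc K)
    have "L2_set (\<lambda>n. norm (p (Suc K) n)) X \<le> L2_set (\<lambda>n. norm (p K n) + norm (\<beta> K * cnj (\<zeta> K) ^ n)) X"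
      by (rule L2_set_mono) (auto simp: p_def norm_triangle_ineq)
    also have "\<dots> \<le> L2_set (\<lambda>n. norm (p K n)) X + L2_set (\<lambda>n. norm (\<beta> K * cnj (\<zeta> K) ^ n)) X"
      by (rule L2_set_triangle_ineq)
    also have "\<dots> \<le> (\<Sum>k<K. (1/2) ^ k) + (1/2) ^ K"
      by (rule add_mono[OF Suc.IH L2_set_kernel[OF X]])
    finally show ?case by simp
  qed (simp add: p_def L2_set_def)
  have le4: "(\<Sum>n\<in>X. (norm (p K n))\<^sup>2) \<le> 4" for K
  proof -
    have "(\<Sum>k<K. (1/2::real) ^ k) \<le> 2"
      by (rule finite_sum_le_has_sum[OF has_sum_half_powers]) auto
    hence "sqrt (\<Sum>n\<in>X. (norm (p K n))\<^sup>2) \<le> 2" using L2[of K] unfolding L2_set_def by linarith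
    hence "(\<Sum>n\<in>X. (norm (p K n))\<^sup>2) \<le> 2\<^sup>2" by (rule sqrt_le_D)
    thus ?thesis by simp
  qed
  have "(\<lambda>K. p K n) \<longlonglongrightarrow> cf n" for n
    using has_sum_imp_sums[OF cf_has_sum[of n]] by (simp add: sums_def p_def)
  hence "(\<lambda>K. \<Sum>n\<in>X. (norm (p K n))\<^sup>2) \<longlonglongrightarrow> (\<Sum>n\<in>X. (norm (cf n))\<^sup>2)"
    by (intro tendsto_intros)
  thus ?thesis by (rule LIMSEQ_le_const2) (use le4 in blast)
qed

lemma F_in_H2A:
  assumes r: "0 < r" "r < 1"
  shows "F \<in> H2A r"
proof -
  define c where "c n = (if n < 0 then 0 else cf (nat n))" for n :: int
  have "((\<lambda>n. c n * z powi n) has_sum F z) UNIV" if "z \<in> ball 0 1" for z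
    by (rule has_sum_int_nat) (use F_power_series[OF that] in \<open>simp_all add: c_def\<close>)
  hence L: "has_laurent r F c" using annulus_subset_ball unfolding has_laurent_def by blast
  have "(\<lambda>n. (norm (cf n))\<^sup>2) summable_on UNIV"
    by (rule nonneg_bdd_above_summable_on) (use cf_l2 in \<open>auto intro!: bdd_aboveI[of _ 4]\<close>)
  then obtain S where "((\<lambda>n. (norm (cf n))\<^sup>2) has_sum S) UNIV" using has_sum_infsum by blast
  hence "((\<lambda>n. H2A_weight r n * (norm (c n))\<^sup>2) has_sum S) UNIV"
    by (intro has_sum_int_nat) (simp_all add: c_def H2A_weight_def)
  hence "H2A_seq r c" unfolding H2A_seq_def by (rule has_sum_imp_summable)
  thus ?thesis
    using L holomorphic_on_subset[OF F_holomorphic annulus_subset_ball] by (auto simp: H2A_iff)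
qed

text \<open>
  If the points approach the circle fast enough, the \<open>k\<close>-th kernel dominates at \<open>\<zeta> k\<close>: the
  others contribute at most a quarter of it. For \<open>m < k\<close> the kernel at \<open>\<zeta> m\<close> is at most
  \<open>2 / s m\<close>, which is small relative to \<open>1 / s k\<close>; for \<open>m > k\<close> its normalising factor \<open>s m\<close> is small.
\<close>

lemma F_lower_bound:
  assumes sep: "\<And>k. s (Suc k) \<le> s k * (1/2) ^ Suc k / 16"
  shows "3/4 * (1/2) ^ k / s k \<le> norm (F (\<zeta> k))"
proof -
  note sf = bdist_facts[OF \<zeta>]
  have dec: "s m \<le> s k" if "k \<le> m" for k m
  proof (rule lift_Suc_antimono_le[OF _ that])
    fix n
    have "(1/2::real) ^ Suc n \<le> 1" by (rule power_le_one) auto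
    hence "s n * (1/2) ^ Suc n \<le> s n * 1" using sf(1)[of n] by (intro mult_left_mono) auto
    thus "s (Suc n) \<le> s n" using sep[of n] sf(1)[of n] by linarith
  qed
  have sep': "s m \<le> s k * (1/2) ^ m / 16" if "k < m" for k m
  proof -
    obtain j where m: "m = Suc j" using \<open>k < m\<close> by (cases m) auto
    have "s m \<le> s j * (1/2) ^ m / 16" using sep[of j] m by simp
    also have "\<dots> \<le> s k * (1/2) ^ m / 16"
      using dec[of k j] that m by (intro divide_right_mono mult_right_mono) auto
    finally show ?thesis .
  qed
  let ?T = "\<lambda>m. \<beta> m / (1 - cnj (\<zeta> m) * \<zeta> k)"
  have T: "norm (?T m) \<le> (1/2) ^ m * ((1/2) ^ k / (8 * s k))" if "m \<noteq> k" for m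
  proof -
    have base: "norm (?T m) \<le> (1/2) ^ m * s m * (2 / x\<^sup>2)"
      if "x = s m \<or> x = s k" for x
    proof -
      have x0: "0 < x" using that sf(1) by auto
      have "norm (cnj (\<zeta> m) * \<zeta> k) \<le> norm (\<zeta> k)" by (rule \<zeta>z_le)
      moreover have "norm (cnj (\<zeta> m) * \<zeta> k) \<le> norm (\<zeta> m)"
        using \<zeta>_lt[of k] by (simp add: norm_mult mult_left_le)
      ultimately have "x\<^sup>2 \<le> 2 * (1 - norm (cnj (\<zeta> m) * \<zeta> k))"
        using that sf(4)[of m] sf(4)[of k] by auto
      also have "1 - norm (cnj (\<zeta> m) * \<zeta> k) \<le> norm (1 - cnj (\<zeta> m) * \<zeta> k)"
        using norm_triangle_ineq2[of 1 "cnj (\<zeta> m) * \<zeta> k"] by simp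
      finally have d: "x\<^sup>2 / 2 \<le> norm (1 - cnj (\<zeta> m) * \<zeta> k)" by simp
      have "norm (?T m) \<le> norm (\<beta> m) / (x\<^sup>2 / 2)"
        unfolding norm_divide using x0
        by (intro divide_left_mono[OF d] mult_pos_pos order_less_le_trans[OF _ d]) auto
      thus ?thesis unfolding norm_\<beta>(1) by simp
    qed
    show ?thesis
    proof (cases "m < k")
      case True
      have "norm (?T m) \<le> (1/2) ^ m * s m * (2 / (s m)\<^sup>2)" by (rule base) simp
      also have "\<dots> = (1/2) ^ m * (2 / s m)" using sf(1)[of m] by (simp add: power2_eq_square)
      also have "\<dots> \<le> (1/2) ^ m * ((1/2) ^ k / (8 * s k))"
        using sep'[OF True] sf(1)[of m] sf(1)[of k] by (intro mult_left_mono) (simp_all add: field_simps)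
      finally show ?thesis .
    next
      case False
      hence km: "k < m" using that by simp
      have "norm (?T m) \<le> (1/2) ^ m * s m * (2 / (s k)\<^sup>2)" by (rule base) simp
      also have "\<dots> \<le> (1/2) ^ m * (s k * (1/2) ^ k / 16) * (2 / (s k)\<^sup>2)"
      proof (intro mult_right_mono mult_left_mono)
        have "(1/2::real) ^ m \<le> (1/2) ^ k" using km by (intro power_decreasing) auto
        hence "s k * (1/2) ^ m / 16 \<le> s k * (1/2) ^ k / 16"
          using sf(1)[of k] by (intro divide_right_mono mult_left_mono) auto
        thus "s m \<le> s k * (1/2) ^ k / 16" using sep'[OF km] by linarith
      qed auto
      also have "\<dots> = (1/2) ^ m * ((1/2) ^ k / (8 * s k))"
        using sf(1)[of k] by (simp add: power2_eq_square)
      finally show ?thesis .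
    qed
  qed
  have "(?T has_sum F (\<zeta> k) - ?T k) (UNIV - {k})"
    using has_sum_Diff[OF F_has_sum[OF \<zeta>[of k]] has_sum_finite[of "{k}" ?T]] by simp
  moreover have "((\<lambda>m. (1/2) ^ m * ((1/2) ^ k / (8 * s k))) has_sum (2 - (1/2) ^ k) * ((1/2) ^ k / (8 * s k))) (UNIV - {k})"
    by (rule has_sum_cmult_left)
       (use has_sum_Diff[OF has_sum_half_powers has_sum_finite[of "{k}" "\<lambda>k. (1/2::real) ^ k"]] in simp)
  ultimately have "norm (F (\<zeta> k) - ?T k) \<le> (2 - (1/2) ^ k) * ((1/2) ^ k / (8 * s k))"
    by (rule norm_infsum_le) (use T in auto)
  also have "\<dots> \<le> 2 * ((1/2) ^ k / (8 * s k))"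
    using sf(1)[of k] by (intro mult_right_mono) auto
  also have "\<dots> = 1/4 * (1/2) ^ k / s k" by simp
  finally have 1: "norm (F (\<zeta> k) - ?T k) \<le> 1/4 * (1/2) ^ k / s k" .
  have "cnj (\<zeta> k) * \<zeta> k = of_real ((norm (\<zeta> k))\<^sup>2)"
    by (simp only: complex_norm_square mult.commute)
  hence "1 - cnj (\<zeta> k) * \<zeta> k = of_real ((s k)\<^sup>2)" unfolding sf(3) by simp
  hence "norm (1 - cnj (\<zeta> k) * \<zeta> k) = norm (complex_of_real ((s k)\<^sup>2))" by (rule arg_cong)
  hence "norm (1 - cnj (\<zeta> k) * \<zeta> k) = (s k)\<^sup>2" unfolding norm_of_real by simp
  hence "norm (?T k) = (1/2) ^ k * s k / (s k)\<^sup>2"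
    by (simp only: norm_divide norm_\<beta>(1))
  also have "\<dots> = (1/2) ^ k / s k" using sf(1)[of k] by (simp add: power2_eq_square)
  finally have 2: "norm (?T k) = (1/2) ^ k / s k" .
  have "norm (?T k) \<le> norm (F (\<zeta> k)) + norm (F (\<zeta> k) - ?T k)"
    using norm_triangle_ineq4[of "F (\<zeta> k)" "F (\<zeta> k) - ?T k"] by simp
  thus ?thesis using 1 2 by simp
qed

end

text \<open>
  A holomorphic function is bounded on smaller closed disks, so its large values occur close to the circle.
\<close>

lemma unbounded_near_circle:
  assumes \<phi>: "\<phi> holomorphic_on ball 0 1" and unb: "\<not> bounded (\<phi> ` ball 0 1)" and e: "0 < e"
  shows "\<exists>z. z \<in> ball 0 1 \<and> C \<le> norm (\<phi> z) \<and> bdist z \<le> e"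
proof (rule ccontr)
  assume *: "\<not> ?thesis"
  define d where "d = sqrt (max 0 (1 - e\<^sup>2))"
  have d1: "d < 1" using e by (simp add: d_def max_def)
  have "compact (\<phi> ` cball 0 d)"
    by (rule compact_continuous_image[OF continuous_on_subset[OF holomorphic_on_imp_continuous_on[OF \<phi>]]])
       (use d1 in auto)
  hence "bounded (\<phi> ` cball 0 d)" by (rule compact_imp_bounded)
  then obtain B where "\<forall>x\<in>\<phi> ` cball 0 d. norm x \<le> B" unfolding bounded_iff by blast
  hence B: "norm (\<phi> z) \<le> B" if "z \<in> cball 0 d" for z using that by blast
  have "norm (\<phi> z) \<le> max B C" if z: "z \<in> ball 0 1" for z
  proof (cases "z \<in> cball 0 d")
    case True
    thus ?thesis using B by (simp add: le_max_iff_disj)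
  next
    case False
    hence "d < norm z" by simp
    hence "d\<^sup>2 < (norm z)\<^sup>2" by (intro power_strict_mono) (auto simp: d_def)
    hence "1 - e\<^sup>2 < (norm z)\<^sup>2" by (simp add: d_def)
    hence "(bdist z)\<^sup>2 \<le> e\<^sup>2" using bdist_facts(3)[OF z] by simp
    hence "bdist z \<le> e" by (rule power2_le_imp_le) (use e in simp)
    hence "\<not> C \<le> norm (\<phi> z)" using * z by blast
    thus ?thesis by simp
  qed
  hence "\<forall>x\<in>\<phi> ` ball 0 1. norm x \<le> max B C" by blast
  thus False using unb unfolding bounded_iff by blast
qed

text \<open>
  If \<open>\<phi>\<close> were unbounded, choose rapidly separated points \<open>\<zeta> k\<close> with \<open>norm (\<phi> (\<zeta> k)) \<ge> 4 ^ k\<close>. Then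
  \<open>\<phi> * F\<close> is at least \<open>2 ^ k * (3/4) / bdist (\<zeta> k)\<close> there, too large for a function with
  square summable Taylor coefficients.
\<close>

theorem multiplier_disk_bounded:
  assumes r: "0 < r" "r < 1" and m: "\<phi> \<in> Mult_H2A r" and \<phi>: "\<phi> holomorphic_on ball 0 1"
  shows "bounded (\<phi> ` ball 0 1)"
proof (rule ccontr)
  assume unb: "\<not> bounded (\<phi> ` ball 0 1)"
  let ?P = "\<lambda>k z. z \<in> ball 0 1 \<and> 4 ^ k \<le> norm (\<phi> z)"
  have "\<exists>\<zeta>. \<forall>k. ?P k (\<zeta> k) \<and> bdist (\<zeta> (Suc k)) \<le> bdist (\<zeta> k) * (1/2) ^ Suc k / 16"
  proof (rule dependent_nat_choice)
    show "\<exists>z. ?P 0 z" using unbounded_near_circle[OF \<phi> unb zero_less_one, of "4 ^ 0"] by blast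
    fix z k assume "?P k z"
    hence "0 < bdist z * (1/2) ^ Suc k / 16" using bdist_facts(1) by simp
    from unbounded_near_circle[OF \<phi> unb this, of "4 ^ Suc k"]
    show "\<exists>y. ?P (Suc k) y \<and> bdist y \<le> bdist z * (1/2) ^ Suc k / 16" by blast
  qed
  then obtain \<zeta> where Z: "\<And>k. \<zeta> k \<in> ball 0 1" "\<And>k. 4 ^ k \<le> norm (\<phi> (\<zeta> k))"
    "\<And>k. bdist (\<zeta> (Suc k)) \<le> bdist (\<zeta> k) * (1/2) ^ Suc k / 16" by blast
  interpret kernel_sum \<zeta> by standard (rule Z(1))
  define G where "G z = \<phi> z * F z" for z
  have Gh: "G holomorphic_on ball 0 1" unfolding G_def by (intro holomorphic_on_mult \<phi> F_holomorphic)
  have "G \<in> H2A r" using m F_in_H2A[OF r] by (simp add: Mult_H2A_def G_def[abs_def])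
  then obtain c where c: "has_laurent r G c" "H2A_seq r c" by (auto simp: H2A_iff)
  have "c = taylor_coeff G" by (rule has_laurent_unique[OF c(1) taylor_has_laurent[OF Gh] r])
  hence l2: "(\<lambda>n. (norm (taylor_coeff G n))\<^sup>2) summable_on UNIV" using H2A_seq_l2[OF c(2) r] by simp
  define S where "S = sq_sum (taylor_coeff G)"
  have "2 ^ k * (3/4) \<le> (S + 1) / 2" for k
  proof -
    have b: "0 < bdist (\<zeta> k)" by (rule bdist_facts(1)[OF Z(1)])
    have "2 ^ k * (3/4) / bdist (\<zeta> k) = 4 ^ k * (3/4 * (1/2) ^ k / bdist (\<zeta> k))"
    proof -
      have "(4::real) ^ k * (1/2) ^ k = 2 ^ k" by (simp flip: power_mult_distrib)
      thus ?thesis by (simp add: mult_ac)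
    qed
    also have "\<dots> \<le> norm (\<phi> (\<zeta> k)) * norm (F (\<zeta> k))"
      using b by (intro mult_mono Z(2) F_lower_bound Z(3)) auto
    also have "\<dots> = norm (G (\<zeta> k))" by (simp add: G_def norm_mult)
    also have "\<dots> \<le> (S + 1) / (2 * bdist (\<zeta> k))"
      unfolding S_def by (rule l2_growth[OF Gh l2 Z(1)])
    finally show ?thesis using b by (simp add: field_simps)
  qed
  note le = this
  obtain k where "(S + 1) / 2 / (3/4) < 2 ^ k" using real_arch_pow[of 2 "(S + 1) / 2 / (3/4)"] by auto
  hence "(S + 1) / 2 < 2 ^ k * (3/4)" by (simp add: field_simps)
  thus False using le[of k] by linarith
qed

section \<open>The reflection exchanging the two boundary circles\<close>

lemma annulus_flip:
  assumes "0 < r" "z \<in> annulus r"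
  shows "of_real r / z \<in> annulus r" "of_real r / (of_real r / z) = z" "z \<noteq> 0"
proof -
  have z: "r < norm z" "norm z < 1" using assms by (auto simp: annulus_def)
  show z0: "z \<noteq> 0" using z assms(1) by auto
  have n0: "0 < norm z" using z assms(1) by linarith
  have "r * norm z < r * 1" using z assms(1) by (intro mult_strict_left_mono) auto
  hence "r < r / norm z" using n0 by (simp add: pos_less_divide_eq)
  thus "of_real r / z \<in> annulus r" using z(1) n0 assms(1) by (simp add: annulus_def norm_divide)
  show "of_real r / (of_real r / z) = z" using assms(1) by simp
qed

definition flip :: "real \<Rightarrow> (complex \<Rightarrow> complex) \<Rightarrow> complex \<Rightarrow> complex" where
  "flip r f z = f (of_real r / z)"

lemma flip_flip: "0 < r \<Longrightarrow> z \<in> annulus r \<Longrightarrow> flip r (flip r f) z = f z"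
  by (simp add: flip_def annulus_flip)

lemma flip_laurent:
  assumes f: "has_laurent r f c" and r: "0 < r"
  shows "has_laurent r (flip r f) (\<lambda>m. c (- m) * of_real (r powi (- m)))"
  unfolding has_laurent_def
proof
  fix z assume z: "z \<in> annulus r"
  have "((\<lambda>n. c n * (of_real r / z) powi n) has_sum flip r f z) UNIV"
    unfolding flip_def by (rule has_laurentD[OF f annulus_flip(1)[OF r z]])
  moreover have "c n * (of_real r / z) powi n = c (- (- n)) * of_real (r powi (- (- n))) * z powi (- n)" for n
    by (simp add: power_int_divide_distrib power_int_minus_divide)
  ultimately have "((\<lambda>n. c (- (- n)) * of_real (r powi (- (- n))) * z powi (- n)) has_sum flip r f z) UNIV"
    by (simp only:)
  thus "((\<lambda>m. c (- m) * of_real (r powi (- m)) * z powi m) has_sum flip r f z) UNIV"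
    by (subst has_sum_reindex_bij_witness[where i = uminus and j = uminus
          and h = "\<lambda>n. c (- (- n)) * of_real (r powi (- (- n))) * z powi (- n)" and T = UNIV]) auto
qed

text \<open>
  The reflection \<open>z \<mapsto> r / z\<close> sends \<open>z powi n\<close> to \<open>r powi n * z powi (- n)\<close>; this identity says that the weights
  are invariant under it.
\<close>

lemma H2A_weight_flip:
  assumes "0 < r"
  shows "H2A_weight r m * (r powi (- m))\<^sup>2 = H2A_weight r (- m)"
proof -
  have sq: "(r powi k)\<^sup>2 = r powi (2 * k)" for k
    using power_int_mult[of r k 2] by (simp add: mult.commute)
  have "r powi (2 * m) * r powi (2 * (- m)) = 1"
    using assms by (simp flip: power_int_add)
  thus ?thesis unfolding sq by (auto simp: H2A_weight_def)
qed

lemma flip_H2A: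
  assumes r: "0 < r" "r < 1" and f: "f \<in> H2A r"
  shows "flip r f \<in> H2A r" "H2A_norm r (flip r f) = H2A_norm r f"
proof -
  obtain c where c: "f holomorphic_on annulus r" "has_laurent r f c" "H2A_seq r c"
    using f by (auto simp: H2A_iff)
  let ?d = "\<lambda>m. c (- m) * complex_of_real (r powi (- m))"
  note L = flip_laurent[OF c(2) r(1)]
  have w: "H2A_weight r m * (norm (?d m))\<^sup>2 = H2A_weight r (- m) * (norm (c (- m)))\<^sup>2" for m
    using r by (simp add: H2A_weight_flip[OF r(1), symmetric] norm_mult power_mult_distrib norm_power_int mult_ac)
  have "((\<lambda>n. H2A_weight r n * (norm (c n))\<^sup>2) has_sum wt_sum r c) UNIV"
    unfolding wt_sum_def by (rule has_sum_infsum[OF c(3)[unfolded H2A_seq_def]])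
  hence "((\<lambda>m. H2A_weight r (- m) * (norm (c (- m)))\<^sup>2) has_sum wt_sum r c) UNIV"
    by (subst has_sum_reindex_bij_witness[where i = uminus and j = uminus
          and h = "\<lambda>n. H2A_weight r n * (norm (c n))\<^sup>2" and T = UNIV]) auto
  hence S: "((\<lambda>m. H2A_weight r m * (norm (?d m))\<^sup>2) has_sum wt_sum r c) UNIV" by (simp only: w)
  have "H2A_seq r ?d" using S unfolding H2A_seq_def by (rule has_sum_imp_summable)
  moreover have "flip r f holomorphic_on annulus r"
  proof -
    have "(\<lambda>z. of_real r / z) holomorphic_on annulus r"
      using annulus_flip(3)[OF r(1)] by (intro holomorphic_intros) auto
    moreover have "(\<lambda>z. of_real r / z) ` annulus r \<subseteq> annulus r"
      using annulus_flip(1)[OF r(1)] by blast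
    ultimately have "f \<circ> (\<lambda>z. of_real r / z) holomorphic_on annulus r"
      by (rule holomorphic_on_compose_gen[OF _ c(1)])
    thus ?thesis by (simp add: flip_def[abs_def] o_def)
  qed
  ultimately show "flip r f \<in> H2A r" using L by (auto simp: H2A_iff)
  have "wt_sum r ?d = wt_sum r c" unfolding wt_sum_def[of r ?d] by (rule infsumI[OF S])
  thus "H2A_norm r (flip r f) = H2A_norm r f"
    by (simp add: H2A_norm_eq[OF L r] H2A_norm_eq[OF c(2) r])
qed

lemma H2A_cong:
  assumes "\<And>z. z \<in> annulus r \<Longrightarrow> f z = g z"
  shows "f \<in> H2A r \<longleftrightarrow> g \<in> H2A r" "H2A_norm r f = H2A_norm r g"
proof -
  have L: "has_laurent r f = has_laurent r g"
    using has_laurent_cong[of r f g] assms by (auto simp: fun_eq_iff)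
  moreover have "f holomorphic_on annulus r \<longleftrightarrow> g holomorphic_on annulus r"
    by (rule holomorphic_cong) (use assms in auto)
  ultimately show "f \<in> H2A r \<longleftrightarrow> g \<in> H2A r" by (simp add: H2A_iff)
  show "H2A_norm r f = H2A_norm r g" by (simp add: H2A_norm_def laurent_coeff_def L)
qed

lemma multiplier_cong:
  assumes "\<And>z. z \<in> annulus r \<Longrightarrow> \<phi> z = \<psi> z"
  shows "\<phi> \<in> Mult_H2A r \<longleftrightarrow> \<psi> \<in> Mult_H2A r" "mult_norm r \<phi> = mult_norm r \<psi>" "subinner r \<phi> \<longleftrightarrow> subinner r \<psi>"
proof -
  have 1: "(\<lambda>z. \<phi> z * f z) \<in> H2A r \<longleftrightarrow> (\<lambda>z. \<psi> z * f z) \<in> H2A r"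
    and 2: "H2A_norm r (\<lambda>z. \<phi> z * f z) = H2A_norm r (\<lambda>z. \<psi> z * f z)" for f
    by (rule H2A_cong; simp add: assms)+
  show a: "\<phi> \<in> Mult_H2A r \<longleftrightarrow> \<psi> \<in> Mult_H2A r" by (simp add: Mult_H2A_def 1)
  show b: "mult_norm r \<phi> = mult_norm r \<psi>" by (simp add: mult_norm_def 2)
  show "subinner r \<phi> \<longleftrightarrow> subinner r \<psi>" by (simp add: subinner_def a b 2)
qed

context
  fixes r :: real assumes r: "0 < r" "r < 1"
begin

lemma flip_mult:
  assumes "\<phi> \<in> Mult_H2A r" "f \<in> H2A r"
  shows "(\<lambda>z. flip r \<phi> z * f z) \<in> H2A r"
    "H2A_norm r (\<lambda>z. flip r \<phi> z * f z) = H2A_norm r (\<lambda>z. \<phi> z * flip r f z)"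
proof -
  have "(\<lambda>z. \<phi> z * flip r f z) \<in> H2A r"
    using assms(1) flip_H2A(1)[OF r assms(2)] by (simp add: Mult_H2A_def)
  note F = flip_H2A[OF r this]
  have e: "flip r \<phi> z * f z = flip r (\<lambda>z. \<phi> z * flip r f z) z" if "z \<in> annulus r" for z
    using flip_flip[OF r(1) that, of f] by (simp add: flip_def)
  show "(\<lambda>z. flip r \<phi> z * f z) \<in> H2A r" using H2A_cong(1)[OF e] F(1) by simp
  show "H2A_norm r (\<lambda>z. flip r \<phi> z * f z) = H2A_norm r (\<lambda>z. \<phi> z * flip r f z)"
    using H2A_cong(2)[OF e] F(2) by simp
qed

lemma flip_Mult: "\<phi> \<in> Mult_H2A r \<Longrightarrow> flip r \<phi> \<in> Mult_H2A r"
  unfolding Mult_H2A_def[of r] using flip_mult(1) by (auto simp: Mult_H2A_def)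

lemma flip_mult_norm_le:
  assumes "\<phi> \<in> Mult_H2A r"
  shows "mult_norm r (flip r \<phi>) \<le> mult_norm r \<phi>"
  unfolding mult_norm_def[of r "flip r \<phi>"]
proof (rule SUP_least)
  fix f assume f: "f \<in> {f \<in> H2A r. H2A_norm r f \<le> 1}"
  hence "flip r f \<in> H2A r" "H2A_norm r (flip r f) \<le> 1" using flip_H2A[OF r, of f] by auto
  from mult_norm_ge[OF this, of \<phi>]
  show "ereal (H2A_norm r (\<lambda>z. flip r \<phi> z * f z)) \<le> mult_norm r \<phi>"
    using flip_mult(2)[OF assms, of f] f by simp
qed

lemma flip_mult_norm:
  assumes "\<phi> \<in> Mult_H2A r"
  shows "mult_norm r (flip r \<phi>) = mult_norm r \<phi>"
proof (rule antisym[OF flip_mult_norm_le[OF assms]])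
  have "mult_norm r \<phi> = mult_norm r (flip r (flip r \<phi>))"
    by (rule multiplier_cong(2)) (simp add: flip_flip r)
  also have "\<dots> \<le> mult_norm r (flip r \<phi>)" by (rule flip_mult_norm_le[OF flip_Mult[OF assms]])
  finally show "mult_norm r \<phi> \<le> mult_norm r (flip r \<phi>)" .
qed

lemma flip_subinner_imp:
  assumes "subinner r \<phi>"
  shows "subinner r (flip r \<phi>)"
proof -
  have m: "\<phi> \<in> Mult_H2A r" "mult_norm r \<phi> = 1" using assms by (auto simp: subinner_def)
  obtain h z where h: "h \<in> H2A r" "z \<in> annulus r" "h z \<noteq> 0"
    "H2A_norm r (\<lambda>z. \<phi> z * h z) = H2A_norm r h"
    using assms by (auto simp: subinner_def)
  have f: "flip r h \<in> H2A r" "H2A_norm r (flip r h) = H2A_norm r h" using flip_H2A[OF r h(1)] by auto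
  have "flip r h (of_real r / z) \<noteq> 0" using h(3) annulus_flip(2)[OF r(1) h(2)] by (simp add: flip_def)
  hence nz: "\<exists>z\<in>annulus r. flip r h z \<noteq> 0" using annulus_flip(1)[OF r(1) h(2)] by blast
  have "H2A_norm r (\<lambda>z. flip r \<phi> z * flip r h z) = H2A_norm r (\<lambda>z. \<phi> z * flip r (flip r h) z)"
    by (rule flip_mult(2)[OF m(1) f(1)])
  also have "\<dots> = H2A_norm r (\<lambda>z. \<phi> z * h z)"
    by (rule H2A_cong(2)) (simp add: flip_flip r)
  also have "\<dots> = H2A_norm r (flip r h)" using h(4) f(2) by simp
  finally have "H2A_norm r (\<lambda>z. flip r \<phi> z * flip r h z) = H2A_norm r (flip r h)" .
  with nz f(1) flip_Mult[OF m(1)] flip_mult_norm[OF m(1)] m(2) show ?thesis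
    unfolding subinner_def by auto
qed

lemma flip_subinner: "subinner r (flip r \<phi>) \<longleftrightarrow> subinner r \<phi>"
proof
  assume "subinner r (flip r \<phi>)"
  hence "subinner r (flip r (flip r \<phi>))" by (rule flip_subinner_imp)
  thus "subinner r \<phi>" by (subst (asm) multiplier_cong(3)[of r _ \<phi>]) (simp_all add: flip_flip r)
qed (rule flip_subinner_imp)

end

lemma Hinf_ext_disk:
  assumes r: "0 < r" and \<phi>: "\<phi> \<in> Hinf_ext r"
  obtains g where "g \<in> Hinf_disk" "\<And>z. r < norm z \<Longrightarrow> \<phi> z = g (of_real r / z)"
proof -
  obtain a where a: "(\<lambda>w. if w = 0 then a else \<phi> (1 / w)) holomorphic_on ball 0 (1 / r)"
    and b: "bounded (\<phi> ` {z. r < norm z})" using \<phi> by (auto simp: Hinf_ext_def)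
  define g where "g w = (if w = 0 then a else \<phi> (of_real r / w))" for w
  have "(\<lambda>w. w / of_real r) holomorphic_on ball 0 1" using r by (intro holomorphic_intros) auto
  moreover have "(\<lambda>w. w / complex_of_real r) ` ball 0 1 \<subseteq> ball 0 (1 / r)"
  proof (intro image_subsetI)
    fix w :: complex assume "w \<in> ball 0 1"
    hence "norm w / r < 1 / r" using r by (intro divide_strict_right_mono) auto
    thus "w / of_real r \<in> ball 0 (1 / r)" using r by (simp add: norm_divide)
  qed
  ultimately have "(\<lambda>w. if w = 0 then a else \<phi> (1 / w)) \<circ> (\<lambda>w. w / of_real r) holomorphic_on ball 0 1"
    by (rule holomorphic_on_compose_gen[OF _ a])
  also have "(\<lambda>w. if w = 0 then a else \<phi> (1 / w)) \<circ> (\<lambda>w. w / of_real r) = g"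
    using r by (auto simp: g_def fun_eq_iff)
  finally have hol: "g holomorphic_on ball 0 1" .
  have "g ` ball 0 1 \<subseteq> insert a (\<phi> ` {z. r < norm z})"
  proof
    fix x assume "x \<in> g ` ball 0 1"
    then obtain w where w: "norm w < 1" "x = g w" by auto
    show "x \<in> insert a (\<phi> ` {z. r < norm z})"
    proof (cases "w = 0")
      case False
      hence "r < norm (of_real r / w)" using w(1) r by (simp add: norm_divide field_simps)
      thus ?thesis using False w(2) by (auto simp: g_def)
    qed (simp add: w g_def)
  qed
  hence "bounded (g ` ball 0 1)" by (rule bounded_subset[rotated]) (use b in simp)
  hence "g \<in> Hinf_disk" using hol by (simp add: Hinf_disk_def)
  moreover have "\<phi> z = g (of_real r / z)" if "r < norm z" for z
  proof -
    have "z \<noteq> 0" using that r by auto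
    thus ?thesis using r by (simp add: g_def)
  qed
  ultimately show ?thesis using that by blast
qed

text \<open>
  The representing function on the disk is determined away from \<open>0\<close>, hence so are its radial limits.
\<close>

lemma inner_ext_iff:
  assumes r: "0 < r" and g: "g \<in> Hinf_disk" and eq: "\<And>z. r < norm z \<Longrightarrow> \<phi> z = g (of_real r / z)"
  shows "inner_ext r \<phi> \<longleftrightarrow> inner_disk g"
proof
  assume "inner_disk g"
  thus "inner_ext r \<phi>" using eq unfolding inner_ext_def by blast
next
  assume "inner_ext r \<phi>"
  then obtain g' where g': "inner_disk g'" "\<And>z. r < norm z \<Longrightarrow> \<phi> z = g' (of_real r / z)"
    unfolding inner_ext_def by blast
  have same: "g w = g' w" if "w \<noteq> 0" "norm w < 1" for w
  proof -
    have "r < norm (of_real r / w)" using that r by (simp add: norm_divide field_simps)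
    from eq[OF this] g'(2)[OF this] show ?thesis using that r by simp
  qed
  have H': "g' \<in> Hinf_disk" using g'(1) by (simp add: inner_disk_def)
  have "AE t in circ. \<exists>L. norm L = 1 \<and> ((\<lambda>\<rho>. g (of_real \<rho> * cis t)) \<longlongrightarrow> L) (at_left 1)"
    using g'(1)[unfolded inner_disk_iff[OF H']]
  proof eventually_elim
    case (elim t)
    then obtain L where L: "norm L = 1" "((\<lambda>\<rho>. g' (of_real \<rho> * cis t)) \<longlongrightarrow> L) (at_left 1)" by blast
    have "\<forall>\<^sub>F \<rho> in at_left 1. 0 < \<rho> \<and> \<rho> < (1::real)"
      using zero_less_one eventually_at_left_field by blast
    hence "\<forall>\<^sub>F \<rho> in at_left 1. g' (of_real \<rho> * cis t) = g (of_real \<rho> * cis t)"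
      by eventually_elim (auto intro!: same[symmetric] simp: norm_mult)
    from Lim_transform_eventually[OF L(2) this] show ?case using L(1) by blast
  qed
  thus "inner_disk g" by (simp add: inner_disk_iff[OF g])
qed

theorem theorem1p2:
  fixes r :: real
  assumes "0 < r" and "r < 1"
  shows "Mult_H2A r \<inter> Hol_disk = Hinf_disk \<and>
    (\<forall>\<phi> \<in> Mult_H2A r \<inter> Hol_disk. inner_disk \<phi> \<longleftrightarrow> subinner r \<phi>) \<and>
    (\<forall>\<phi> \<in> Hinf_ext r. inner_ext r \<phi> \<longleftrightarrow> subinner r \<phi>)"
proof -
  have iff: "inner_disk \<phi> \<longleftrightarrow> subinner r \<phi>" if "\<phi> \<in> Hinf_disk" for \<phi>
    using inner_imp_subinner[OF assms] subinner_imp_inner[OF assms that] by blast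
  have "\<phi> \<in> Hinf_disk" if "\<phi> \<in> Mult_H2A r \<inter> Hol_disk" for \<phi>
    using multiplier_disk_bounded[OF assms] that by (auto simp: Hol_disk_def Hinf_disk_def)
  moreover have "\<phi> \<in> Mult_H2A r \<inter> Hol_disk" if H: "\<phi> \<in> Hinf_disk" for \<phi>
  proof -
    obtain B where B: "0 \<le> B" "\<phi> holomorphic_on ball 0 1" "\<And>z. z \<in> ball 0 1 \<Longrightarrow> norm (\<phi> z) \<le> B"
      using Hinf_diskD[OF H] by metis
    have "norm (\<phi> z) \<le> B" if "z \<in> annulus r" for z using B(3) annulus_subset_ball that by blast
    from H2A_disk_mult(1)[OF assms B(2) this B(1)] show ?thesis
      using B(2) by (simp add: Mult_H2A_def Hol_disk_def)
  qed
  ultimately have eq: "Mult_H2A r \<inter> Hol_disk = Hinf_disk" by blast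
  have ext: "inner_ext r \<phi> \<longleftrightarrow> subinner r \<phi>" if \<phi>: "\<phi> \<in> Hinf_ext r" for \<phi>
  proof -
    obtain g where g: "g \<in> Hinf_disk" "\<And>z. r < norm z \<Longrightarrow> \<phi> z = g (of_real r / z)"
      using Hinf_ext_disk[OF assms(1) \<phi>] by blast
    have "inner_ext r \<phi> \<longleftrightarrow> inner_disk g" by (rule inner_ext_iff[OF assms(1) g])
    also have "\<dots> \<longleftrightarrow> subinner r (flip r g)" unfolding iff[OF g(1)] flip_subinner[OF assms] ..
    also have "\<dots> \<longleftrightarrow> subinner r \<phi>"
      by (rule multiplier_cong(3)) (simp add: flip_def annulus_def g(2))
    finally show ?thesis .
  qed
  show ?thesis using eq iff ext by simp
qed

end
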